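(* Let $(X,\mathcal{B},\mu)$ be a probability space and $T_1,\dots,T_k$ measurable transformations of $(X,\mathcal{B})$ such that each $T_i$ has an invariant probability measure $\mu_i$ equivalent to $\mu$. The following are equivalent: (i) $T_1,\dots,T_k$ are jointly ergodic with respect to $(\mu;\mu_1,\dots,\mu_k)$, i.e. for all $f_1,\dots,f_k\in L^\infty$, $\lim_{N\to\infty}\frac1N\sum_{n=0}^{N-1}T_1^nf_1\cdots T_k^nf_k=\prod_i\int f_i\,d\mu_i$ in $L^2(\mu)$; (ii) for all bounded measurable $f_0,\dots,f_k$, $\lim_{N\to\infty}\frac1N\sum_{n=1}^N\int f_0\cdot T_1^nf_1\cdots T_k^nf_k\,d\mu=\int f_0\,d\mu\prod_{i=1}^k\int f_i\,d\mu_i$; (iii) (a) $T_1\times\cdots\times T_k$ is ergodic w.r.t. $\mu_1\times\cdots\times\mu_k$ and (b) for all bounded measurable $f_1,\dots,f_k$, $\lim_{N\to\infty}\frac1N\sum_{n=1}^N\int T_1^nf_1\cdots T_k^nf_k\,d\mu=\prod_i\int f_i\,d\mu_i$; (iv) (a) $T_1\times\cdots\times T_k$ is ergodic w.r.t. $\mu_1\times\cdots\times\mu_k$ and (b) there is $C>0$ such that for all $A_1,\dots,A_k\in\mathcal{B}$, $\limsup_{N\to\infty}\frac1N\sum_{n=1}^N\mu(T_1^{-n}A_1\cap\cdots\cap T_k^{-n}A_k)\le C\prod_i\mu_i(A_i)$.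
   Context: $T^nf:=f\circ T^n$. The probability space is a compact metric space with its Borel $\sigma$-algebra. *)

theory Defs
  imports "HOL-Probability.Probability"
begin

definition invariant_measure :: "'b measure \<Rightarrow> ('b \<Rightarrow> 'b) \<Rightarrow> bool" where
  "invariant_measure N S \<longleftrightarrow> S \<in> measurable N N \<and> distr N N S = N"

definition ergodic :: "'b measure \<Rightarrow> ('b \<Rightarrow> 'b) \<Rightarrow> bool" where
  "ergodic N S \<longleftrightarrow> invariant_measure N S \<and>
     (\<forall>A\<in>sets N. S -` A \<inter> space N = A \<longrightarrow> emeasure N A = 0 \<or> emeasure N A = 1)"

definition equivalent_measures :: "'b measure \<Rightarrow> 'b measure \<Rightarrow> bool" where
  "equivalent_measures M N \<longleftrightarrow> sets M = sets N \<and> null_sets M = null_sets N"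

definition product_map :: "nat \<Rightarrow> (nat \<Rightarrow> 'a \<Rightarrow> 'a) \<Rightarrow> (nat \<Rightarrow> 'a) \<Rightarrow> (nat \<Rightarrow> 'a)" where
  "product_map k T = (\<lambda>\<omega>. \<lambda>i\<in>{1..k}. T i (\<omega> i))"

definition bounded_meas :: "'a measure \<Rightarrow> ('a \<Rightarrow> real) \<Rightarrow> bool" where
  "bounded_meas M f \<longleftrightarrow> f \<in> borel_measurable M \<and> bounded (f ` space M)"

end

theory Submission
  imports Defs
begin

text \<open>Write \<open>F = f\<^sub>1 \<otimes> \<dots> \<otimes> f\<^sub>k\<close>, \<open>S = T\<^sub>1 \<times> \<dots> \<times> T\<^sub>k\<close>,
  \<open>\<nu> = \<mu>\<^sub>1 \<times> \<dots> \<times> \<mu>\<^sub>k\<close> and \<open>p = \<integral>F d\<nu>\<close>. (i) gives (ii) by integrating against \<open>f\<^sub>0\<close>,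
  and (iii) gives (iv) with \<open>C = 1\<close>.

  (ii) implies that \<open>S\<close> is ergodic: split each \<open>f\<^sub>i\<close> into an almost periodic part and a part orthogonal
  to all almost periodic functions. The latter is weakly mixing, and a tensor product with a weakly
  mixing factor has ergodic averages tending to \<open>0\<close> in \<open>L\<^sup>2(\<nu>)\<close>. If all \<open>f\<^sub>i\<close> are almost periodic, then the
  functions \<open>\<Prod> f\<^sub>i(T\<^sub>i\<^bsup>n+v(i)\<^esup> x)\<close> form a totally bounded set, so the weak convergence in (ii) is strong
  and uniform in \<open>v\<close>; averaging its square over \<open>v\<close> turns the diagonal into \<open>\<nu>\<close>, since each \<open>T\<^sub>i\<close> is
  ergodic. Hence the averages of \<open>F \<circ> S\<^sup>n\<close> tend to \<open>p\<close> in \<open>L\<^sup>2(\<nu>)\<close>.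

  (iv) implies (i): let \<open>\<beta>\<close> be the average of \<open>F \<circ> S\<^sup>h\<close> over \<open>h < H\<close>, for large \<open>H\<close>. The averages in (i) are close
  to averages of \<open>\<beta>(S\<^sup>n(x, \<dots>, x))\<close>, so by convexity their squared distance to \<open>p\<close> is at most the mean of
  \<open>\<integral>(\<beta>(S\<^sup>n(x, \<dots>, x)) - p)\<^sup>2 d\<mu>\<close>, which the domination in (iv) bounds by \<open>C \<integral>(\<beta> - p)\<^sup>2 d\<nu>\<close>; this is small
  by the mean ergodic theorem for \<open>S\<close>.\<close>

section \<open>Bounded measurable functions\<close>

text \<open>The obstacle is that \<mu> need not be invariant under any \<open>T i\<close>:
  correlations over \<mu> do not depend on time differences alone, so no van der Corput argument
  runs on the diagonal. Invariance holds for each \<open>\<mu> i\<close> separately, hence for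
  \<nu>, and only common null sets link \<open>\<mu> i\<close> with \<mu>. Densities may be
  unbounded, but on uniformly bounded functions smallness in L1 passes from one measure to the
  other. This is why all functions are bounded, and why weak mixing is exploited only over \<nu>,
  where correlations factor over the coordinates.

  Ergodicity of each \<open>T i\<close>, on which the averaging over multitimes rests, comes from
  (ii) with all other functions equal to 1.

  Limits are genuine bounded functions rather than classes: L2 projections arise from minimising
  sequences of bounded functions and are realised as pointwise limits along a subsequence. Almost
  periodicity means that the forward orbit is totally bounded in L1, which avoids complex
  eigenfunctions and makes sense for transformations without inverse.\<close>

lemma bounded_measI:
  assumes "f \<in> borel_measurable M" "\<And>x. x \<in> space M \<Longrightarrow> \<bar>f x\<bar> \<le> B"
  shows "bounded_meas M f"
  using assms unfolding bounded_meas_def bounded_iff by auto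

lemma bounded_measE:
  assumes "bounded_meas M f"
  obtains B where "B \<ge> 1" "\<And>x. x \<in> space M \<Longrightarrow> \<bar>f x\<bar> \<le> B"
proof -
  from assms obtain B where "\<forall>x\<in>space M. \<bar>f x\<bar> \<le> B"
    unfolding bounded_meas_def bounded_iff by auto
  then have "\<bar>f x\<bar> \<le> max 1 B" if "x \<in> space M" for x using that by fastforce
  then show thesis using that[of "max 1 B"] by auto
qed

lemma bounded_meas_measurable [measurable_dest]: "bounded_meas M f \<Longrightarrow> f \<in> borel_measurable M"
  by (simp add: bounded_meas_def)

named_theorems bounded_meas_intros

lemma bounded_meas_const [bounded_meas_intros]: "bounded_meas M (\<lambda>x. c)"
  by (rule bounded_measI[of _ _ "\<bar>c\<bar>"]) auto

lemma bounded_meas_add [bounded_meas_intros]: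
  assumes "bounded_meas M f" "bounded_meas M g"
  shows "bounded_meas M (\<lambda>x. f x + g x)"
proof -
  obtain A B where "\<And>x. x \<in> space M \<Longrightarrow> \<bar>f x\<bar> \<le> A" "\<And>x. x \<in> space M \<Longrightarrow> \<bar>g x\<bar> \<le> B"
    using assms by (metis bounded_measE)
  then have "\<bar>f x + g x\<bar> \<le> A + B" if "x \<in> space M" for x
    using that by (meson abs_triangle_ineq add_mono order_trans)
  then show ?thesis using assms by (intro bounded_measI) auto
qed

lemma bounded_meas_mult [bounded_meas_intros]:
  assumes "bounded_meas M f" "bounded_meas M g"
  shows "bounded_meas M (\<lambda>x. f x * g x)"
proof -
  obtain A B where AB: "\<And>x. x \<in> space M \<Longrightarrow> \<bar>f x\<bar> \<le> A" "\<And>x. x \<in> space M \<Longrightarrow> \<bar>g x\<bar> \<le> B"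
    using assms by (metis bounded_measE)
  then have "\<bar>f x * g x\<bar> \<le> A * B" if "x \<in> space M" for x
    unfolding abs_mult using AB[OF that] by (intro mult_mono order_trans[OF abs_ge_zero]) auto
  then show ?thesis using assms by (intro bounded_measI) auto
qed

lemma bounded_meas_uminus [bounded_meas_intros]: "bounded_meas M f \<Longrightarrow> bounded_meas M (\<lambda>x. - f x)"
  using bounded_meas_mult[OF bounded_meas_const[of M "-1"]] by fastforce

lemma bounded_meas_diff [bounded_meas_intros]:
  "bounded_meas M f \<Longrightarrow> bounded_meas M g \<Longrightarrow> bounded_meas M (\<lambda>x. f x - g x)"
  using bounded_meas_add[OF _ bounded_meas_uminus] by fastforce

lemma bounded_meas_divide [bounded_meas_intros]: "bounded_meas M f \<Longrightarrow> bounded_meas M (\<lambda>x. f x / c)"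
  using bounded_meas_mult[OF _ bounded_meas_const[of M "1/c"], of f] by simp

lemma bounded_meas_abs [bounded_meas_intros]: "bounded_meas M f \<Longrightarrow> bounded_meas M (\<lambda>x. \<bar>f x\<bar>)"
  by (auto simp: bounded_meas_def bounded_iff)

lemma bounded_meas_power [bounded_meas_intros]: "bounded_meas M f \<Longrightarrow> bounded_meas M (\<lambda>x. f x ^ n)"
  by (induction n) (auto intro: bounded_meas_intros)

lemma bounded_meas_sum [bounded_meas_intros]:
  "(\<And>i. i \<in> I \<Longrightarrow> bounded_meas M (f i)) \<Longrightarrow> bounded_meas M (\<lambda>x. \<Sum>i\<in>I. f i x)"
  by (induction I rule: infinite_finite_induct) (auto intro: bounded_meas_intros)

lemma bounded_meas_prod [bounded_meas_intros]:
  "(\<And>i. i \<in> I \<Longrightarrow> bounded_meas M (f i)) \<Longrightarrow> bounded_meas M (\<lambda>x. \<Prod>i\<in>I. f i x)"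
  by (induction I rule: infinite_finite_induct) (auto intro: bounded_meas_intros)

lemma bounded_meas_comp:
  assumes "bounded_meas N f" "T \<in> measurable M N"
  shows "bounded_meas M (\<lambda>x. f (T x))"
proof -
  obtain B where "\<And>x. x \<in> space N \<Longrightarrow> \<bar>f x\<bar> \<le> B" using assms(1) by (metis bounded_measE)
  then show ?thesis
    using measurable_space[OF assms(2)] measurable_compose[OF assms(2) bounded_meas_measurable[OF assms(1)]]
    by (intro bounded_measI[of _ _ B]) auto
qed

lemma bounded_meas_indicator [bounded_meas_intros]: "A \<in> sets M \<Longrightarrow> bounded_meas M (indicator A)"
  by (rule bounded_measI[of _ _ 1]) (auto simp: indicator_def)

lemma bounded_meas_integrable:
  assumes "finite_measure M" "bounded_meas M f" shows "integrable M f"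
proof -
  obtain B where "\<And>x. x \<in> space M \<Longrightarrow> \<bar>f x\<bar> \<le> B" using assms(2) by (metis bounded_measE)
  then show ?thesis
    using assms by (intro finite_measure.integrable_const_bound[of _ _ B]) auto
qed

section \<open>Estimates in L1 and L2 over a probability space\<close>

context prob_space
begin

lemma integrable_bounded_meas [bounded_meas_intros]: "bounded_meas M f \<Longrightarrow> integrable M f"
  by (rule bounded_meas_integrable[OF finite_measure_axioms])

lemma integral_le_bound:
  fixes f :: "'a \<Rightarrow> real"
  assumes "bounded_meas M f" "\<And>x. x \<in> space M \<Longrightarrow> f x \<le> B" shows "(\<integral>x. f x \<partial>M) \<le> B"
proof -
  have "(\<integral>x. f x \<partial>M) \<le> (\<integral>x. B \<partial>M)"
    using assms by (intro integral_mono bounded_meas_intros) auto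
  then show ?thesis by (simp add: prob_space)
qed

lemma abs_integral_le_bound:
  assumes "bounded_meas M f" "\<And>x. x \<in> space M \<Longrightarrow> \<bar>f x\<bar> \<le> B" shows "\<bar>\<integral>x. f x \<partial>M\<bar> \<le> B"
  using integral_abs_bound[of M f] integral_le_bound[OF bounded_meas_abs[OF assms(1)] assms(2)]
  by linarith

text \<open>The variance of \<open>\<bar>f\<bar>\<close> is nonnegative, the total mass being
  1.\<close>

lemma integral_abs_square_le:
  assumes "bounded_meas M f" shows "(\<integral>x. \<bar>f x\<bar> \<partial>M)\<^sup>2 \<le> (\<integral>x. (f x)\<^sup>2 \<partial>M)"
proof -
  let ?c = "\<integral>x. \<bar>f x\<bar> \<partial>M"
  have "0 \<le> (\<integral>x. (\<bar>f x\<bar> - ?c)\<^sup>2 \<partial>M)" by simp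
  also have "\<dots> = (\<integral>x. (f x)\<^sup>2 - 2 * ?c * \<bar>f x\<bar> + ?c\<^sup>2 \<partial>M)"
    by (intro Bochner_Integration.integral_cong) (auto simp: power2_eq_square algebra_simps)
  also have "\<dots> = (\<integral>x. (f x)\<^sup>2 \<partial>M) - 2 * ?c * ?c + ?c\<^sup>2"
    using assms by (simp add: bounded_meas_intros prob_space)
  finally show ?thesis by (simp add: power2_eq_square)
qed

lemma integral_abs_le_of_square:
  assumes "bounded_meas M f" "(\<integral>x. (f x)\<^sup>2 \<partial>M) \<le> e\<^sup>2" "e \<ge> 0" shows "(\<integral>x. \<bar>f x\<bar> \<partial>M) \<le> e"
  using integral_abs_square_le[OF assms(1)] assms(2,3)
  by (metis order_trans power2_le_imp_le)

lemma integral_square_le_abs: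
  assumes "bounded_meas M f" "\<And>x. x \<in> space M \<Longrightarrow> \<bar>f x\<bar> \<le> B"
  shows "(\<integral>x. (f x)\<^sup>2 \<partial>M) \<le> B * (\<integral>x. \<bar>f x\<bar> \<partial>M)"
proof -
  have "(\<integral>x. (f x)\<^sup>2 \<partial>M) \<le> (\<integral>x. B * \<bar>f x\<bar> \<partial>M)"
  proof (intro integral_mono bounded_meas_intros assms)
    fix x assume "x \<in> space M"
    then show "(f x)\<^sup>2 \<le> B * \<bar>f x\<bar>"
      using assms(2)[of x] mult_right_mono[of "\<bar>f x\<bar>" B "\<bar>f x\<bar>"] by (simp add: power2_eq_square)
  qed
  then show ?thesis by simp
qed

lemma abs_integral_mult_le:
  assumes "bounded_meas M f" "bounded_meas M g" "\<And>x. x \<in> space M \<Longrightarrow> \<bar>g x\<bar> \<le> B"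
  shows "\<bar>\<integral>x. g x * f x \<partial>M\<bar> \<le> B * (\<integral>x. \<bar>f x\<bar> \<partial>M)"
proof -
  have "\<bar>\<integral>x. g x * f x \<partial>M\<bar> \<le> (\<integral>x. \<bar>g x * f x\<bar> \<partial>M)" by (rule integral_abs_bound)
  also have "\<dots> \<le> (\<integral>x. B * \<bar>f x\<bar> \<partial>M)"
    using assms by (intro integral_mono bounded_meas_intros) (auto simp: abs_mult intro: mult_right_mono)
  finally show ?thesis by simp
qed

lemma integral_abs_triangle:
  assumes "bounded_meas M f" "bounded_meas M g" "bounded_meas M h"
  shows "(\<integral>x. \<bar>f x - h x\<bar> \<partial>M) \<le> (\<integral>x. \<bar>f x - g x\<bar> \<partial>M) + (\<integral>x. \<bar>g x - h x\<bar> \<partial>M)"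
proof -
  have "(\<integral>x. \<bar>f x - h x\<bar> \<partial>M) \<le> (\<integral>x. \<bar>f x - g x\<bar> + \<bar>g x - h x\<bar> \<partial>M)"
    using assms by (intro integral_mono bounded_meas_intros) auto
  also have "\<dots> = (\<integral>x. \<bar>f x - g x\<bar> \<partial>M) + (\<integral>x. \<bar>g x - h x\<bar> \<partial>M)"
    using assms by (intro Bochner_Integration.integral_add bounded_meas_intros)
  finally show ?thesis .
qed

text \<open>Minimisation and the mean ergodic theorem live in L2, whereas limits, total boundedness
  and the change of measure live in L1. This lemma and the next one pass between the two; the way
  back uses a uniform bound.\<close>

lemma tendsto_L1_of_L2:
  assumes "\<And>n. bounded_meas M (u n)" "(\<lambda>n. \<integral>x. (u n x)\<^sup>2 \<partial>M) \<longlonglongrightarrow> 0"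
  shows "(\<lambda>n. \<integral>x. \<bar>u n x\<bar> \<partial>M) \<longlonglongrightarrow> 0"
proof (rule tendsto_sandwich[of "\<lambda>n. 0" _ _ "\<lambda>n. sqrt (\<integral>x. (u n x)\<^sup>2 \<partial>M)"])
  show "\<forall>\<^sub>F n in sequentially. (\<integral>x. \<bar>u n x\<bar> \<partial>M) \<le> sqrt (\<integral>x. (u n x)\<^sup>2 \<partial>M)"
    using integral_abs_square_le[OF assms(1)] by (intro always_eventually allI real_le_rsqrt)
  show "(\<lambda>n. sqrt (\<integral>x. (u n x)\<^sup>2 \<partial>M)) \<longlonglongrightarrow> 0"
    using tendsto_real_sqrt[OF assms(2)] by simp
qed auto

lemma tendsto_L2_of_L1:
  assumes "\<And>n. bounded_meas M (u n)" "\<And>n x. x \<in> space M \<Longrightarrow> \<bar>u n x\<bar> \<le> B"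
    "(\<lambda>n. \<integral>x. \<bar>u n x\<bar> \<partial>M) \<longlonglongrightarrow> 0"
  shows "(\<lambda>n. \<integral>x. (u n x)\<^sup>2 \<partial>M) \<longlonglongrightarrow> 0"
proof (rule tendsto_sandwich[of "\<lambda>n. 0" _ _ "\<lambda>n. B * (\<integral>x. \<bar>u n x\<bar> \<partial>M)"])
  show "\<forall>\<^sub>F n in sequentially. (\<integral>x. (u n x)\<^sup>2 \<partial>M) \<le> B * (\<integral>x. \<bar>u n x\<bar> \<partial>M)"
    using integral_square_le_abs[OF assms(1,2)] by (intro always_eventually allI)
  show "(\<lambda>n. B * (\<integral>x. \<bar>u n x\<bar> \<partial>M)) \<longlonglongrightarrow> 0"
    using tendsto_mult_left[OF assms(3), of B] by simp
qed auto

text \<open>Along a subsequence with consecutive L1 distances at most \<open>(1/2)^k\<close> the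
  increments are summable almost everywhere. The explicit formula for \<open>h\<close> is part of
  the conclusion because the mean ergodic theorem reads off from it that its limit is invariant at
  every point, not only almost everywhere.\<close>

lemma L1_Cauchy_bounded:
  fixes u :: "nat \<Rightarrow> 'a \<Rightarrow> real"
  assumes meas: "\<And>n. bounded_meas M (u n)" and bd: "\<And>n x. x \<in> space M \<Longrightarrow> \<bar>u n x\<bar> \<le> B"
    and C: "\<And>e. e > 0 \<Longrightarrow> \<exists>n0. \<forall>m\<ge>n0. \<forall>n\<ge>n0. (\<integral>x. \<bar>u m x - u n x\<bar> \<partial>M) < e"
  obtains r :: "nat \<Rightarrow> nat" and h where "strict_mono r"
    "h = (\<lambda>x. if Cauchy (\<lambda>k. u (r k) x) then lim (\<lambda>k. u (r k) x) else 0)"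
    "bounded_meas M h" "\<And>x. x \<in> space M \<Longrightarrow> \<bar>h x\<bar> \<le> B"
    "(\<lambda>n. \<integral>x. \<bar>u n x - h x\<bar> \<partial>M) \<longlonglongrightarrow> 0"
proof -
  have [measurable]: "u n \<in> borel_measurable M" for n using meas by (rule bounded_meas_measurable)
  have "\<forall>k. \<exists>n0. \<forall>m\<ge>n0. \<forall>n\<ge>n0. (\<integral>x. \<bar>u m x - u n x\<bar> \<partial>M) < (1/2)^k"
    using C by simp
  then obtain N where N: "\<And>k m n. m \<ge> N k \<Longrightarrow> n \<ge> N k \<Longrightarrow> (\<integral>x. \<bar>u m x - u n x\<bar> \<partial>M) < (1/2)^k"
    by metis
  \<comment> \<open>Partial sums of \<open>Suc (N j)\<close> increase strictly and stay above
    \<open>N k\<close>.\<close>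
  define r where "r k = (\<Sum>j\<le>k. Suc (N j))" for k
  have r: "strict_mono r" unfolding r_def by (intro strict_monoI_Suc) auto
  have rN: "N k \<le> r k" for k
    unfolding r_def by (cases k) auto
  have rd: "(\<integral>x. \<bar>u (r (Suc k)) x - u (r k) x\<bar> \<partial>M) \<le> (1/2)^k" for k
    using N[of k "r (Suc k)" "r k"] rN[of k] r by (meson le_SucI lessI less_imp_le order_trans strict_mono_less_eq)
  define h where "h = (\<lambda>x. if Cauchy (\<lambda>k. u (r k) x) then lim (\<lambda>k. u (r k) x) else 0)"
  have hm[measurable]: "h \<in> borel_measurable M" unfolding h_def by measurable
  have hB: "\<bar>h x\<bar> \<le> B" if x: "x \<in> space M" for x
  proof (cases "Cauchy (\<lambda>k. u (r k) x)")
    case True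
    then have "(\<lambda>k. \<bar>u (r k) x\<bar>) \<longlonglongrightarrow> \<bar>h x\<bar>"
      by (auto simp: h_def Cauchy_convergent_iff convergent_LIMSEQ_iff intro!: tendsto_rabs)
    then show ?thesis using bd[OF x] by (intro LIMSEQ_le_const2) auto
  next
    case False
    then show ?thesis using order_trans[OF abs_ge_zero bd[OF x]] by (simp add: h_def)
  qed
  have hbm: "bounded_meas M h" using hm hB by (rule bounded_measI)
  have "(\<integral>\<^sup>+x. (\<Sum>k. ennreal \<bar>u (r (Suc k)) x - u (r k) x\<bar>) \<partial>M)
      = (\<Sum>k. \<integral>\<^sup>+x. ennreal \<bar>u (r (Suc k)) x - u (r k) x\<bar> \<partial>M)"
    by (intro nn_integral_suminf) measurable
  also have "\<dots> \<le> (\<Sum>k. ennreal ((1/2)^k))"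
  proof (intro suminf_le)
    fix k show "(\<integral>\<^sup>+x. ennreal \<bar>u (r (Suc k)) x - u (r k) x\<bar> \<partial>M) \<le> ennreal ((1/2)^k)"
      using rd[of k] by (subst nn_integral_eq_integral) (auto intro!: bounded_meas_intros meas ennreal_leI)
  qed auto
  also have "\<dots> < \<top>"
    by (subst suminf_ennreal2) (auto simp: summable_geometric)
  finally have "AE x in M. (\<Sum>k. ennreal \<bar>u (r (Suc k)) x - u (r k) x\<bar>) \<noteq> \<infinity>"
    by (intro nn_integral_noteq_infinite) auto
  then have AEC: "AE x in M. (\<lambda>k. u (r k) x) \<longlonglongrightarrow> h x"
  proof eventually_elim
    case (elim x)
    then have "summable (\<lambda>k. \<bar>u (r (Suc k)) x - u (r k) x\<bar>)"
      by (intro summable_suminf_not_top) auto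
    then have "summable (\<lambda>k. u (r (Suc k)) x - u (r k) x)" by (rule summable_rabs_cancel)
    then have "convergent (\<lambda>n. (\<Sum>k<n. u (r (Suc k)) x - u (r k) x))"
      by (simp add: summable_iff_convergent)
    then have "convergent (\<lambda>n. u (r n) x - u (r 0) x)"
      unfolding sum_lessThan_telescope[of "\<lambda>k. u (r k) x"] .
    then have "convergent (\<lambda>n. u (r n) x - u (r 0) x + u (r 0) x)"
      by (intro convergent_add convergent_const)
    then show ?case by (auto simp: h_def Cauchy_convergent_iff convergent_LIMSEQ_iff)
  qed
  have "(\<lambda>n. \<integral>x. \<bar>u n x - h x\<bar> \<partial>M) \<longlonglongrightarrow> 0"
  proof (rule LIMSEQ_I)
    fix e :: real assume "e > 0"
    then obtain n0 where n0: "\<And>m n. m \<ge> n0 \<Longrightarrow> n \<ge> n0 \<Longrightarrow> (\<integral>x. \<bar>u m x - u n x\<bar> \<partial>M) < e/2"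
      using C[of "e/2"] by auto
    \<comment> \<open>With \<open>n\<close> fixed, the other index of the Cauchy condition runs
      along the subsequence; \<open>B + B\<close> dominates.\<close>
    have "(\<integral>x. \<bar>u n x - h x\<bar> \<partial>M) \<le> e/2" if n: "n \<ge> n0" for n
    proof (rule LIMSEQ_le_const2)
      show "(\<lambda>k. \<integral>x. \<bar>u n x - u (r k) x\<bar> \<partial>M) \<longlonglongrightarrow> (\<integral>x. \<bar>u n x - h x\<bar> \<partial>M)"
      proof (rule integral_dominated_convergence[where w="\<lambda>x. B + B"])
        show "AE x in M. (\<lambda>k. \<bar>u n x - u (r k) x\<bar>) \<longlonglongrightarrow> \<bar>u n x - h x\<bar>"
          using AEC by eventually_elim (intro tendsto_intros)
        show "AE x in M. norm \<bar>u n x - u (r k) x\<bar> \<le> B + B" for k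
          using bd[of _ n] bd[of _ "r k"] by (intro AE_I2) (simp, smt (verit))
      qed auto
      show "\<exists>k0. \<forall>k\<ge>k0. (\<integral>x. \<bar>u n x - u (r k) x\<bar> \<partial>M) \<le> e/2"
        using n0[OF n] seq_suble[OF r] by (meson less_imp_le order_trans)
    qed
    moreover have "0 \<le> (\<integral>x. \<bar>u n x - h x\<bar> \<partial>M)" for n by simp
    ultimately show "\<exists>no. \<forall>n\<ge>no. norm ((\<integral>x. \<bar>u n x - h x\<bar> \<partial>M) - 0) < e"
      using \<open>e > 0\<close> by (intro exI[of _ n0]) fastforce
  qed
  then show thesis using that r h_def hbm hB by blast
qed

text \<open>By the parallelogram law the squared distance of two elements is twice the sum of their
  squared norms minus four times that of their midpoint. The midpoint stays above \<open>d\<close>,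
  which both squared norms approach.\<close>

lemma minimizing_sequence_Cauchy:
  fixes u :: "nat \<Rightarrow> 'a \<Rightarrow> real"
  assumes meas: "\<And>n. bounded_meas M (u n)"
    and lim: "(\<lambda>n. \<integral>x. (u n x)\<^sup>2 \<partial>M) \<longlonglongrightarrow> d"
    and mid: "\<And>m n. d \<le> (\<integral>x. ((u m x + u n x) / 2)\<^sup>2 \<partial>M)"
    and e: "e > 0"
  shows "\<exists>n0. \<forall>m\<ge>n0. \<forall>n\<ge>n0. (\<integral>x. (u m x - u n x)\<^sup>2 \<partial>M) < e"
proof -
  have eq: "(\<integral>x. (u m x - u n x)\<^sup>2 \<partial>M)
      = 2 * (\<integral>x. (u m x)\<^sup>2 \<partial>M) + 2 * (\<integral>x. (u n x)\<^sup>2 \<partial>M) - 4 * (\<integral>x. ((u m x + u n x) / 2)\<^sup>2 \<partial>M)" for m n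
  proof -
    have "(\<integral>x. (u m x - u n x)\<^sup>2 \<partial>M)
      = (\<integral>x. 2 * (u m x)\<^sup>2 + 2 * (u n x)\<^sup>2 - 4 * ((u m x + u n x) / 2)\<^sup>2 \<partial>M)"
      by (intro Bochner_Integration.integral_cong) (auto simp: power2_eq_square field_simps)
    then show ?thesis by (simp add: bounded_meas_intros meas)
  qed
  obtain n0 where n0: "\<And>n. n \<ge> n0 \<Longrightarrow> \<bar>(\<integral>x. (u n x)\<^sup>2 \<partial>M) - d\<bar> < e/4"
    using LIMSEQ_D[OF lim, of "e/4"] e by auto
  show ?thesis
  proof (intro exI[of _ n0] allI impI)
    fix m n assume "m \<ge> n0" "n \<ge> n0"
    then show "(\<integral>x. (u m x - u n x)\<^sup>2 \<partial>M) < e"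
      unfolding eq using n0[of m] n0[of n] mid[of m n] by linarith
  qed
qed

end

section \<open>Means and the mean ergodic theorem\<close>

text \<open>The range \<open>n < N\<close> is that of condition (i); \<open>cesaro_from_1\<close>
  treats the range from 1 to \<open>N\<close> of the other conditions. Division by zero gives zero,
  so \<open>cesaro a 0 = 0\<close>, which is why several facts below assume \<open>N > 0\<close> or
  use \<open>Suc N\<close>.\<close>

definition cesaro :: "(nat \<Rightarrow> real) \<Rightarrow> nat \<Rightarrow> real" where
  "cesaro a N = (1 / real N) * (\<Sum>n<N. a n)"

lemma cesaro_add: "cesaro (\<lambda>n. a n + b n) N = cesaro a N + cesaro b N"
  by (simp add: cesaro_def sum.distrib algebra_simps)

lemma cesaro_diff: "cesaro (\<lambda>n. a n - b n) N = cesaro a N - cesaro b N"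
  by (simp add: cesaro_def sum_subtractf algebra_simps)

lemma cesaro_cmult: "cesaro (\<lambda>n. c * a n) N = c * cesaro a N"
  by (simp add: cesaro_def flip: sum_distrib_left)

lemma cesaro_mult_right: "cesaro (\<lambda>n. a n * c) N = cesaro a N * c"
  by (simp add: cesaro_def flip: sum_distrib_right)

lemma cesaro_sum: "cesaro (\<lambda>n. \<Sum>i\<in>I. a i n) N = (\<Sum>i\<in>I. cesaro (a i) N)"
  unfolding cesaro_def by (subst sum.swap) (simp add: sum_distrib_left)

lemma cesaro_const: "N > 0 \<Longrightarrow> cesaro (\<lambda>n. c) N = c"
  by (simp add: cesaro_def)

lemma cesaro_mono: "(\<And>n. a n \<le> b n) \<Longrightarrow> cesaro a N \<le> cesaro b N"
  by (simp add: cesaro_def sum_mono divide_right_mono)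

lemma cesaro_nonneg: "(\<And>n. 0 \<le> a n) \<Longrightarrow> 0 \<le> cesaro a N"
  by (simp add: cesaro_def sum_nonneg)

lemma abs_cesaro_le: "\<bar>cesaro a N\<bar> \<le> cesaro (\<lambda>n. \<bar>a n\<bar>) N"
  by (simp add: cesaro_def abs_mult divide_right_mono)

lemma abs_cesaro_le_bound: "(\<And>n. \<bar>a n\<bar> \<le> B) \<Longrightarrow> \<bar>cesaro a N\<bar> \<le> B"
proof -
  assume B: "\<And>n. \<bar>a n\<bar> \<le> B"
  have "\<bar>cesaro a N\<bar> \<le> cesaro (\<lambda>n. \<bar>a n\<bar>) N" by (rule abs_cesaro_le)
  also have "\<dots> \<le> cesaro (\<lambda>n. B) N" using B by (rule cesaro_mono)
  also have "\<dots> \<le> B"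
    using order_trans[OF abs_ge_zero B[of 0]] by (cases "N = 0") (auto simp: cesaro_def)
  finally show ?thesis .
qed

lemma abs_cesaro_le_bound_lt:
  assumes "\<And>n. n < N \<Longrightarrow> \<bar>a n\<bar> \<le> B" "B \<ge> 0"
  shows "\<bar>cesaro a N\<bar> \<le> B"
proof -
  have "cesaro a N = cesaro (\<lambda>n. if n < N then a n else 0) N" by (simp add: cesaro_def)
  then show ?thesis using assms by (auto intro!: abs_cesaro_le_bound)
qed

lemma cesaro_swap: "cesaro (\<lambda>n. cesaro (\<lambda>h. a n h) H) N = cesaro (\<lambda>h. cesaro (\<lambda>n. a n h) N) H"
  unfolding cesaro_def sum_distrib_left[symmetric]
  by (subst sum.swap) (simp add: mult.left_commute)

lemma tendsto_cesaro: "(\<And>n. (\<lambda>K. a K n) \<longlonglongrightarrow> b n) \<Longrightarrow> (\<lambda>K. cesaro (a K) N) \<longlonglongrightarrow> cesaro b N"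
  unfolding cesaro_def by (intro tendsto_mult_left tendsto_sum)

text \<open>Again a variance is nonnegative, now for the uniform distribution on the first
  \<open>N\<close> indices.\<close>

lemma cesaro_square_le: "(cesaro a N)\<^sup>2 \<le> cesaro (\<lambda>n. (a n)\<^sup>2) N"
proof (cases "N = 0")
  case False
  let ?c = "cesaro a N"
  have "0 \<le> cesaro (\<lambda>n. (a n - ?c)\<^sup>2) N" by (rule cesaro_nonneg) simp
  also have "(\<lambda>n. (a n - ?c)\<^sup>2) = (\<lambda>n. (a n)\<^sup>2 - 2 * ?c * a n + ?c\<^sup>2)"
    by (auto simp: power2_eq_square algebra_simps)
  also have "cesaro \<dots> N = cesaro (\<lambda>n. (a n)\<^sup>2) N - 2 * ?c * ?c + ?c\<^sup>2"
    using False by (simp add: cesaro_add cesaro_diff cesaro_cmult cesaro_const)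
  finally show ?thesis by (simp add: power2_eq_square)
qed (simp add: cesaro_def)

lemma cesaro_to_const: "(\<lambda>N. cesaro (\<lambda>n. c) N) \<longlonglongrightarrow> c"
  by (rule tendsto_eventually)
    (auto simp: eventually_sequentially cesaro_const intro!: exI[of _ 1])

text \<open>Both sums are pieces of the sum of the first \<open>N + j\<close> terms; the difference
  consists of \<open>j\<close> terms at each end.\<close>

lemma abs_sum_lessThan_shift_le:
  fixes a :: "nat \<Rightarrow> real"
  assumes "\<And>n. \<bar>a n\<bar> \<le> B"
  shows "\<bar>(\<Sum>n<N. a (n + j)) - (\<Sum>n<N. a n)\<bar> \<le> 2 * real j * B"
proof -
  have "(\<Sum>n<N + j. a n) = (\<Sum>n<j. a n) + (\<Sum>n<N. a (n + j))"
    by (induction N) auto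
  moreover have "(\<Sum>n<N + j. a n) = (\<Sum>n<N. a n) + (\<Sum>n<j. a (n + N))"
    by (induction j) (auto simp: add.commute)
  ultimately have "(\<Sum>n<N. a (n + j)) - (\<Sum>n<N. a n) = (\<Sum>n<j. a (n + N)) - (\<Sum>n<j. a n)"
    by simp
  moreover have "\<bar>\<Sum>n<j. a (n + N)\<bar> \<le> j * B" "\<bar>\<Sum>n<j. a n\<bar> \<le> j * B"
    using sum_norm_bound[of "{..<j}" "\<lambda>n. a (n + N)" B] sum_norm_bound[of "{..<j}" a B] assms by auto
  ultimately show ?thesis by linarith
qed

lemma abs_cesaro_shift_le:
  assumes "\<And>n. \<bar>a n\<bar> \<le> B"
  shows "\<bar>cesaro (\<lambda>n. a (n + j)) N - cesaro a N\<bar> \<le> 2 * real j * B / real N"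
proof -
  have "\<bar>cesaro (\<lambda>n. a (n + j)) N - cesaro a N\<bar> = \<bar>(\<Sum>n<N. a (n + j)) - (\<Sum>n<N. a n)\<bar> / real N"
    unfolding cesaro_def by (simp add: abs_divide flip: diff_divide_distrib)
  then show ?thesis using abs_sum_lessThan_shift_le[of a B j N] assms by (simp add: divide_right_mono)
qed

lemma tendsto_const_over_nat: "(\<lambda>N. c / real N) \<longlonglongrightarrow> 0"
  using tendsto_mult_left[OF lim_1_over_n, of c] by simp

lemma cesaro_shift_tendsto:
  assumes "\<And>n. \<bar>a n\<bar> \<le> B"
  shows "(\<lambda>N. cesaro (\<lambda>n. a (n + j)) N - cesaro a N) \<longlonglongrightarrow> 0"
  by (rule Lim_null_comparison[OF _ tendsto_const_over_nat[of "2 * real j * B"]])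
    (use abs_cesaro_shift_le[of a B j] assms in \<open>auto intro!: always_eventually\<close>)

lemma cesaro_from_1: "(1 / real N) * (\<Sum>n=1..N. a n) = cesaro (\<lambda>n. a (Suc n)) N"
proof -
  have "(\<Sum>n=1..N. a n) = (\<Sum>n<N. a (Suc n))"
    using sum.atLeast1_atMost_eq[of a N] by simp
  then show ?thesis by (simp add: cesaro_def)
qed

text \<open>The two ranges differ by a shift, which has no effect in the limit for a bounded
  sequence.\<close>

lemma cesaro_from_1_tendsto_iff:
  assumes "\<And>n. \<bar>a n\<bar> \<le> B"
  shows "(\<lambda>N. (1 / real N) * (\<Sum>n=1..N. a n)) \<longlonglongrightarrow> L \<longleftrightarrow> cesaro a \<longlonglongrightarrow> L"
proof -
  have d: "(\<lambda>N. cesaro (\<lambda>n. a (Suc n)) N - cesaro a N) \<longlonglongrightarrow> 0"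
    using cesaro_shift_tendsto[of a B 1] assms by simp
  show ?thesis
    unfolding cesaro_from_1
    using tendsto_diff[OF _ d, of "cesaro (\<lambda>n. a (Suc n))" L] tendsto_add[OF _ d, of "cesaro a" L]
    by auto
qed

lemma cesaro_abs_tendsto_0:
  assumes "cesaro (\<lambda>n. (a n)\<^sup>2) \<longlonglongrightarrow> 0"
  shows "cesaro (\<lambda>n. \<bar>a n\<bar>) \<longlonglongrightarrow> 0"
proof (rule tendsto_sandwich[of "\<lambda>n. 0" _ _ "\<lambda>N. sqrt (cesaro (\<lambda>n. (a n)\<^sup>2) N)"])
  show "\<forall>\<^sub>F N in sequentially. cesaro (\<lambda>n. \<bar>a n\<bar>) N \<le> sqrt (cesaro (\<lambda>n. (a n)\<^sup>2) N)"
    using cesaro_square_le[of "\<lambda>n. \<bar>a n\<bar>"] by (intro always_eventually allI real_le_rsqrt) simp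
  show "(\<lambda>N. sqrt (cesaro (\<lambda>n. (a n)\<^sup>2) N)) \<longlonglongrightarrow> 0"
    using tendsto_real_sqrt[OF assms] by simp
qed (auto intro!: always_eventually cesaro_nonneg)

lemma bounded_meas_cesaro [bounded_meas_intros]:
  "(\<And>n. bounded_meas M (f n)) \<Longrightarrow> bounded_meas M (\<lambda>x. cesaro (\<lambda>n. f n x) N)"
  unfolding cesaro_def by (intro bounded_meas_intros)

lemma (in prob_space) integral_cesaro:
  "(\<And>n. bounded_meas M (f n)) \<Longrightarrow> (\<integral>x. cesaro (\<lambda>n. f n x) N \<partial>M) = cesaro (\<lambda>n. \<integral>x. f n x \<partial>M) N"
  unfolding cesaro_def by (simp add: bounded_meas_intros)

section \<open>Measure-preserving systems and the mean ergodic theorem\<close>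

locale measure_preserving = prob_space M for M :: "'a measure" +
  fixes T :: "'a \<Rightarrow> 'a"
  assumes invariant: "invariant_measure M T"
begin

lemma T_meas [measurable]: "T \<in> measurable M M"
  using invariant by (simp add: invariant_measure_def)

lemma Tn_meas [measurable]: "(T ^^ n) \<in> measurable M M"
  by (rule measurable_compose_n[OF T_meas])

lemma Tn_space: "x \<in> space M \<Longrightarrow> (T ^^ n) x \<in> space M"
  using measurable_space[OF Tn_meas] .

lemma T_space: "x \<in> space M \<Longrightarrow> T x \<in> space M"
  using measurable_space[OF T_meas] .

lemma Tn_Tm: "(T ^^ n) ((T ^^ m) x) = (T ^^ (n + m)) x"
  by (simp add: funpow_add)

lemma distr_Tn: "distr M M (T ^^ n) = M"
proof (induction n)
  case (Suc n)
  have "distr M M (T ^^ Suc n) = distr (distr M M (T ^^ n)) M T"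
    by (subst distr_distr) auto
  then show ?case using Suc invariant by (simp only: invariant_measure_def)
qed (simp add: id_def distr_id2)

lemma integral_Tn:
  fixes f :: "'a \<Rightarrow> real"
  assumes [measurable]: "f \<in> borel_measurable M"
  shows "(\<integral>x. f ((T ^^ n) x) \<partial>M) = (\<integral>x. f x \<partial>M)"
  using integral_distr[of "T ^^ n" M M f] by (simp add: distr_Tn)

lemma bounded_meas_Tn [bounded_meas_intros]: "bounded_meas M f \<Longrightarrow> bounded_meas M (\<lambda>x. f ((T ^^ n) x))"
  by (rule bounded_meas_comp[OF _ Tn_meas])

definition avg :: "('a \<Rightarrow> real) \<Rightarrow> nat \<Rightarrow> 'a \<Rightarrow> real" where
  "avg f N x = cesaro (\<lambda>n. f ((T ^^ n) x)) N"

lemma bounded_meas_avg [bounded_meas_intros]: "bounded_meas M f \<Longrightarrow> bounded_meas M (avg f N)"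
  using bounded_meas_cesaro[of M "\<lambda>n x. f ((T ^^ n) x)" N] by (simp add: avg_def[abs_def] bounded_meas_intros)

lemma abs_avg_le:
  assumes "\<And>x. x \<in> space M \<Longrightarrow> \<bar>f x\<bar> \<le> B" "x \<in> space M" shows "\<bar>avg f N x\<bar> \<le> B"
  unfolding avg_def using assms Tn_space by (intro abs_cesaro_le_bound) auto

lemma integral_avg:
  assumes "bounded_meas M f" "N > 0" shows "(\<integral>x. avg f N x \<partial>M) = (\<integral>x. f x \<partial>M)"
  unfolding avg_def using assms
  by (subst integral_cesaro) (auto simp: integral_Tn bounded_meas_measurable bounded_meas_intros cesaro_const)

text \<open>Convexity moves the square inside the average, where invariance makes all terms
  equal.\<close>

lemma integral_avg_square_le:
  assumes f: "bounded_meas M f" shows "(\<integral>x. (avg f N x)\<^sup>2 \<partial>M) \<le> (\<integral>x. (f x)\<^sup>2 \<partial>M)"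
proof -
  have [measurable]: "f \<in> borel_measurable M" using f by (rule bounded_meas_measurable)
  have "(\<integral>x. (avg f N x)\<^sup>2 \<partial>M) \<le> (\<integral>x. cesaro (\<lambda>n. (f ((T ^^ n) x))\<^sup>2) N \<partial>M)"
    unfolding avg_def by (intro integral_mono bounded_meas_intros f cesaro_square_le)
  also have "\<dots> = cesaro (\<lambda>n. \<integral>x. (f x)\<^sup>2 \<partial>M) N"
    using f by (subst integral_cesaro) (auto simp: integral_Tn[of "\<lambda>x. (f x)\<^sup>2"] bounded_meas_intros)
  also have "\<dots> \<le> (\<integral>x. (f x)\<^sup>2 \<partial>M)" by (cases "N = 0") (auto simp: cesaro_const, simp add: cesaro_def)
  finally show ?thesis .
qed

text \<open>The averages of \<open>f\<close> asymptotically minimise the \<open>L\<^sup>2\<close> norm over the convex set of all bounded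
  functions with the same ergodic sums up to a bounded error, so they are Cauchy by the
  parallelogram law.\<close>

lemma avg_Cauchy:
  assumes f: "bounded_meas M f" and e: "e > 0"
  shows "\<exists>n0. \<forall>m\<ge>n0. \<forall>n\<ge>n0. (\<integral>x. (avg f m x - avg f n x)\<^sup>2 \<partial>M) < e"
proof -
  define C where "C = {c. bounded_meas M c \<and>
    (\<exists>B. \<forall>N. \<forall>x\<in>space M. \<bar>(\<Sum>n<N. c ((T ^^ n) x)) - (\<Sum>n<N. f ((T ^^ n) x))\<bar> \<le> B)}"
  define d where "d = (INF c\<in>C. \<integral>x. (c x)\<^sup>2 \<partial>M)"
  obtain Bf where Bf: "\<And>x. x \<in> space M \<Longrightarrow> \<bar>f x\<bar> \<le> Bf" and "Bf \<ge> 1" using f by (metis bounded_measE)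
  have fC: "f \<in> C" unfolding C_def using f by (auto intro!: exI[of _ 0])
  have dC: "d \<le> (\<integral>x. (c x)\<^sup>2 \<partial>M)" if "c \<in> C" for c
    unfolding d_def using that by (intro cINF_lower bdd_belowI[of _ 0]) auto
  \<comment> \<open>Averaging displaces the ergodic sums by at most \<open>J\<close> indices at each
    end, a bound independent of \<open>N\<close>. The index \<open>Suc J\<close> excludes
    \<open>avg f 0\<close>, the zero function, which need not lie in \<open>C\<close>.\<close>
  have avgC: "avg f (Suc J) \<in> C" for J
  proof -
    have "\<bar>(\<Sum>n<N. avg f (Suc J) ((T ^^ n) x)) - (\<Sum>n<N. f ((T ^^ n) x))\<bar> \<le> 2 * real (Suc J) * Bf"
      if x: "x \<in> space M" for N x
    proof -
      let ?S = "\<lambda>j. \<Sum>n<N. f ((T ^^ (n + j)) x)"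
      have "(\<Sum>n<N. avg f (Suc J) ((T ^^ n) x)) = cesaro ?S (Suc J)"
        unfolding avg_def by (simp add: Tn_Tm cesaro_sum add.commute)
      then have "(\<Sum>n<N. avg f (Suc J) ((T ^^ n) x)) - ?S 0 = cesaro (\<lambda>j. ?S j - ?S 0) (Suc J)"
        by (simp add: cesaro_diff cesaro_const)
      also have "\<dots> = (1 / real (Suc J)) * (\<Sum>j<Suc J. ?S j - ?S 0)"
        by (simp add: cesaro_def)
      also have "\<bar>\<dots>\<bar> \<le> (1 / real (Suc J)) * (\<Sum>j<Suc J. \<bar>?S j - ?S 0\<bar>)"
        unfolding abs_mult by (intro mult_mono sum_abs) auto
      also have "\<dots> \<le> (1 / real (Suc J)) * (\<Sum>j<Suc J. 2 * real (Suc J) * Bf)"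
      proof (intro mult_left_mono sum_mono)
        fix j assume "j \<in> {..<Suc J}"
        then have "2 * real j * Bf \<le> 2 * real (Suc J) * Bf"
          using \<open>Bf \<ge> 1\<close> by (intro mult_right_mono) auto
        then show "\<bar>?S j - ?S 0\<bar> \<le> 2 * real (Suc J) * Bf"
          using abs_sum_lessThan_shift_le[of "\<lambda>n. f ((T ^^ n) x)" Bf j N] Bf Tn_space[OF x] by simp
      qed simp
      also have "\<dots> = 2 * real (Suc J) * Bf" by (simp del: of_nat_Suc)
      finally show ?thesis by simp
    qed
    then show ?thesis unfolding C_def using f by (auto intro!: bounded_meas_intros)
  qed
  have mid: "(\<lambda>x. (c x + c' x) / 2) \<in> C" if "c \<in> C" "c' \<in> C" for c c'
  proof -
    from that obtain B B' where
      *: "\<And>N x. x \<in> space M \<Longrightarrow> \<bar>(\<Sum>n<N. c ((T ^^ n) x)) - (\<Sum>n<N. f ((T ^^ n) x))\<bar> \<le> B"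
         "\<And>N x. x \<in> space M \<Longrightarrow> \<bar>(\<Sum>n<N. c' ((T ^^ n) x)) - (\<Sum>n<N. f ((T ^^ n) x))\<bar> \<le> B'"
      unfolding C_def by blast
    have "\<bar>(\<Sum>n<N. (c ((T ^^ n) x) + c' ((T ^^ n) x)) / 2) - (\<Sum>n<N. f ((T ^^ n) x))\<bar> \<le> (B + B') / 2"
      if "x \<in> space M" for N x
    proof -
      have "(\<Sum>n<N. (c ((T ^^ n) x) + c' ((T ^^ n) x)) / 2)
          = ((\<Sum>n<N. c ((T ^^ n) x)) + (\<Sum>n<N. c' ((T ^^ n) x))) / 2"
        by (simp add: sum.distrib flip: sum_divide_distrib)
      then show ?thesis using *[OF that, of N] unfolding abs_le_iff by (simp add: field_simps)
    qed
    then have "\<exists>B. \<forall>N. \<forall>x\<in>space M.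
        \<bar>(\<Sum>n<N. (c ((T ^^ n) x) + c' ((T ^^ n) x)) / 2) - (\<Sum>n<N. f ((T ^^ n) x))\<bar> \<le> B" by blast
    then show ?thesis using that unfolding C_def by (auto intro!: bounded_meas_intros)
  qed
  have lim: "(\<lambda>N. \<integral>x. (avg f N x)\<^sup>2 \<partial>M) \<longlonglongrightarrow> d"
  proof (rule LIMSEQ_I)
    fix e :: real assume e: "e > 0"
    then obtain c where c: "c \<in> C" "(\<integral>x. (c x)\<^sup>2 \<partial>M) < d + e / 2"
      using cInf_lessD[of "(\<lambda>c. \<integral>x. (c x)\<^sup>2 \<partial>M) ` C" "d + e / 2"] fC unfolding d_def by auto
    then obtain B where B: "\<And>N x. x \<in> space M \<Longrightarrow> \<bar>(\<Sum>n<N. c ((T ^^ n) x)) - (\<Sum>n<N. f ((T ^^ n) x))\<bar> \<le> B"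
      and cb: "bounded_meas M c"
      unfolding C_def by blast
    obtain Bc where Bc: "\<And>x. x \<in> space M \<Longrightarrow> \<bar>c x\<bar> \<le> Bc" "Bc \<ge> 1" using cb by (metis bounded_measE)
    \<comment> \<open>The averages of \<open>c\<close> and of \<open>f\<close> differ by at most
      \<open>B / real N\<close>, and averaging does not increase the norm of \<open>c\<close>; so
      asymptotically \<open>avg f N\<close> is no larger in norm than any competitor
      \<open>c\<close>.\<close>
    have up: "(\<integral>x. (avg f N x)\<^sup>2 \<partial>M) \<le> (\<integral>x. (c x)\<^sup>2 \<partial>M) + (Bf + Bc) * B / real N" for N
    proof -
      have pt: "(avg f N x)\<^sup>2 \<le> (avg c N x)\<^sup>2 + (Bf + Bc) * B / real N" if x: "x \<in> space M" for x
      proof -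
        have "\<bar>avg c N x - avg f N x\<bar> \<le> B / real N"
          unfolding avg_def cesaro_def
          using B[OF x, of N] by (simp add: abs_divide divide_right_mono flip: diff_divide_distrib)
        moreover have "\<bar>avg f N x + avg c N x\<bar> \<le> Bf + Bc"
          using abs_avg_le[of f Bf x N] abs_avg_le[of c Bc x N] Bf Bc x by (smt (verit))
        ultimately have "\<bar>avg f N x + avg c N x\<bar> * \<bar>avg c N x - avg f N x\<bar> \<le> (Bf + Bc) * (B / real N)"
          by (intro mult_mono) auto
        then have "\<bar>(avg f N x + avg c N x) * (avg c N x - avg f N x)\<bar> \<le> (Bf + Bc) * B / real N"
          by (simp add: abs_mult)
        moreover have "(avg f N x + avg c N x) * (avg c N x - avg f N x) = (avg c N x)\<^sup>2 - (avg f N x)\<^sup>2"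
          by (simp add: power2_eq_square algebra_simps)
        ultimately show ?thesis by linarith
      qed
      have "(\<integral>x. (avg f N x)\<^sup>2 \<partial>M) \<le> (\<integral>x. (avg c N x)\<^sup>2 + (Bf + Bc) * B / real N \<partial>M)"
        using pt by (intro integral_mono bounded_meas_intros f cb)
      also have "\<dots> = (\<integral>x. (avg c N x)\<^sup>2 \<partial>M) + (Bf + Bc) * B / real N"
        using f cb by (subst Bochner_Integration.integral_add) (auto intro!: bounded_meas_intros simp: prob_space)
      also have "\<dots> \<le> (\<integral>x. (c x)\<^sup>2 \<partial>M) + (Bf + Bc) * B / real N"
        using integral_avg_square_le[OF cb] by simp
      finally show ?thesis .
    qed
    obtain n0 where n0: "\<And>n. n \<ge> n0 \<Longrightarrow> \<bar>(Bf + Bc) * B / real n\<bar> < e / 2"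
      using LIMSEQ_D[OF tendsto_const_over_nat[of "(Bf + Bc) * B"], of "e/2"] e by auto
    show "\<exists>no. \<forall>n\<ge>no. norm ((\<integral>x. (avg f n x)\<^sup>2 \<partial>M) - d) < e"
    proof (intro exI[of _ "Suc n0"] allI impI)
      fix n assume n: "n \<ge> Suc n0"
      then have "d \<le> (\<integral>x. (avg f n x)\<^sup>2 \<partial>M)" using dC[OF avgC[of "n - 1"]] by simp
      moreover have "(Bf + Bc) * B / real n < e / 2"
        using n0[of n] n unfolding abs_less_iff by simp
      ultimately show "norm ((\<integral>x. (avg f n x)\<^sup>2 \<partial>M) - d) < e"
        using up[of n] c(2) e unfolding real_norm_def abs_less_iff by linarith
    qed
  qed
  have "(\<lambda>N. \<integral>x. (avg f (Suc N) x)\<^sup>2 \<partial>M) \<longlonglongrightarrow> d" using lim by (rule LIMSEQ_Suc)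
  from minimizing_sequence_Cauchy[OF _ this, of e]
  obtain n0 where n0: "\<forall>m\<ge>n0. \<forall>n\<ge>n0. (\<integral>x. (avg f (Suc m) x - avg f (Suc n) x)\<^sup>2 \<partial>M) < e"
    using e f dC[OF mid[OF avgC avgC]] by (auto intro!: bounded_meas_intros)
  have "(\<integral>x. (avg f m x - avg f n x)\<^sup>2 \<partial>M) < e" if "m \<ge> Suc n0" "n \<ge> Suc n0" for m n
    using n0[rule_format, of "m - 1" "n - 1"] that by simp
  then show ?thesis by blast
qed

text \<open>The limit exists by completeness. It is invariant everywhere because the averages at
  \<open>T x\<close> and at \<open>x\<close> differ by O(1/N): the subsequence defining
  \<open>g\<close> is Cauchy at both points or at neither, with the same limit.\<close>

lemma mean_ergodic:
  assumes f: "bounded_meas M f"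
  obtains g where "bounded_meas M g" "\<And>x. x \<in> space M \<Longrightarrow> g (T x) = g x"
    "(\<lambda>N. \<integral>x. (avg f N x - g x)\<^sup>2 \<partial>M) \<longlonglongrightarrow> 0"
proof -
  obtain B where B: "\<And>x. x \<in> space M \<Longrightarrow> \<bar>f x\<bar> \<le> B" using f by (metis bounded_measE)
  have aB: "\<bar>avg f n x\<bar> \<le> B" if "x \<in> space M" for n x using abs_avg_le[of f B x n] B that by simp
  have C: "\<exists>n0. \<forall>m\<ge>n0. \<forall>n\<ge>n0. (\<integral>x. \<bar>avg f m x - avg f n x\<bar> \<partial>M) < e" if e: "e > 0" for e
  proof -
    obtain n0 where n0: "\<And>m n. m \<ge> n0 \<Longrightarrow> n \<ge> n0 \<Longrightarrow> (\<integral>x. (avg f m x - avg f n x)\<^sup>2 \<partial>M) < (e/2)\<^sup>2"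
      using avg_Cauchy[OF f, of "(e/2)\<^sup>2"] e by auto
    have "(\<integral>x. \<bar>avg f m x - avg f n x\<bar> \<partial>M) \<le> e/2" if "m \<ge> n0" "n \<ge> n0" for m n
      using n0[OF that] e f by (intro integral_abs_le_of_square bounded_meas_intros) auto
    then show ?thesis using e by (intro exI[of _ n0]) fastforce
  qed
  obtain r :: "nat \<Rightarrow> nat" and g where r: "strict_mono r"
    and g: "g = (\<lambda>x. if Cauchy (\<lambda>k. avg f (r k) x) then lim (\<lambda>k. avg f (r k) x) else 0)"
    "bounded_meas M g" "\<And>x. x \<in> space M \<Longrightarrow> \<bar>g x\<bar> \<le> B"
    "(\<lambda>n. \<integral>x. \<bar>avg f n x - g x\<bar> \<partial>M) \<longlonglongrightarrow> 0"
    using L1_Cauchy_bounded[OF bounded_meas_avg[OF f] aB C] by blast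
  have "g (T x) = g x" if x: "x \<in> space M" for x
  proof -
    have "(\<lambda>k. avg f k (T x) - avg f k x) \<longlonglongrightarrow> 0"
      using cesaro_shift_tendsto[of "\<lambda>n. f ((T ^^ n) x)" B 1] B Tn_space[OF x]
      unfolding avg_def by (simp add: funpow_swap1)
    then have d: "(\<lambda>k. avg f (r k) (T x) - avg f (r k) x) \<longlonglongrightarrow> 0"
      using LIMSEQ_subseq_LIMSEQ[OF _ r] by (fastforce simp: comp_def)
    have iff: "(\<lambda>k. avg f (r k) (T x)) \<longlonglongrightarrow> L \<longleftrightarrow> (\<lambda>k. avg f (r k) x) \<longlonglongrightarrow> L" for L
      using tendsto_diff[OF _ d, of "\<lambda>k. avg f (r k) (T x)" L]
        tendsto_add[OF _ d, of "\<lambda>k. avg f (r k) x" L] by auto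
    show ?thesis
      unfolding g(1) Cauchy_convergent_iff convergent_def lim_def iff ..
  qed
  moreover have "(\<lambda>N. \<integral>x. (avg f N x - g x)\<^sup>2 \<partial>M) \<longlonglongrightarrow> 0"
  proof (rule tendsto_L2_of_L1[where B="B + B"])
    show "\<bar>avg f n x - g x\<bar> \<le> B + B" if "x \<in> space M" for n x
      using aB[OF that, of n] g(3)[OF that] by linarith
  qed (use f g in \<open>auto intro!: bounded_meas_intros\<close>)
  ultimately show thesis using that g(2) by blast
qed

text \<open>Let the invariant limit \<open>g\<close> have mean \<open>m\<close>. The invariant set
  where \<open>g > m\<close> has measure 0 or 1. Measure 1 contradicts that \<open>g - m\<close> has
  integral 0, so \<open>g \<le> m\<close> almost everywhere, and the zero integral forces
  equality.\<close>

lemma mean_ergodic_const: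
  assumes erg: "ergodic M T" and f: "bounded_meas M f"
  shows "(\<lambda>N. \<integral>x. (avg f N x - (\<integral>y. f y \<partial>M))\<^sup>2 \<partial>M) \<longlonglongrightarrow> 0"
proof -
  obtain g where g: "bounded_meas M g" "\<And>x. x \<in> space M \<Longrightarrow> g (T x) = g x"
    "(\<lambda>N. \<integral>x. (avg f N x - g x)\<^sup>2 \<partial>M) \<longlonglongrightarrow> 0" using mean_ergodic[OF f] by blast
  have [measurable]: "g \<in> borel_measurable M" using g(1) by (rule bounded_meas_measurable)
  define m where "m = (\<integral>x. g x \<partial>M)"
  have tr: "emeasure M {x \<in> space M. P (g x)} = 0 \<or> emeasure M {x \<in> space M. P (g x)} = 1"
    if [measurable]: "Measurable.pred borel P" for P
  proof -
    have "{x \<in> space M. P (g x)} \<in> sets M" by measurable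
    moreover have "T -` {x \<in> space M. P (g x)} \<inter> space M = {x \<in> space M. P (g x)}"
      using T_space g(2) by auto
    ultimately show ?thesis using erg unfolding ergodic_def by blast
  qed
  have AE1: "AE x in M. P (g x)" if "emeasure M {x \<in> space M. P (g x)} = 1" "Measurable.pred borel P" for P
    using that by (subst AE_iff_emeasure_eq_1) (auto)
  have AE0: "AE x in M. \<not> P (g x)" if "emeasure M {x \<in> space M. P (g x)} = 0" "Measurable.pred borel P" for P
    using that by (subst AE_iff_measurable[OF _ refl]) auto
  have int: "integrable M (\<lambda>x. g x - m)" "(\<integral>x. g x - m \<partial>M) = 0"
    using g(1) by (auto simp: m_def bounded_meas_intros prob_space)
  have up: "AE x in M. g x \<le> m"
  proof -
    have "\<not> (AE x in M. g x > m)"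
    proof
      assume *: "AE x in M. g x > m"
      then have "AE x in M. 0 \<le> g x - m" by eventually_elim auto
      then have "AE x in M. g x - m = 0"
        using int(2) integral_nonneg_eq_0_iff_AE[OF int(1)] by blast
      with * have "AE x in M. False" by eventually_elim auto
      then show False using AE_False prob_space by simp
    qed
    then have "emeasure M {x \<in> space M. g x > m} = 0"
      using tr[of "\<lambda>t. t > m"] AE1[of "\<lambda>t. t > m"] by force
    then have "AE x in M. \<not> g x > m" by (rule AE0) simp
    then show ?thesis by eventually_elim auto
  qed
  then have "AE x in M. m - g x = 0"
    using int g(1) by (subst integral_nonneg_eq_0_iff_AE[symmetric]) (auto simp: bounded_meas_intros m_def prob_space)
  then have AEm: "AE x in M. g x = m" by eventually_elim auto
  have lim: "(\<lambda>N. \<integral>x. (avg f N x - m)\<^sup>2 \<partial>M) \<longlonglongrightarrow> 0"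
  proof -
    have "(\<integral>x. (avg f N x - m)\<^sup>2 \<partial>M) = (\<integral>x. (avg f N x - g x)\<^sup>2 \<partial>M)" for N
      using AEm f g(1) by (intro integral_cong_AE) (auto intro!: bounded_meas_measurable bounded_meas_intros)
    then show ?thesis using g(3) by simp
  qed
  \<comment> \<open>Each average with at least one term has the same integral as \<open>f\<close>,
    which persists in the limit.\<close>
  have "m = (\<integral>y. f y \<partial>M)"
  proof -
    have "(\<lambda>N. \<integral>x. \<bar>avg f N x - m\<bar> \<partial>M) \<longlonglongrightarrow> 0"
      using f by (intro tendsto_L1_of_L2[OF _ lim] bounded_meas_intros)
    then have "(\<lambda>N. \<integral>x. avg f N x - m \<partial>M) \<longlonglongrightarrow> 0"
      by (rule Lim_null_comparison[rotated]) (auto intro!: always_eventually integral_abs_bound)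
    then have "(\<lambda>N. \<integral>x. avg f (Suc N) x - m \<partial>M) \<longlonglongrightarrow> 0" by (rule LIMSEQ_Suc)
    moreover have "(\<integral>x. avg f (Suc N) x - m \<partial>M) = (\<integral>y. f y \<partial>M) - m" for N
      using f by (simp add: bounded_meas_intros prob_space integral_avg)
    ultimately show ?thesis by (simp add: LIMSEQ_const_iff)
  qed
  then show ?thesis using lim by simp
qed

end

section \<open>Almost periodic functions\<close>

text \<open>The first-order condition: \<open>t\<^sup>2 * b - 2 * t * a\<close> is minimal at
  \<open>t = 0\<close>, so its derivative vanishes there.\<close>

lemma zero_if_quadratic_le:
  fixes a b :: real
  assumes "\<And>t. 2 * t * a \<le> t\<^sup>2 * b" "b \<ge> 0"
  shows "a = 0"
proof -
  \<comment> \<open>The minimum would be at \<open>a / b\<close>; adding 1 covers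
    \<open>b = 0\<close>.\<close>
  define t where "t = a / (b + 1)"
  have a: "a = t * (b + 1)" using assms(2) unfolding t_def by simp
  have "2 * t * (t * (b + 1)) \<le> t\<^sup>2 * b" using assms(1)[of t] a by simp
  then have "t\<^sup>2 * (b + 2) \<le> 0" by (simp add: power2_eq_square algebra_simps)
  then have "t = 0" using assms(2) by (simp add: mult_le_0_iff)
  then show ?thesis using a by simp
qed

context measure_preserving
begin

lemma integral_abs_diff_Tn:
  assumes "bounded_meas M f" "bounded_meas M g"
  shows "(\<integral>x. \<bar>f ((T ^^ n) x) - g ((T ^^ n) x)\<bar> \<partial>M) = (\<integral>x. \<bar>f x - g x\<bar> \<partial>M)"
proof -
  have "(\<lambda>x. \<bar>f x - g x\<bar>) \<in> borel_measurable M"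
    using assms by (intro bounded_meas_measurable bounded_meas_intros)
  then show ?thesis by (rule integral_Tn)
qed

lemma integral_abs_diff_Tn_shift:
  assumes "bounded_meas M f"
  shows "(\<integral>x. \<bar>f ((T ^^ (n + j)) x) - f ((T ^^ (m + j)) x)\<bar> \<partial>M)
    = (\<integral>x. \<bar>f ((T ^^ n) x) - f ((T ^^ m) x)\<bar> \<partial>M)"
  using integral_abs_diff_Tn[of "\<lambda>x. f ((T ^^ n) x)" "\<lambda>x. f ((T ^^ m) x)" j] assms
  by (simp add: bounded_meas_intros Tn_Tm)

text \<open>The forward orbit of \<open>f\<close> is totally bounded in L1, with centres taken from
  the orbit itself. These functions play the role of combinations of eigenfunctions, with real
  scalars only.\<close>

definition almost_periodic :: "('a \<Rightarrow> real) \<Rightarrow> bool" where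
  "almost_periodic f \<longleftrightarrow> bounded_meas M f \<and>
    (\<forall>e>0. \<exists>J. finite J \<and> (\<forall>n. \<exists>j\<in>J. (\<integral>x. \<bar>f ((T ^^ n) x) - f ((T ^^ j) x)\<bar> \<partial>M) < e))"

lemma almost_periodic_bounded [bounded_meas_intros]: "almost_periodic f \<Longrightarrow> bounded_meas M f"
  by (simp add: almost_periodic_def)

text \<open>Total boundedness as a finite colouring of the times in which equal colours mean nearby
  translates. Unlike finite nets inside an orbit, colourings combine directly by pairing.\<close>

lemma almost_periodic_coloring:
  assumes "almost_periodic f" "e > 0"
  shows "\<exists>c :: nat \<Rightarrow> nat. finite (range c) \<and>
    (\<forall>m n. c m = c n \<longrightarrow> (\<integral>x. \<bar>f ((T ^^ m) x) - f ((T ^^ n) x)\<bar> \<partial>M) < e)"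
proof -
  have f: "bounded_meas M f" using assms by (simp add: bounded_meas_intros)
  obtain J where J: "finite J" "\<forall>n. \<exists>j\<in>J. (\<integral>x. \<bar>f ((T ^^ n) x) - f ((T ^^ j) x)\<bar> \<partial>M) < e / 2"
    using assms unfolding almost_periodic_def by (meson half_gt_zero)
  obtain c where c: "\<And>n. c n \<in> J" "\<And>n. (\<integral>x. \<bar>f ((T ^^ n) x) - f ((T ^^ c n) x)\<bar> \<partial>M) < e / 2"
    using J(2) by metis
  show ?thesis
  proof (intro exI[of _ c] conjI)
    show "finite (range c)" using c(1) J(1) by (meson finite_subset image_subsetI)
    have "(\<integral>x. \<bar>f ((T ^^ m) x) - f ((T ^^ n) x)\<bar> \<partial>M) < e" if eq: "c m = c n" for m n
    proof -
      have "(\<integral>x. \<bar>f ((T ^^ m) x) - f ((T ^^ n) x)\<bar> \<partial>M)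
          \<le> (\<integral>x. \<bar>f ((T ^^ m) x) - f ((T ^^ c n) x)\<bar> \<partial>M) + (\<integral>x. \<bar>f ((T ^^ c n) x) - f ((T ^^ n) x)\<bar> \<partial>M)"
        by (intro integral_abs_triangle bounded_meas_intros f)
      then show ?thesis
        using c(2)[of m] c(2)[of n] eq by (simp add: abs_minus_commute)
    qed
    then show "\<forall>m n. c m = c n \<longrightarrow> (\<integral>x. \<bar>f ((T ^^ m) x) - f ((T ^^ n) x)\<bar> \<partial>M) < e" by blast
  qed
qed

text \<open>One time per colour, chosen by \<open>inv c\<close>, forms the finite net. The type of
  colours is left open so that pairs of colours and tables of rounded coefficients can
  serve.\<close>

lemma almost_periodicI:
  assumes f: "bounded_meas M f"
    and col: "\<And>e. e > 0 \<Longrightarrow> \<exists>c :: nat \<Rightarrow> 'b. finite (range c) \<and>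
      (\<forall>m n. c m = c n \<longrightarrow> (\<integral>x. \<bar>f ((T ^^ m) x) - f ((T ^^ n) x)\<bar> \<partial>M) < e)"
  shows "almost_periodic f"
  unfolding almost_periodic_def
proof (intro conjI f allI impI)
  fix e :: real assume "e > 0"
  from col[OF this] obtain c :: "nat \<Rightarrow> 'b" where c: "finite (range c)"
    "\<forall>m n. c m = c n \<longrightarrow> (\<integral>x. \<bar>f ((T ^^ m) x) - f ((T ^^ n) x)\<bar> \<partial>M) < e" by blast
  define J where "J = inv c ` range c"
  have "c (inv c (c n)) = c n" for n by (simp add: f_inv_into_f)
  then have "(\<integral>x. \<bar>f ((T ^^ n) x) - f ((T ^^ inv c (c n)) x)\<bar> \<partial>M) < e" for n
    using c(2) by simp
  then have "\<forall>n. \<exists>j\<in>J. (\<integral>x. \<bar>f ((T ^^ n) x) - f ((T ^^ j) x)\<bar> \<partial>M) < e"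
    unfolding J_def by blast
  then show "\<exists>J. finite J \<and> (\<forall>n. \<exists>j\<in>J. (\<integral>x. \<bar>f ((T ^^ n) x) - f ((T ^^ j) x)\<bar> \<partial>M) < e)"
    using c(1) unfolding J_def by blast
qed

text \<open>Pair the colourings of \<open>f\<close> and \<open>g\<close>; the Lipschitz condition
  turns closeness of both translates into closeness of the combination.\<close>

lemma almost_periodic_combine:
  assumes f: "almost_periodic f" and g: "almost_periodic g"
    and F: "bounded_meas M (\<lambda>x. F (f x) (g x))"
    and L: "L > 0" "\<And>a b a' b'. \<bar>F a b - F a' b'\<bar> \<le> L * (\<bar>a - a'\<bar> + \<bar>b - b'\<bar>)"
  shows "almost_periodic (\<lambda>x. F (f x) (g x))"
proof (rule almost_periodicI[OF F])
  fix e :: real assume e: "e > 0"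
  then have eL: "e / (2 * L) > 0" using L by simp
  have fg: "bounded_meas M f" "bounded_meas M g" using f g by (simp_all only: almost_periodic_bounded)
  have Fn: "bounded_meas M (\<lambda>x. F (f ((T ^^ n) x)) (g ((T ^^ n) x)))" for n
    using bounded_meas_Tn[OF F] .
  obtain c :: "nat \<Rightarrow> nat" where c: "finite (range c)"
    "\<forall>m n. c m = c n \<longrightarrow> (\<integral>x. \<bar>f ((T ^^ m) x) - f ((T ^^ n) x)\<bar> \<partial>M) < e / (2 * L)"
    using almost_periodic_coloring[OF f eL] by blast
  obtain d :: "nat \<Rightarrow> nat" where d: "finite (range d)"
    "\<forall>m n. d m = d n \<longrightarrow> (\<integral>x. \<bar>g ((T ^^ m) x) - g ((T ^^ n) x)\<bar> \<partial>M) < e / (2 * L)"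
    using almost_periodic_coloring[OF g eL] by blast
  have "range (\<lambda>n. (c n, d n)) \<subseteq> range c \<times> range d" by blast
  then have "finite (range (\<lambda>n. (c n, d n)))"
    by (rule finite_subset) (intro finite_cartesian_product c(1) d(1))
  moreover have "(\<integral>x. \<bar>F (f ((T ^^ m) x)) (g ((T ^^ m) x)) - F (f ((T ^^ n) x)) (g ((T ^^ n) x))\<bar> \<partial>M) < e"
    if eq: "(c m, d m) = (c n, d n)" for m n
  proof -
    have "(\<integral>x. \<bar>F (f ((T ^^ m) x)) (g ((T ^^ m) x)) - F (f ((T ^^ n) x)) (g ((T ^^ n) x))\<bar> \<partial>M)
      \<le> (\<integral>x. L * (\<bar>f ((T ^^ m) x) - f ((T ^^ n) x)\<bar> + \<bar>g ((T ^^ m) x) - g ((T ^^ n) x)\<bar>) \<partial>M)"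
      by (intro integral_mono integrable_bounded_meas bounded_meas_abs bounded_meas_diff Fn L(2)
        bounded_meas_mult[OF bounded_meas_const] bounded_meas_add bounded_meas_Tn fg)
    also have "\<dots> = L * ((\<integral>x. \<bar>f ((T ^^ m) x) - f ((T ^^ n) x)\<bar> \<partial>M) + (\<integral>x. \<bar>g ((T ^^ m) x) - g ((T ^^ n) x)\<bar> \<partial>M))"
      by (subst integral_mult_right_zero, subst Bochner_Integration.integral_add) (intro bounded_meas_intros fg refl)+
    also have "\<dots> < L * (e / (2 * L) + e / (2 * L))"
      using eq L c(2)[rule_format, of m n] d(2)[rule_format, of m n] by (intro mult_strict_left_mono add_strict_mono) auto
    also have "\<dots> = e" using L by simp
    finally show ?thesis .
  qed
  ultimately show "\<exists>c :: nat \<Rightarrow> nat \<times> nat. finite (range c) \<and> (\<forall>m n. c m = c n \<longrightarrow>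
      (\<integral>x. \<bar>F (f ((T ^^ m) x)) (g ((T ^^ m) x)) - F (f ((T ^^ n) x)) (g ((T ^^ n) x))\<bar> \<partial>M) < e)"
    by (intro exI[of _ "\<lambda>n. (c n, d n)"]) blast
qed

lemma almost_periodic_const: "almost_periodic (\<lambda>x. c)"
  unfolding almost_periodic_def by (auto intro!: bounded_meas_intros exI[of _ "{0}"])

lemma almost_periodic_lincomb:
  assumes "almost_periodic f" "almost_periodic g"
  shows "almost_periodic (\<lambda>x. a * f x + b * g x)"
proof (rule almost_periodic_combine[OF assms, where F="\<lambda>s t. a * s + b * t" and L="\<bar>a\<bar> + \<bar>b\<bar> + 1"])
  show "bounded_meas M (\<lambda>x. a * f x + b * g x)" using assms by (intro bounded_meas_intros)
  fix s t s' t' :: real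
  have "\<bar>a * s + b * t - (a * s' + b * t')\<bar> = \<bar>a * (s - s') + b * (t - t')\<bar>" by (simp add: algebra_simps)
  also have "\<dots> \<le> \<bar>a\<bar> * \<bar>s - s'\<bar> + \<bar>b\<bar> * \<bar>t - t'\<bar>"
    using abs_triangle_ineq[of "a * (s - s')" "b * (t - t')"] by (simp add: abs_mult)
  also have "\<dots> \<le> (\<bar>a\<bar> + \<bar>b\<bar> + 1) * \<bar>s - s'\<bar> + (\<bar>a\<bar> + \<bar>b\<bar> + 1) * \<bar>t - t'\<bar>"
    by (intro add_mono mult_right_mono) auto
  finally show "\<bar>a * s + b * t - (a * s' + b * t')\<bar> \<le> (\<bar>a\<bar> + \<bar>b\<bar> + 1) * (\<bar>s - s'\<bar> + \<bar>t - t'\<bar>)"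
    by (simp add: algebra_simps)
qed auto

lemma almost_periodic_truncate:
  assumes "almost_periodic f" "B \<ge> 0"
  shows "almost_periodic (\<lambda>x. max (-B) (min B (f x)))"
\<comment> \<open>Truncation involves one function only: \<open>F\<close> ignores its second
  argument, and \<open>f\<close> fills both places.\<close>
proof (rule almost_periodic_combine[OF assms(1) assms(1), where F="\<lambda>s t. max (-B) (min B s)" and L=1])
  have "f \<in> borel_measurable M" using assms by (intro bounded_meas_measurable bounded_meas_intros)
  then show "bounded_meas M (\<lambda>x. max (-B) (min B (f x)))"
    using assms(2) by (intro bounded_measI[of _ _ B]) auto
  show "\<bar>max (- B) (min B a) - max (- B) (min B a')\<bar> \<le> 1 * (\<bar>a - a'\<bar> + \<bar>b - b'\<bar>)" for a b a' b' :: real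
    by (cases "a \<le> a'") (auto simp: max_def min_def)
qed auto

lemma almost_periodic_Tn:
  assumes f: "almost_periodic f" shows "almost_periodic (\<lambda>x. f ((T ^^ j) x))"
proof -
  have fb: "bounded_meas M f" using f by (rule bounded_meas_intros)
  show ?thesis
  using f integral_abs_diff_Tn_shift[OF fb, of _ j] unfolding almost_periodic_def
    by (simp add: Tn_Tm bounded_meas_intros add.commute)
qed

text \<open>Three errors of \<open>e / 3\<close>: replacing \<open>f\<close> by \<open>h\<close>
  costs the same at all times, since composition with \<open>T\<close> preserves L1
  distances.\<close>

lemma almost_periodic_limit:
  assumes f: "bounded_meas M f" and "\<And>e. e > 0 \<Longrightarrow> \<exists>h. almost_periodic h \<and> (\<integral>x. \<bar>f x - h x\<bar> \<partial>M) < e"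
  shows "almost_periodic f"
proof (rule almost_periodicI[OF f])
  fix e :: real assume e: "e > 0"
  then have e3: "e / 3 > 0" by simp
  obtain h where h: "almost_periodic h" "(\<integral>x. \<bar>f x - h x\<bar> \<partial>M) < e / 3"
    using assms(2)[of "e/3"] e by auto
  obtain c :: "nat \<Rightarrow> nat" where c: "finite (range c)"
    "\<forall>m n. c m = c n \<longrightarrow> (\<integral>x. \<bar>h ((T ^^ m) x) - h ((T ^^ n) x)\<bar> \<partial>M) < e / 3"
    using almost_periodic_coloring[OF h(1) e3] by blast
  have hb: "bounded_meas M h" using h(1) by (rule bounded_meas_intros)
  have "(\<integral>x. \<bar>f ((T ^^ m) x) - f ((T ^^ n) x)\<bar> \<partial>M) < e" if "c m = c n" for m n
  proof -
    have "(\<integral>x. \<bar>f ((T ^^ m) x) - f ((T ^^ n) x)\<bar> \<partial>M)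
        \<le> (\<integral>x. \<bar>f ((T ^^ m) x) - h ((T ^^ m) x)\<bar> \<partial>M) + (\<integral>x. \<bar>h ((T ^^ m) x) - f ((T ^^ n) x)\<bar> \<partial>M)"
      by (intro integral_abs_triangle bounded_meas_intros f hb)
    also have "(\<integral>x. \<bar>h ((T ^^ m) x) - f ((T ^^ n) x)\<bar> \<partial>M)
        \<le> (\<integral>x. \<bar>h ((T ^^ m) x) - h ((T ^^ n) x)\<bar> \<partial>M) + (\<integral>x. \<bar>h ((T ^^ n) x) - f ((T ^^ n) x)\<bar> \<partial>M)"
      by (intro integral_abs_triangle bounded_meas_intros f hb)
    finally show ?thesis
      using c(2)[rule_format, OF that] h(2) by (simp add: integral_abs_diff_Tn f hb abs_minus_commute[of "h _" "f _"])
  qed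
  then show "\<exists>c::nat \<Rightarrow> nat. finite (range c) \<and> (\<forall>m n. c m = c n \<longrightarrow>
      (\<integral>x. \<bar>f ((T ^^ m) x) - f ((T ^^ n) x)\<bar> \<partial>M) < e)" using c(1) by blast
qed

text \<open>By the pigeonhole principle two multiples of \<open>Suc n\<close> have the same colour.
  Their difference is at least \<open>n\<close>, and cancelling the common shift compares it with
  time 0.\<close>

lemma almost_periodic_return:
  assumes f: "almost_periodic f" and e: "e > 0"
  obtains j where "j \<ge> n" "(\<integral>x. \<bar>f ((T ^^ j) x) - f x\<bar> \<partial>M) < e"
proof -
  obtain c :: "nat \<Rightarrow> nat" where c: "finite (range c)"
    "\<forall>k m. c k = c m \<longrightarrow> (\<integral>x. \<bar>f ((T ^^ k) x) - f ((T ^^ m) x)\<bar> \<partial>M) < e"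
    using almost_periodic_coloring[OF f e] by blast
  have "finite (range (\<lambda>k. c (k * Suc n)))" by (rule finite_subset[OF _ c(1)]) blast
  then have "\<not> inj (\<lambda>k. c (k * Suc n))" by (metis finite_imageD infinite_UNIV_nat)
  then obtain a' b' where "a' \<noteq> b'" "c (a' * Suc n) = c (b' * Suc n)"
    unfolding inj_on_def by blast
  then obtain a b where ab: "a < b" "c (a * Suc n) = c (b * Suc n)"
    by (metis linorder_neqE_nat)
  define j where "j = (b - a) * Suc n"
  have "b * Suc n = j + a * Suc n"
    using ab(1) unfolding j_def add_mult_distrib[symmetric] by (simp del: mult_Suc_right)
  then have "(\<integral>x. \<bar>f ((T ^^ j) x) - f x\<bar> \<partial>M) = (\<integral>x. \<bar>f ((T ^^ (b * Suc n)) x) - f ((T ^^ (a * Suc n)) x)\<bar> \<partial>M)"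
    using integral_abs_diff_Tn_shift[of f j "a * Suc n" 0] f by (simp add: bounded_meas_intros)
  moreover have "n \<le> j" using ab(1) unfolding j_def by (cases "b - a") auto
  ultimately show thesis using that c(2)[rule_format, OF ab(2)[symmetric]] by auto
qed

section \<open>Splitting off the almost periodic part\<close>

definition orthogonal_to_almost_periodic :: "('a \<Rightarrow> real) \<Rightarrow> bool" where
  "orthogonal_to_almost_periodic f \<longleftrightarrow> bounded_meas M f \<and> (\<forall>h. almost_periodic h \<longrightarrow> (\<integral>x. h x * f x \<partial>M) = 0)"

text \<open>As \<open>T\<close> need not be invertible, the \<open>n\<close> steps cannot be moved
  to \<open>h\<close> by an inverse. Instead \<open>h\<close> is replaced by its translate at a
  return time \<open>j \<ge> n\<close>; invariance cancels \<open>n\<close> steps and leaves the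
  translate by \<open>j - n\<close>, which is almost periodic, paired with \<open>w\<close>.\<close>

lemma orthogonal_to_almost_periodic_Tn:
  assumes w: "orthogonal_to_almost_periodic w" and h: "almost_periodic h"
  shows "(\<integral>x. h x * w ((T ^^ n) x) \<partial>M) = 0"
proof -
  have wb: "bounded_meas M w" and hb: "bounded_meas M h"
    using w h by (auto simp: orthogonal_to_almost_periodic_def bounded_meas_intros)
  obtain B where B: "\<And>x. x \<in> space M \<Longrightarrow> \<bar>w x\<bar> \<le> B" "B \<ge> 1" using wb by (metis bounded_measE)
  have "\<bar>\<integral>x. h x * w ((T ^^ n) x) \<partial>M\<bar> \<le> 0 + e" if e: "e > 0" for e
  proof -
    obtain j where j: "j \<ge> n" "(\<integral>x. \<bar>h ((T ^^ j) x) - h x\<bar> \<partial>M) < e / B"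
      using almost_periodic_return[OF h, of "e / B"] e B by auto
    have "(\<integral>x. h ((T ^^ j) x) * w ((T ^^ n) x) \<partial>M)
        = (\<integral>x. h ((T ^^ (j - n)) ((T ^^ n) x)) * w ((T ^^ n) x) \<partial>M)"
      using j(1) by (simp add: Tn_Tm)
    also have "\<dots> = (\<integral>x. h ((T ^^ (j - n)) x) * w x \<partial>M)"
      by (intro integral_Tn[of "\<lambda>x. h ((T ^^ (j - n)) x) * w x"] bounded_meas_measurable bounded_meas_intros hb wb)
    also have "\<dots> = 0"
      using w almost_periodic_Tn[OF h] by (auto simp: orthogonal_to_almost_periodic_def)
    finally have z: "(\<integral>x. h ((T ^^ j) x) * w ((T ^^ n) x) \<partial>M) = 0" .
    have "(\<integral>x. h x * w ((T ^^ n) x) \<partial>M)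
        = - (\<integral>x. w ((T ^^ n) x) * (h ((T ^^ j) x) - h x) \<partial>M)"
      using z by (simp add: right_diff_distrib bounded_meas_intros wb hb mult.commute)
    also have "\<bar>\<dots>\<bar> \<le> B * (\<integral>x. \<bar>h ((T ^^ j) x) - h x\<bar> \<partial>M)"
      unfolding abs_minus_cancel using B Tn_space
      by (intro abs_integral_mult_le bounded_meas_intros hb wb) auto
    also have "\<dots> \<le> B * (e / B)" using j(2) B by (intro mult_left_mono) auto
    finally show ?thesis using B by simp
  qed
  then have "\<bar>\<integral>x. h x * w ((T ^^ n) x) \<partial>M\<bar> \<le> 0" by (rule field_le_epsilon)
  then show ?thesis by simp
qed

text \<open>Truncation keeps a minimising sequence uniformly bounded, so that the projection is bounded too.\<close>

lemma almost_periodic_decomposition: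
  assumes f: "bounded_meas M f"
  obtains h where "almost_periodic h" "orthogonal_to_almost_periodic (\<lambda>x. f x - h x)"
proof -
  obtain B where B: "\<And>x. x \<in> space M \<Longrightarrow> \<bar>f x\<bar> \<le> B" "B \<ge> 1" using f by (metis bounded_measE)
  define S where "S = {h. almost_periodic h \<and> (\<forall>x\<in>space M. \<bar>h x\<bar> \<le> B)}"
  let ?E = "\<lambda>h. \<integral>x. (f x - h x)\<^sup>2 \<partial>M"
  define d where "d = (INF h\<in>S. ?E h)"
  have S0: "(\<lambda>x. 0) \<in> S" using B unfolding S_def by (simp add: almost_periodic_const)
  have dS: "d \<le> ?E h" if "h \<in> S" for h
    unfolding d_def using that by (intro cINF_lower bdd_belowI[of _ 0]) auto
  \<comment> \<open>Clipping at \<open>B\<close> preserves almost periodicity and moves no value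
    away from \<open>f\<close>, which obeys the same bound; so \<open>d\<close> is a lower bound
    over all almost periodic functions, not only over \<open>S\<close>.\<close>
  have d: "d \<le> ?E h" if h: "almost_periodic h" for h
  proof -
    let ?t = "\<lambda>x. max (-B) (min B (h x))"
    have t: "almost_periodic ?t" using h B by (intro almost_periodic_truncate) auto
    then have "?t \<in> S" using B unfolding S_def by auto
    then have "d \<le> ?E ?t" by (rule dS)
    also have "?E ?t \<le> ?E h"
    proof (intro integral_mono f h t bounded_meas_intros)
      fix x assume "x \<in> space M"
      then have "\<bar>f x\<bar> \<le> B" by (rule B)
      then have "\<bar>f x - ?t x\<bar> \<le> \<bar>f x - h x\<bar>" by linarith
      then show "(f x - ?t x)\<^sup>2 \<le> (f x - h x)\<^sup>2" by (rule abs_le_square_iff[THEN iffD1])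
    qed
    finally show ?thesis .
  qed
  have "\<forall>n. \<exists>h\<in>S. ?E h < d + 1 / real (Suc n)"
  proof
    fix n
    show "\<exists>h\<in>S. ?E h < d + 1 / real (Suc n)"
      using cInf_lessD[of "?E ` S" "d + 1 / real (Suc n)"] S0 unfolding d_def by auto
  qed
  then obtain u where u: "\<And>n. u n \<in> S" "\<And>n. ?E (u n) < d + 1 / real (Suc n)" by metis
  have ua: "almost_periodic (u n)" and uB: "x \<in> space M \<Longrightarrow> \<bar>u n x\<bar> \<le> B" for n x
    using u(1)[of n] unfolding S_def by auto
  have lim: "(\<lambda>n. ?E (u n)) \<longlonglongrightarrow> d"
  proof (rule tendsto_sandwich[of "\<lambda>n. d" _ _ "\<lambda>n. d + 1 / real (Suc n)"])
    show "(\<lambda>n. d + 1 / real (Suc n)) \<longlonglongrightarrow> d"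
      using tendsto_add[OF tendsto_const LIMSEQ_Suc[OF tendsto_const_over_nat[of 1]], of d] by simp
  qed (use u(2) dS u(1) in \<open>auto intro!: always_eventually less_imp_le simp del: of_nat_Suc\<close>)
  have mid: "d \<le> (\<integral>x. (((f x - u m x) + (f x - u n x)) / 2)\<^sup>2 \<partial>M)" for m n
  proof -
    have "d \<le> ?E (\<lambda>x. (1/2) * u m x + (1/2) * u n x)"
      by (intro d almost_periodic_lincomb ua)
    also have "\<dots> = (\<integral>x. (((f x - u m x) + (f x - u n x)) / 2)\<^sup>2 \<partial>M)"
      by (intro Bochner_Integration.integral_cong) (auto simp: field_simps)
    finally show ?thesis .
  qed
  have C: "\<exists>n0. \<forall>m\<ge>n0. \<forall>n\<ge>n0. (\<integral>x. \<bar>u m x - u n x\<bar> \<partial>M) < e" if e: "e > 0" for e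
  proof -
    have "\<exists>n0. \<forall>m\<ge>n0. \<forall>n\<ge>n0. (\<integral>x. ((f x - u m x) - (f x - u n x))\<^sup>2 \<partial>M) < (e/2)\<^sup>2"
      using e by (intro minimizing_sequence_Cauchy[OF _ lim mid] bounded_meas_intros f ua) auto
    moreover have "((f x - u m x) - (f x - u n x))\<^sup>2 = (u m x - u n x)\<^sup>2" for x m n
      by (simp add: power2_eq_square algebra_simps)
    ultimately have "\<exists>n0. \<forall>m\<ge>n0. \<forall>n\<ge>n0. (\<integral>x. (u m x - u n x)\<^sup>2 \<partial>M) < (e/2)\<^sup>2" by (simp only:)
    then obtain n0 where n0: "\<And>m n. m \<ge> n0 \<Longrightarrow> n \<ge> n0 \<Longrightarrow> (\<integral>x. (u m x - u n x)\<^sup>2 \<partial>M) < (e/2)\<^sup>2"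
      by blast
    have "(\<integral>x. \<bar>u m x - u n x\<bar> \<partial>M) \<le> e/2" if "m \<ge> n0" "n \<ge> n0" for m n
      using n0[OF that] e by (intro integral_abs_le_of_square bounded_meas_intros ua) auto
    then show ?thesis using e by (intro exI[of _ n0]) fastforce
  qed
  obtain h where h: "bounded_meas M h" "\<And>x. x \<in> space M \<Longrightarrow> \<bar>h x\<bar> \<le> B"
    "(\<lambda>n. \<integral>x. \<bar>u n x - h x\<bar> \<partial>M) \<longlonglongrightarrow> 0"
    using L1_Cauchy_bounded[OF almost_periodic_bounded[OF ua] uB C] by blast
  have ha: "almost_periodic h"
  proof (rule almost_periodic_limit[OF h(1)])
    fix e :: real assume "e > 0"
    then obtain n where "(\<integral>x. \<bar>u n x - h x\<bar> \<partial>M) < e"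
      using LIMSEQ_D[OF h(3), of e] by auto
    then show "\<exists>g. almost_periodic g \<and> (\<integral>x. \<bar>h x - g x\<bar> \<partial>M) < e"
      using ua by (auto intro!: exI[of _ "u n"] simp: abs_minus_commute)
  qed
  \<comment> \<open>The squared distance passes to the L1 limit because \<open>4 * B\<close> bounds
    \<open>\<bar>2 * f x - h x - u n x\<bar>\<close>.\<close>
  have Eh: "?E h \<le> d"
  proof (rule LIMSEQ_le_const[OF _ exI, of "\<lambda>n. ?E (u n) + 4 * B * (\<integral>x. \<bar>u n x - h x\<bar> \<partial>M)"])
    show "(\<lambda>n. ?E (u n) + 4 * B * (\<integral>x. \<bar>u n x - h x\<bar> \<partial>M)) \<longlonglongrightarrow> d"
      using tendsto_add[OF lim tendsto_mult_left[OF h(3), of "4 * B"]] by simp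
    show "\<forall>n\<ge>0. ?E h \<le> ?E (u n) + 4 * B * (\<integral>x. \<bar>u n x - h x\<bar> \<partial>M)"
    proof (intro allI impI)
      fix n
      have "?E h \<le> (\<integral>x. (f x - u n x)\<^sup>2 + 4 * B * \<bar>u n x - h x\<bar> \<partial>M)"
      proof (intro integral_mono f h ua bounded_meas_intros)
        fix x assume x: "x \<in> space M"
        have "(f x - h x)\<^sup>2 - (f x - u n x)\<^sup>2 = (2 * f x - h x - u n x) * (u n x - h x)"
          by (simp add: power2_eq_square algebra_simps)
        also have "\<dots> \<le> \<bar>2 * f x - h x - u n x\<bar> * \<bar>u n x - h x\<bar>"
          by (simp flip: abs_mult)
        also have "\<dots> \<le> (4 * B) * \<bar>u n x - h x\<bar>"
          using B(1)[OF x] h(2)[OF x] uB[OF x, of n] by (intro mult_right_mono) linarith+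
        finally show "(f x - h x)\<^sup>2 \<le> (f x - u n x)\<^sup>2 + 4 * B * \<bar>u n x - h x\<bar>" by simp
      qed
      then show "?E h \<le> ?E (u n) + 4 * B * (\<integral>x. \<bar>u n x - h x\<bar> \<partial>M)"
        by (simp add: bounded_meas_intros f h ua)
    qed
  qed
  have "orthogonal_to_almost_periodic (\<lambda>x. f x - h x)"
    unfolding orthogonal_to_almost_periodic_def
  proof (intro conjI allI impI f h bounded_meas_intros)
    fix g assume g: "almost_periodic g"
    let ?a = "\<integral>x. g x * (f x - h x) \<partial>M" and ?b = "\<integral>x. (g x)\<^sup>2 \<partial>M"
    \<comment> \<open>Moving the minimiser \<open>h\<close> in the direction \<open>g\<close> cannot
      bring it closer to \<open>f\<close>.\<close>
    have q: "2 * t * ?a \<le> t\<^sup>2 * ?b" for t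
    proof -
      have "d \<le> ?E (\<lambda>x. 1 * h x + t * g x)" by (intro d almost_periodic_lincomb ha g)
      also have "\<dots> = (\<integral>x. (f x - h x)\<^sup>2 - 2 * t * (g x * (f x - h x)) + t\<^sup>2 * (g x)\<^sup>2 \<partial>M)"
        by (intro Bochner_Integration.integral_cong) (auto simp: power2_eq_square algebra_simps)
      also have "\<dots> = ?E h - 2 * t * ?a + t\<^sup>2 * ?b" by (simp add: bounded_meas_intros f h g)
      finally show ?thesis using Eh by linarith
    qed
    show "?a = 0" using q by (rule zero_if_quadratic_le) simp
  qed
  then show thesis using that ha by blast
qed


section \<open>Weak mixing of functions orthogonal to the almost periodic ones\<close>

lemma invariant_pair: "invariant_measure (M \<Otimes>\<^sub>M M) (map_prod T T)"
proof -
  have d: "distr M M T = M" using invariant by (simp add: invariant_measure_def)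
  have "distr M M T \<Otimes>\<^sub>M distr M M T = distr (M \<Otimes>\<^sub>M M) (M \<Otimes>\<^sub>M M) (\<lambda>(x, y). (T x, T y))"
    by (rule pair_measure_distr) (auto simp: d sigma_finite_measure_axioms)
  then show ?thesis
    unfolding invariant_measure_def map_prod_def d by simp
qed

text \<open>The averages of \<open>w(T\<^sup>n x) w(T\<^sup>n y)\<close> converge in \<open>L\<^sup>2\<close> of the square of the system to an invariant kernel.
  Its integral operator is a limit of operators of finite rank and commutes with composition by \<open>T\<close>,
  so it maps bounded functions to almost periodic ones, to which \<open>w\<close> is orthogonal.\<close>

lemma orthogonal_to_almost_periodic_weakly_mixing:
  assumes w: "orthogonal_to_almost_periodic w" and g: "bounded_meas M g"
  shows "cesaro (\<lambda>n. (\<integral>x. g x * w ((T ^^ n) x) \<partial>M)\<^sup>2) \<longlonglongrightarrow> 0"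
proof -
  interpret PP: pair_prob_space M M ..
  interpret D: measure_preserving "M \<Otimes>\<^sub>M M" "map_prod T T"
    by unfold_locales (rule invariant_pair)
  have wb: "bounded_meas M w" using w by (simp add: orthogonal_to_almost_periodic_def)
  obtain Bw where Bw: "\<And>x. x \<in> space M \<Longrightarrow> \<bar>w x\<bar> \<le> Bw" "Bw \<ge> 1" using wb by (metis bounded_measE)
  obtain Bg where Bg: "\<And>x. x \<in> space M \<Longrightarrow> \<bar>g x\<bar> \<le> Bg" "Bg \<ge> 1" using g by (metis bounded_measE)
  define u where "u = (\<lambda>p. w (fst p) * w (snd p))"
  have ub: "bounded_meas (M \<Otimes>\<^sub>M M) u" unfolding u_def
    by (intro bounded_meas_mult bounded_meas_comp[OF wb]) auto
  obtain K where K: "bounded_meas (M \<Otimes>\<^sub>M M) K"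
    "(\<lambda>N. \<integral>p. (D.avg u N p - K p)\<^sup>2 \<partial>(M \<Otimes>\<^sub>M M)) \<longlonglongrightarrow> 0"
    using D.mean_ergodic[OF ub] by blast
  define err where "err N = (\<integral>p. \<bar>D.avg u N p - K p\<bar> \<partial>(M \<Otimes>\<^sub>M M))" for N
  have err0: "err N \<ge> 0" for N unfolding err_def by simp
  have err: "err \<longlonglongrightarrow> 0"
    unfolding err_def[abs_def] using K ub by (intro PP.P.tendsto_L1_of_L2 bounded_meas_diff D.bounded_meas_avg)
  obtain BK where BK: "\<And>p. p \<in> space (M \<Otimes>\<^sub>M M) \<Longrightarrow> \<bar>K p\<bar> \<le> BK" "BK \<ge> 1" using K(1) by (metis bounded_measE)
  have sec: "bounded_meas M (\<lambda>y. F (x, y))" if "bounded_meas (M \<Otimes>\<^sub>M M) F" "x \<in> space M" for F x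
    using that by (intro bounded_meas_comp[OF that(1)]) simp
  \<comment> \<open>\<open>Kop\<close> is the integral operator with kernel \<open>K\<close>.
    \<open>KN N\<close> is the one with kernel \<open>D.avg u N\<close>, written as an operator of
    finite rank: its values are combinations of \<open>w \<circ> T^n\<close> with
    \<open>n < N\<close>.\<close>
  define Kop where "Kop v x = (\<integral>y. v y * K (x, y) \<partial>M)" for v x
  define KN where "KN N v x = cesaro (\<lambda>n. (\<integral>y. v y * w ((T ^^ n) y) \<partial>M) * w ((T ^^ n) x)) N" for N v x
  have Kopb: "bounded_meas M (Kop v)" if v: "bounded_meas M v" for v
  proof -
    obtain B where B: "\<And>x. x \<in> space M \<Longrightarrow> \<bar>v x\<bar> \<le> B" "B \<ge> 1" using v by (metis bounded_measE)
    have [measurable]: "v \<in> borel_measurable M" "K \<in> borel_measurable (M \<Otimes>\<^sub>M M)"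
      using v K(1) by (auto intro: bounded_meas_measurable)
    have "(\<lambda>x. \<integral>y. v y * K (x, y) \<partial>M) \<in> borel_measurable M" by measurable
    moreover have "\<bar>\<integral>y. v y * K (x, y) \<partial>M\<bar> \<le> B * BK" if x: "x \<in> space M" for x
    proof (rule abs_integral_le_bound)
      show "bounded_meas M (\<lambda>y. v y * K (x, y))"
        using sec[OF K(1) x] v by (intro bounded_meas_mult)
      show "\<bar>v y * K (x, y)\<bar> \<le> B * BK" if y: "y \<in> space M" for y
        unfolding abs_mult using B BK(1)[of "(x, y)"] x y
        by (intro mult_mono) (auto simp: space_pair_measure)
    qed
    ultimately show ?thesis unfolding Kop_def[abs_def] by (rule bounded_measI)
  qed
  have KNb: "bounded_meas M (KN N v)" for N v
    unfolding KN_def[abs_def] by (intro bounded_meas_cesaro bounded_meas_mult bounded_meas_const bounded_meas_Tn wb)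
  have funpow_map_prod: "(map_prod T T ^^ n) p = ((T ^^ n) (fst p), (T ^^ n) (snd p))" for n p
    by (induction n) (auto simp: map_prod_def split: prod.splits)
  have KN_eq: "KN N v x = (\<integral>y. v y * D.avg u N (x, y) \<partial>M)" if v: "bounded_meas M v" for N v x
  proof -
    have "(\<integral>y. v y * D.avg u N (x, y) \<partial>M) = (\<integral>y. cesaro (\<lambda>n. (v y * w ((T ^^ n) y)) * w ((T ^^ n) x)) N \<partial>M)"
      unfolding D.avg_def u_def funpow_map_prod cesaro_cmult[symmetric] by (simp add: mult_ac)
    also have "\<dots> = KN N v x"
      unfolding KN_def
      by (subst integral_cesaro) (intro bounded_meas_mult bounded_meas_const bounded_meas_Tn wb v, simp)
    finally show ?thesis by simp
  qed
  \<comment> \<open>By Fubini, the two images of a function bounded by \<open>B\<close> differ in L1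
    by at most \<open>B\<close> times the L1 distance of the kernels.\<close>
  have KN_err: "(\<integral>x. \<bar>KN N v x - Kop v x\<bar> \<partial>M) \<le> B * err N"
    if v: "bounded_meas M v" "\<And>x. x \<in> space M \<Longrightarrow> \<bar>v x\<bar> \<le> B" for v B N
  proof -
    let ?d = "\<lambda>p. \<bar>D.avg u N p - K p\<bar>"
    have db: "bounded_meas (M \<Otimes>\<^sub>M M) ?d" by (intro bounded_meas_abs bounded_meas_diff D.bounded_meas_avg ub K(1))
    have di: "integrable (M \<Otimes>\<^sub>M M) ?d" using db by (rule PP.P.integrable_bounded_meas)
    have "(\<integral>x. \<bar>KN N v x - Kop v x\<bar> \<partial>M) \<le> (\<integral>x. B * (\<integral>y. ?d (x, y) \<partial>M) \<partial>M)"
    proof (rule integral_mono)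
      show "integrable M (\<lambda>x. \<bar>KN N v x - Kop v x\<bar>)"
        by (intro integrable_bounded_meas bounded_meas_abs bounded_meas_diff KNb Kopb v)
      show "integrable M (\<lambda>x. B * (\<integral>y. ?d (x, y) \<partial>M))"
        using PP.integrable_fst'[OF di] by simp
      fix x assume x: "x \<in> space M"
      have s: "bounded_meas M (\<lambda>y. D.avg u N (x, y))" "bounded_meas M (\<lambda>y. K (x, y))"
        by (rule sec[OF _ x], rule D.bounded_meas_avg[OF ub], rule sec[OF K(1) x])
      have "KN N v x - Kop v x = (\<integral>y. v y * (D.avg u N (x, y) - K (x, y)) \<partial>M)"
        unfolding KN_eq[OF v(1)] Kop_def right_diff_distrib
        by (rule Bochner_Integration.integral_diff[symmetric])
          (intro integrable_bounded_meas bounded_meas_mult s v(1))+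
      also have "\<bar>\<dots>\<bar> \<le> B * (\<integral>y. ?d (x, y) \<partial>M)"
        by (intro abs_integral_mult_le bounded_meas_diff s v)
      finally show "\<bar>KN N v x - Kop v x\<bar> \<le> B * (\<integral>y. ?d (x, y) \<partial>M)" .
    qed
    also have "\<dots> = B * err N" unfolding err_def using PP.integral_fst'[OF di] by simp
    finally show ?thesis .
  qed
  define gm where "gm m x = g ((T ^^ m) x)" for m x
  have gmb: "bounded_meas M (gm m)" for m unfolding gm_def[abs_def] by (intro bounded_meas_Tn g)
  have gmB: "\<bar>gm m x\<bar> \<le> Bg" if "x \<in> space M" for m x unfolding gm_def using Bg(1) Tn_space[OF that] .
  define h where "h = Kop g"
  have hb: "bounded_meas M h" unfolding h_def by (rule Kopb[OF g])
  define I where "I m n = (\<integral>y. gm m y * w ((T ^^ n) y) \<partial>M)" for m n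
  have IB: "\<bar>I m n\<bar> \<le> Bg * Bw" for m n
    unfolding I_def
  proof (rule abs_integral_le_bound)
    show "bounded_meas M (\<lambda>y. gm m y * w ((T ^^ n) y))" by (intro bounded_meas_mult gmb bounded_meas_Tn wb)
    show "\<bar>gm m y * w ((T ^^ n) y)\<bar> \<le> Bg * Bw" if "y \<in> space M" for y
      unfolding abs_mult using gmB[OF that] Bw(1) Tn_space[OF that] Bg(2) by (intro mult_mono) auto
  qed
  have I_shift: "I m (n + m) = I 0 n" for m n
  proof -
    have "I m (n + m) = (\<integral>y. g ((T ^^ m) y) * w ((T ^^ n) ((T ^^ m) y)) \<partial>M)"
      unfolding I_def gm_def by (simp add: Tn_Tm)
    also have "\<dots> = I 0 n" unfolding I_def gm_def
      using integral_Tn[of "\<lambda>y. g y * w ((T ^^ n) y)" m] g wb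
      by (simp add: bounded_meas_measurable bounded_meas_mult bounded_meas_Tn)
    finally show ?thesis .
  qed
  \<comment> \<open>By \<open>I_shift\<close>, the value of \<open>KN N g\<close> at
    \<open>T^m x\<close> and that of \<open>KN N (gm m)\<close> at \<open>x\<close> are averages of
    one bounded sequence up to a shift by \<open>m\<close>. This costs O(m/N) and vanishes as
    \<open>N\<close> grows, so the limit operator commutes with \<open>T\<close> almost
    everywhere.\<close>
  have equivariant: "(\<integral>x. \<bar>h ((T ^^ m) x) - Kop (gm m) x\<bar> \<partial>M) = 0" for m
  proof -
    let ?hT = "\<lambda>x. h ((T ^^ m) x)" and ?k = "\<lambda>N x. KN N g ((T ^^ m) x)"
    have hTb: "bounded_meas M ?hT" and kb: "bounded_meas M (?k N)" for N
      by (rule bounded_meas_Tn[OF hb], rule bounded_meas_Tn[OF KNb])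
    have bd: "(\<integral>x. \<bar>?hT x - Kop (gm m) x\<bar> \<partial>M) \<le> Bg * err N + 2 * real m * (Bg * Bw * Bw) / real N + Bg * err N" for N
    proof -
      have "(\<integral>x. \<bar>?hT x - Kop (gm m) x\<bar> \<partial>M) \<le> (\<integral>x. \<bar>?hT x - ?k N x\<bar> \<partial>M) + (\<integral>x. \<bar>?k N x - Kop (gm m) x\<bar> \<partial>M)"
        by (intro integral_abs_triangle hTb kb Kopb gmb)
      moreover have "(\<integral>x. \<bar>?k N x - Kop (gm m) x\<bar> \<partial>M)
          \<le> (\<integral>x. \<bar>?k N x - KN N (gm m) x\<bar> \<partial>M) + (\<integral>x. \<bar>KN N (gm m) x - Kop (gm m) x\<bar> \<partial>M)"
        by (intro integral_abs_triangle kb KNb Kopb gmb)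
      moreover have "(\<integral>x. \<bar>?hT x - ?k N x\<bar> \<partial>M) = (\<integral>x. \<bar>KN N g x - h x\<bar> \<partial>M)"
        using integral_abs_diff_Tn[OF hb KNb] by (simp add: abs_minus_commute)
      moreover have "(\<integral>x. \<bar>KN N g x - h x\<bar> \<partial>M) \<le> Bg * err N"
        unfolding h_def by (intro KN_err g Bg)
      moreover have "(\<integral>x. \<bar>KN N (gm m) x - Kop (gm m) x\<bar> \<partial>M) \<le> Bg * err N"
        by (intro KN_err gmb gmB)
      moreover have "(\<integral>x. \<bar>?k N x - KN N (gm m) x\<bar> \<partial>M) \<le> 2 * real m * (Bg * Bw * Bw) / real N"
      proof (rule integral_le_bound)
        show "bounded_meas M (\<lambda>x. \<bar>?k N x - KN N (gm m) x\<bar>)"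
          by (intro bounded_meas_abs bounded_meas_diff kb KNb)
        fix x assume x: "x \<in> space M"
        let ?b = "\<lambda>n. I m n * w ((T ^^ n) x)"
        have "\<bar>?b n\<bar> \<le> Bg * Bw * Bw" for n
          unfolding abs_mult using IB Bw(1)[OF Tn_space[OF x]] Bg(2) Bw(2) by (intro mult_mono) auto
        then have "\<bar>cesaro (\<lambda>n. ?b (n + m)) N - cesaro ?b N\<bar> \<le> 2 * real m * (Bg * Bw * Bw) / real N"
          by (rule abs_cesaro_shift_le)
        moreover have "cesaro (\<lambda>n. ?b (n + m)) N = ?k N x"
          unfolding KN_def I_shift by (simp add: I_def gm_def Tn_Tm)
        moreover have "cesaro ?b N = KN N (gm m) x" unfolding KN_def I_def ..
        ultimately show "\<bar>?k N x - KN N (gm m) x\<bar> \<le> 2 * real m * (Bg * Bw * Bw) / real N" by simp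
      qed
      ultimately show ?thesis by linarith
    qed
    have "(\<lambda>N. Bg * err N + 2 * real m * (Bg * Bw * Bw) / real N + Bg * err N) \<longlonglongrightarrow> Bg * 0 + 0 + Bg * 0"
      by (intro tendsto_add tendsto_mult_left err tendsto_const_over_nat)
    then have "(\<integral>x. \<bar>?hT x - Kop (gm m) x\<bar> \<partial>M) \<le> 0"
      using bd by (intro LIMSEQ_le_const) auto
    then show ?thesis by (intro antisym) auto
  qed
  have ha: "almost_periodic h"
  proof (rule almost_periodicI[OF hb])
    fix e :: real assume e: "e > 0"
    have "(\<lambda>N. Bg * err N) \<longlonglongrightarrow> Bg * 0" by (intro tendsto_mult_left err)
    then obtain N where N: "Bg * err N < e / 4"
      using LIMSEQ_D[of "\<lambda>N. Bg * err N" 0 "e/4"] e err0 Bg(2) by (auto simp: abs_mult)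
    \<comment> \<open>The approximants of \<open>h \<circ> T^m\<close> are combinations of
      \<open>N\<close> fixed functions bounded by \<open>Bw\<close>. Rounding their bounded
      coefficients on the scale \<open>\<delta>\<close> gives finitely many colours. Equal colours
      cost at most \<open>\<delta> * Bw = e / 4\<close>, and the two approximation errors add less
      than \<open>e / 2\<close>.\<close>
    define \<delta> where "\<delta> = e / (4 * Bw)"
    have \<delta>: "\<delta> > 0" using e Bw unfolding \<delta>_def by simp
    define c where "c m = (\<lambda>n\<in>{..<N}. \<lfloor>I m n / \<delta>\<rfloor>)" for m
    have fl: "\<lfloor>I m n / \<delta>\<rfloor> \<in> {\<lfloor>- (Bg * Bw) / \<delta>\<rfloor>..\<lfloor>Bg * Bw / \<delta>\<rfloor>}" for m n
    proof -
      have "- (Bg * Bw) / \<delta> \<le> I m n / \<delta>" "I m n / \<delta> \<le> Bg * Bw / \<delta>"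
        using IB[of m n] \<delta> unfolding abs_le_iff by (intro divide_right_mono; linarith)+
      then show ?thesis unfolding atLeastAtMost_iff by (intro conjI floor_mono)
    qed
    have "range c \<subseteq> ({..<N} \<rightarrow>\<^sub>E {\<lfloor>- (Bg * Bw) / \<delta>\<rfloor>..\<lfloor>Bg * Bw / \<delta>\<rfloor>})"
      using fl unfolding c_def by (intro image_subsetI restrict_PiE_iff[THEN iffD2]) blast
    then have fin: "finite (range c)" by (rule finite_subset) (intro finite_PiE, auto)
    have "(\<integral>x. \<bar>h ((T ^^ m) x) - h ((T ^^ m') x)\<bar> \<partial>M) < e" if eq: "c m = c m'" for m m'
    proof -
      have I: "\<bar>I m n - I m' n\<bar> \<le> \<delta>" if "n < N" for n
      proof -
        have "\<lfloor>I m n / \<delta>\<rfloor> = \<lfloor>I m' n / \<delta>\<rfloor>"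
          using fun_cong[OF eq, of n] that unfolding c_def by simp
        then have "\<bar>I m n / \<delta> - I m' n / \<delta>\<bar> \<le> 1" by linarith
        then have "\<bar>(I m n - I m' n) / \<delta>\<bar> \<le> 1" by (simp add: diff_divide_distrib)
        then show ?thesis using \<delta> by (simp add: abs_divide)
      qed
      have k: "(\<integral>x. \<bar>KN N (gm m) x - KN N (gm m') x\<bar> \<partial>M) \<le> \<delta> * Bw"
      proof (rule integral_le_bound)
        show "bounded_meas M (\<lambda>x. \<bar>KN N (gm m) x - KN N (gm m') x\<bar>)"
          by (intro bounded_meas_abs bounded_meas_diff KNb)
        fix x assume x: "x \<in> space M"
        have "KN N (gm m) x - KN N (gm m') x = cesaro (\<lambda>n. (I m n - I m' n) * w ((T ^^ n) x)) N"
          unfolding KN_def I_def[symmetric] by (simp add: left_diff_distrib cesaro_diff)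
        also have "\<bar>\<dots>\<bar> \<le> \<delta> * Bw"
          using I Bw Tn_space[OF x] \<delta>
          by (intro abs_cesaro_le_bound_lt) (auto simp: abs_mult intro!: mult_mono)
        finally show "\<bar>KN N (gm m) x - KN N (gm m') x\<bar> \<le> \<delta> * Bw" .
      qed
      have hm: "bounded_meas M (\<lambda>x. h ((T ^^ m) x))" for m by (rule bounded_meas_Tn[OF hb])
      have t1: "(\<integral>x. \<bar>h ((T ^^ m) x) - KN N (gm m) x\<bar> \<partial>M) \<le> Bg * err N" for m
      proof -
        have "(\<integral>x. \<bar>h ((T ^^ m) x) - KN N (gm m) x\<bar> \<partial>M)
          \<le> (\<integral>x. \<bar>h ((T ^^ m) x) - Kop (gm m) x\<bar> \<partial>M) + (\<integral>x. \<bar>Kop (gm m) x - KN N (gm m) x\<bar> \<partial>M)"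
          by (intro integral_abs_triangle hm Kopb gmb KNb)
        then show ?thesis
          using KN_err[OF gmb gmB, of N m] equivariant[of m]
          by (simp add: abs_minus_commute[of "KN _ _ _"])
      qed
      have "(\<integral>x. \<bar>h ((T ^^ m) x) - h ((T ^^ m') x)\<bar> \<partial>M)
        \<le> (\<integral>x. \<bar>h ((T ^^ m) x) - KN N (gm m) x\<bar> \<partial>M) + (\<integral>x. \<bar>KN N (gm m) x - h ((T ^^ m') x)\<bar> \<partial>M)"
        by (intro integral_abs_triangle hm KNb)
      also have "(\<integral>x. \<bar>KN N (gm m) x - h ((T ^^ m') x)\<bar> \<partial>M)
        \<le> (\<integral>x. \<bar>KN N (gm m) x - KN N (gm m') x\<bar> \<partial>M) + (\<integral>x. \<bar>KN N (gm m') x - h ((T ^^ m') x)\<bar> \<partial>M)"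
        by (intro integral_abs_triangle hm KNb)
      also have "(\<integral>x. \<bar>KN N (gm m') x - h ((T ^^ m') x)\<bar> \<partial>M) \<le> Bg * err N"
        using t1[of m'] by (simp add: abs_minus_commute)
      finally have "(\<integral>x. \<bar>h ((T ^^ m) x) - h ((T ^^ m') x)\<bar> \<partial>M) \<le> Bg * err N + (\<delta> * Bw + Bg * err N)"
        using t1[of m] k by linarith
      moreover have "\<delta> * Bw = e / 4" using Bw(2) unfolding \<delta>_def by simp
      ultimately show ?thesis using N e by linarith
    qed
    then show "\<exists>c :: nat \<Rightarrow> nat \<Rightarrow> int. finite (range c) \<and>
        (\<forall>m n. c m = c n \<longrightarrow> (\<integral>x. \<bar>h ((T ^^ m) x) - h ((T ^^ n) x)\<bar> \<partial>M) < e)"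
      using fin by blast
  qed
  \<comment> \<open>For \<open>v = g\<close> this is exactly the mean of squares in the claim, and
    its limit is the pairing of \<open>g\<close> with \<open>h\<close>. For \<open>v = h\<close> it
    is zero by orthogonality, so \<open>h\<close> has norm zero and that limit vanishes.\<close>
  have pair_KN: "(\<integral>x. v x * KN N g x \<partial>M) = cesaro (\<lambda>n. I 0 n * (\<integral>x. v x * w ((T ^^ n) x) \<partial>M)) N"
    if v: "bounded_meas M v" for v N
  proof -
    have "(\<integral>x. v x * KN N g x \<partial>M) = (\<integral>x. cesaro (\<lambda>n. I 0 n * (v x * w ((T ^^ n) x))) N \<partial>M)"
      unfolding KN_def cesaro_cmult[symmetric] I_def gm_def by (simp add: mult_ac)
    also have "\<dots> = cesaro (\<lambda>n. I 0 n * (\<integral>x. v x * w ((T ^^ n) x) \<partial>M)) N"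
      by (subst integral_cesaro) (intro bounded_meas_mult bounded_meas_const bounded_meas_Tn wb v, simp)
    finally show ?thesis .
  qed
  have pair_lim: "(\<lambda>N. \<integral>x. v x * KN N g x \<partial>M) \<longlonglongrightarrow> (\<integral>x. v x * h x \<partial>M)" if v: "bounded_meas M v" for v
  proof -
    obtain B where B: "\<And>x. x \<in> space M \<Longrightarrow> \<bar>v x\<bar> \<le> B" "B \<ge> 1" using v by (metis bounded_measE)
    have bd: "\<bar>(\<integral>x. v x * KN N g x \<partial>M) - (\<integral>x. v x * h x \<partial>M)\<bar> \<le> B * (Bg * err N)" for N
    proof -
      have "(\<integral>x. v x * KN N g x \<partial>M) - (\<integral>x. v x * h x \<partial>M) = (\<integral>x. v x * (KN N g x - h x) \<partial>M)"
        unfolding right_diff_distrib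
        by (rule Bochner_Integration.integral_diff[symmetric])
          (intro integrable_bounded_meas bounded_meas_mult v KNb hb)+
      also have "\<bar>\<dots>\<bar> \<le> B * (\<integral>x. \<bar>KN N g x - h x\<bar> \<partial>M)"
        by (intro abs_integral_mult_le bounded_meas_diff KNb hb v B)
      also have "\<dots> \<le> B * (Bg * err N)"
        unfolding h_def using B(2) by (intro mult_left_mono KN_err g Bg) auto
      finally show ?thesis .
    qed
    have "(\<lambda>N. B * (Bg * err N)) \<longlonglongrightarrow> B * (Bg * 0)" by (intro tendsto_mult_left err)
    then have "(\<lambda>N. (\<integral>x. v x * KN N g x \<partial>M) - (\<integral>x. v x * h x \<partial>M)) \<longlonglongrightarrow> 0"
      unfolding mult_zero_right
      by (rule Lim_null_comparison[rotated]) (simp only: real_norm_def bd always_eventually simp_thms)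
    then show ?thesis by (rule LIM_zero_cancel)
  qed
  have "(\<integral>x. h x * w ((T ^^ n) x) \<partial>M) = 0" for n
    by (rule orthogonal_to_almost_periodic_Tn[OF w ha])
  then have "(\<integral>x. h x * KN N g x \<partial>M) = 0" for N
    unfolding pair_KN[OF hb] by (simp add: cesaro_def)
  then have "(\<integral>x. h x * h x \<partial>M) = 0"
    using pair_lim[OF hb] by (simp add: LIMSEQ_const_iff)
  then have "(\<integral>x. \<bar>h x\<bar> \<partial>M) = 0"
    by (intro antisym integral_abs_le_of_square hb) (auto simp: power2_eq_square)
  then have "(\<integral>x. g x * h x \<partial>M) = 0"
    using abs_integral_mult_le[OF hb g Bg(1)] by simp
  then have "(\<lambda>N. \<integral>x. g x * KN N g x \<partial>M) \<longlonglongrightarrow> 0" using pair_lim[OF g] by simp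
  moreover have "(\<integral>x. g x * KN N g x \<partial>M) = cesaro (\<lambda>n. (\<integral>x. g x * w ((T ^^ n) x) \<partial>M)\<^sup>2) N" for N
    unfolding pair_KN[OF g] by (simp add: I_def gm_def power2_eq_square)
  ultimately show ?thesis by simp
qed

end

section \<open>Multitime orbits of diagonal points\<close>

text \<open>After division by \<open>B\<close> all factors have absolute value at most 1 and the
  telescoping bound \<open>norm_prod_diff\<close> applies. The exponent \<open>card I\<close> gives
  away one factor \<open>B\<close>, which is allowed since \<open>B \<ge> 1\<close>.\<close>

lemma abs_prod_diff_le:
  fixes a b :: "'i \<Rightarrow> real"
  assumes "finite I" "B \<ge> 1" "\<And>i. i \<in> I \<Longrightarrow> \<bar>a i\<bar> \<le> B" "\<And>i. i \<in> I \<Longrightarrow> \<bar>b i\<bar> \<le> B"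
  shows "\<bar>(\<Prod>i\<in>I. a i) - (\<Prod>i\<in>I. b i)\<bar> \<le> B ^ card I * (\<Sum>i\<in>I. \<bar>a i - b i\<bar>)"
proof -
  have "norm ((\<Prod>i\<in>I. a i / B) - (\<Prod>i\<in>I. b i / B)) \<le> (\<Sum>i\<in>I. norm (a i / B - b i / B))"
    using assms by (intro norm_prod_diff) auto
  also have "\<dots> = (\<Sum>i\<in>I. \<bar>a i - b i\<bar>) / B"
    using assms(2) by (simp add: sum_divide_distrib flip: diff_divide_distrib)
  also have "\<dots> \<le> (\<Sum>i\<in>I. \<bar>a i - b i\<bar>) / 1"
    using assms(2) by (intro divide_left_mono sum_nonneg) auto
  finally have "\<bar>(\<Prod>i\<in>I. a i) - (\<Prod>i\<in>I. b i)\<bar> / B ^ card I \<le> (\<Sum>i\<in>I. \<bar>a i - b i\<bar>)"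
    using assms(2) by (simp add: prod_dividef flip: diff_divide_distrib)
  then show ?thesis using assms(2) by (simp add: divide_le_eq mult.commute)
qed

lemma abs_prod_le:
  fixes a :: "'i \<Rightarrow> real"
  assumes "\<And>i. i \<in> I \<Longrightarrow> \<bar>a i\<bar> \<le> B"
  shows "\<bar>\<Prod>i\<in>I. a i\<bar> \<le> B ^ card I"
proof -
  have "(\<Prod>i\<in>I. \<bar>a i\<bar>) \<le> (\<Prod>i\<in>I. B)" using assms by (intro prod_mono) auto
  then show ?thesis by (simp add: abs_prod)
qed

lemma bounded_meas_cong_sets: "sets M = sets N \<Longrightarrow> bounded_meas M f \<longleftrightarrow> bounded_meas N f"
  unfolding bounded_meas_def using measurable_cong_sets[of M N borel borel] sets_eq_imp_space_eq[of M N]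
  by auto

text \<open>Otherwise some functions bounded by \<open>B\<close> would tend to 0 in L1 of
  \<open>N\<close> but not of \<open>M\<close>. A subsequence tends to 0 almost everywhere for
  \<open>N\<close>, hence for \<open>M\<close>, against dominated convergence. As \<open>d\<close>
  does not depend on \<open>u\<close>, the lemma applies to all times at once.\<close>

lemma (in prob_space) L1_small_of_absolutely_continuous:
  assumes N: "prob_space N" "sets N = sets M" "null_sets N \<subseteq> null_sets M" and e: "e > 0"
  shows "\<exists>d>0. \<forall>u. bounded_meas M u \<longrightarrow> (\<forall>x\<in>space M. \<bar>u x\<bar> \<le> B) \<longrightarrow>
    (\<integral>x. \<bar>u x\<bar> \<partial>N) < d \<longrightarrow> (\<integral>x. \<bar>u x\<bar> \<partial>M) < e"
proof (rule ccontr)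
  interpret N: prob_space N by fact
  assume "\<not> ?thesis"
  then have "\<forall>n. \<exists>u. bounded_meas M u \<and> (\<forall>x\<in>space M. \<bar>u x\<bar> \<le> B) \<and>
      (\<integral>x. \<bar>u x\<bar> \<partial>N) < 1 / real (Suc n) \<and> e \<le> (\<integral>x. \<bar>u x\<bar> \<partial>M)"
    by (metis not_le of_nat_0_less_iff zero_less_Suc zero_less_divide_1_iff)
  then obtain u where u: "\<And>n. bounded_meas M (u n)" "\<And>n x. x \<in> space M \<Longrightarrow> \<bar>u n x\<bar> \<le> B"
      "\<And>n. (\<integral>x. \<bar>u n x\<bar> \<partial>N) < 1 / real (Suc n)" "\<And>n. e \<le> (\<integral>x. \<bar>u n x\<bar> \<partial>M)"
    by metis
  have [measurable]: "u n \<in> borel_measurable M" for n using u(1) by (rule bounded_meas_measurable)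
  have uN: "bounded_meas N (u n)" for n using u(1) bounded_meas_cong_sets[OF N(2)] by simp
  have "(\<lambda>n. \<integral>x. norm (u n x) \<partial>N) \<longlonglongrightarrow> 0"
  proof (rule tendsto_sandwich[of "\<lambda>n. 0" _ _ "\<lambda>n. 1 / real (Suc n)"])
    show "(\<lambda>n. 1 / real (Suc n)) \<longlonglongrightarrow> 0"
      using LIMSEQ_Suc[OF tendsto_const_over_nat[of 1]] .
    show "\<forall>\<^sub>F n in sequentially. (\<integral>x. norm (u n x) \<partial>N) \<le> 1 / real (Suc n)"
      using u(3) by (intro always_eventually allI less_imp_le) (simp only: real_norm_def)
  qed auto
  then obtain r :: "nat \<Rightarrow> nat" where r: "strict_mono r" "AE x in N. (\<lambda>n. u (r n) x) \<longlonglongrightarrow> 0"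
    using tendsto_L1_AE_subseq[of N u, OF N.integrable_bounded_meas[OF uN]] by blast
  have AEM: "AE x in M. (\<lambda>n. u (r n) x) \<longlonglongrightarrow> 0"
    using r(2) N(3) sets_eq_imp_space_eq[OF N(2)] unfolding eventually_ae_filter by auto
  have "(\<lambda>n. \<integral>x. \<bar>u (r n) x\<bar> \<partial>M) \<longlonglongrightarrow> (\<integral>x. 0 \<partial>M)"
  proof (rule integral_dominated_convergence[where w="\<lambda>x. B"])
    show "AE x in M. (\<lambda>n. \<bar>u (r n) x\<bar>) \<longlonglongrightarrow> 0"
      using AEM by eventually_elim (rule tendsto_rabs_zero)
    show "AE x in M. norm \<bar>u (r n) x\<bar> \<le> B" for n using u(2) by (intro AE_I2) simp
  qed auto
  then have "e \<le> (\<integral>x. 0 \<partial>M)" using u(4) by (intro LIMSEQ_le_const) auto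
  then show False using e by simp
qed

text \<open>The squared error in terms of correlations and means. Used over \<open>M\<close> and
  over \<nu>, it reduces the comparison of the two errors to one of integrals of products.\<close>

lemma (in prob_space) integral_square_cesaro_diff:
  fixes q :: "nat \<Rightarrow> 'a \<Rightarrow> real"
  assumes q: "\<And>n. bounded_meas M (q n)" and N: "N > 0"
  shows "(\<integral>x. (cesaro (\<lambda>n. q n x) N - p)\<^sup>2 \<partial>M)
    = cesaro (\<lambda>n. cesaro (\<lambda>n'. \<integral>x. q n x * q n' x \<partial>M) N) N - 2 * p * cesaro (\<lambda>n. \<integral>x. q n x \<partial>M) N + p\<^sup>2"
proof -
  let ?c = "\<lambda>x. cesaro (\<lambda>n. q n x) N"
  have c: "bounded_meas M ?c" by (intro bounded_meas_cesaro q)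
  have "(\<integral>x. (?c x - p)\<^sup>2 \<partial>M) = (\<integral>x. ?c x * ?c x - 2 * p * ?c x + p\<^sup>2 \<partial>M)"
    by (intro Bochner_Integration.integral_cong) (auto simp: power2_eq_square algebra_simps)
  also have "\<dots> = (\<integral>x. ?c x * ?c x \<partial>M) - 2 * p * (\<integral>x. ?c x \<partial>M) + p\<^sup>2"
    using integrable_bounded_meas[OF bounded_meas_mult[OF c c]] integrable_bounded_meas[OF c]
    by (simp add: prob_space)
  also have "(\<integral>x. ?c x \<partial>M) = cesaro (\<lambda>n. \<integral>x. q n x \<partial>M) N" by (rule integral_cesaro[OF q])
  also have "(\<lambda>x. ?c x * ?c x) = (\<lambda>x. cesaro (\<lambda>n. cesaro (\<lambda>n'. q n x * q n' x) N) N)"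
    by (simp add: cesaro_cmult cesaro_mult_right)
  also have "(\<integral>x. cesaro (\<lambda>n. cesaro (\<lambda>n'. q n x * q n' x) N) N \<partial>M)
      = cesaro (\<lambda>n. cesaro (\<lambda>n'. \<integral>x. q n x * q n' x \<partial>M) N) N"
    by (subst integral_cesaro[OF bounded_meas_cesaro[OF bounded_meas_mult[OF q q]]])
      (subst integral_cesaro[OF bounded_meas_mult[OF q q]], rule refl)
  finally show ?thesis .
qed

text \<open>\<open>M\<close> itself carries no invariance; it is tied to the \<open>\<mu> i\<close>
  by its null sets. The conditions range over all indices, also outside \<open>I\<close>, so that
  facts about single systems have no side condition on \<open>i\<close>.\<close>

locale joint_systems = prob_space M for M :: "'a measure" +
  fixes I :: "'i set" and \<mu> :: "'i \<Rightarrow> 'a measure" and T :: "'i \<Rightarrow> 'a \<Rightarrow> 'a"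
  assumes finite_I: "finite I"
    and measure_preserving: "\<And>i. measure_preserving (\<mu> i) (T i)"
    and sets_\<mu>: "\<And>i. sets (\<mu> i) = sets M"
    and null_sets_\<mu>: "\<And>i. null_sets (\<mu> i) = null_sets M"
begin

lemma space_\<mu>: "space (\<mu> i) = space M"
  by (rule sets_eq_imp_space_eq[OF sets_\<mu>])

lemma bounded_meas_\<mu>: "bounded_meas (\<mu> i) f \<longleftrightarrow> bounded_meas M f"
  by (rule bounded_meas_cong_sets[OF sets_\<mu>])

lemma prob_space_\<mu>: "prob_space (\<mu> i)"
  using measure_preserving[of i] by (simp add: measure_preserving_def)

lemma abs_integral_\<mu>_le:
  assumes "bounded_meas M f" "\<And>x. x \<in> space M \<Longrightarrow> \<bar>f x\<bar> \<le> B"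
  shows "\<bar>\<integral>x. f x \<partial>\<mu> i\<bar> \<le> B"
  using assms by (intro prob_space.abs_integral_le_bound prob_space_\<mu>) (auto simp: bounded_meas_\<mu> space_\<mu>)

lemma Ti_meas: "(T i ^^ n) \<in> measurable M M"
  using measure_preserving.Tn_meas[OF measure_preserving[of i], of n] measurable_cong_sets[OF sets_\<mu> sets_\<mu>] by blast

lemma Ti_space: "x \<in> space M \<Longrightarrow> (T i ^^ n) x \<in> space M"
  using measurable_space[OF Ti_meas] .

lemma bounded_meas_Ti: "bounded_meas M f \<Longrightarrow> bounded_meas M (\<lambda>x. f ((T i ^^ n) x))"
  by (rule bounded_meas_comp[OF _ Ti_meas])

lemma integral_Ti:
  "bounded_meas M f \<Longrightarrow> (\<integral>x. f ((T i ^^ n) x) \<partial>\<mu> i) = (\<integral>x. f x \<partial>\<mu> i)"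
  using measure_preserving.integral_Tn[OF measure_preserving[of i], of f n] by (simp add: bounded_meas_measurable bounded_meas_\<mu>)

lemma Ti_Ti: "(T i ^^ n) ((T i ^^ m) x) = (T i ^^ (n + m)) x"
  by (simp add: funpow_add)

text \<open>The function \<open>f\<^sub>1 \<otimes> \<dots> \<otimes> f\<^sub>k\<close> at the point of the orbit of the diagonal point
  \<open>(x, \<dots>, x)\<close> with multitime \<open>v\<close>.\<close>

definition diag :: "('i \<Rightarrow> 'a \<Rightarrow> real) \<Rightarrow> ('i \<Rightarrow> nat) \<Rightarrow> 'a \<Rightarrow> real" where
  "diag f v x = (\<Prod>i\<in>I. f i ((T i ^^ v i) x))"

lemma bounded_meas_diag:
  "(\<And>i. i \<in> I \<Longrightarrow> bounded_meas M (f i)) \<Longrightarrow> bounded_meas M (diag f v)"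
  unfolding diag_def[abs_def] by (intro bounded_meas_prod bounded_meas_Ti)

lemma abs_diag_le:
  assumes "\<And>i x. i \<in> I \<Longrightarrow> x \<in> space M \<Longrightarrow> \<bar>f i x\<bar> \<le> B" "x \<in> space M"
  shows "\<bar>diag f v x\<bar> \<le> B ^ card I"
  unfolding diag_def using assms Ti_space by (intro abs_prod_le) auto

lemma diag_shift: "diag (\<lambda>i x. f i ((T i ^^ w i) x)) v x = diag f (\<lambda>i. w i + v i) x"
  by (simp add: diag_def Ti_Ti)

lemma diag_mult: "diag f v x * diag g v x = diag (\<lambda>i x. f i x * g i x) v x"
  by (simp add: diag_def prod.distrib)

lemma uniform_bound:
  assumes "\<And>i. i \<in> I \<Longrightarrow> bounded_meas M (f i)"
  obtains B where "B \<ge> 1" "\<And>i x. i \<in> I \<Longrightarrow> x \<in> space M \<Longrightarrow> \<bar>f i x\<bar> \<le> B"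
proof -
  have "\<forall>i\<in>I. \<exists>B\<ge>1. \<forall>x\<in>space M. \<bar>f i x\<bar> \<le> B" using assms by (metis bounded_measE)
  then obtain b where b: "\<And>i. i \<in> I \<Longrightarrow> b i \<ge> 1" "\<And>i x. i \<in> I \<Longrightarrow> x \<in> space M \<Longrightarrow> \<bar>f i x\<bar> \<le> b i"
    by metis
  define B where "B = 1 + (\<Sum>i\<in>I. b i)"
  have "0 \<le> (\<Sum>i\<in>I. b i)" using b(1) by (intro sum_nonneg) force
  moreover have "b i \<le> (\<Sum>i\<in>I. b i)" if "i \<in> I" for i
    using that finite_I b(1) by (intro member_le_sum) force+
  ultimately show thesis using b by (intro that[of B]) (force simp: B_def)+
qed

text \<open>Colour a multitime by the colours of its components: finitely many combinations occur.
  Equal colours make each pair of factors close in L1 of \<open>\<mu> i\<close>, equally for every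
  common shift \<open>n\<close> because \<open>T i\<close> preserves \<open>\<mu> i\<close>.
  Absolute continuity moves this to \<open>M\<close>, and products are compared factor by
  factor.\<close>

lemma diag_totally_bounded:
  assumes f: "\<And>i. i \<in> I \<Longrightarrow> measure_preserving.almost_periodic (\<mu> i) (T i) (f i)" and e: "e > 0"
  shows "\<exists>V. finite V \<and> (\<forall>v. \<exists>v'\<in>V. \<forall>n.
    (\<integral>x. \<bar>diag f (\<lambda>i. n + v i) x - diag f (\<lambda>i. n + v' i) x\<bar> \<partial>M) \<le> e)"
proof -
  have fb: "bounded_meas M (f i)" if "i \<in> I" for i
    using measure_preserving.almost_periodic_bounded[OF measure_preserving f[OF that]] by (simp add: bounded_meas_\<mu>)
  obtain B where B: "B \<ge> 1" "\<And>i x. i \<in> I \<Longrightarrow> x \<in> space M \<Longrightarrow> \<bar>f i x\<bar> \<le> B"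
    using uniform_bound[of f] fb by blast
  \<comment> \<open>\<open>B ^ card I\<close> comes from comparing products and
    \<open>card I\<close> from summing over the factors; the 1 avoids a zero denominator.\<close>
  define e' where "e' = e / (B ^ card I * (real (card I) + 1))"
  have B0: "B ^ card I > 0" using B(1) by simp
  have e': "e' > 0" unfolding e'_def using e B0 by (intro divide_pos_pos mult_pos_pos) auto
  have "\<exists>d>0. \<forall>u. bounded_meas M u \<longrightarrow> (\<forall>x\<in>space M. \<bar>u x\<bar> \<le> 2 * B) \<longrightarrow>
    (\<integral>x. \<bar>u x\<bar> \<partial>\<mu> i) < d \<longrightarrow> (\<integral>x. \<bar>u x\<bar> \<partial>M) < e'" for i
    using e' by (intro L1_small_of_absolutely_continuous prob_space_\<mu> sets_\<mu>) (simp_all add: null_sets_\<mu>)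
  then obtain d where d: "\<And>i. d i > 0" "\<And>i u. bounded_meas M u \<Longrightarrow> (\<forall>x\<in>space M. \<bar>u x\<bar> \<le> 2 * B) \<Longrightarrow>
    (\<integral>x. \<bar>u x\<bar> \<partial>\<mu> i) < d i \<Longrightarrow> (\<integral>x. \<bar>u x\<bar> \<partial>M) < e'"
    by metis
  have "\<forall>i\<in>I. \<exists>c :: nat \<Rightarrow> nat. finite (range c) \<and>
    (\<forall>m n. c m = c n \<longrightarrow> (\<integral>x. \<bar>f i ((T i ^^ m) x) - f i ((T i ^^ n) x)\<bar> \<partial>\<mu> i) < d i)"
    using measure_preserving.almost_periodic_coloring[OF measure_preserving f d(1)] by blast
  then obtain c :: "'i \<Rightarrow> nat \<Rightarrow> nat" where c: "\<And>i. i \<in> I \<Longrightarrow> finite (range (c i))"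
    "\<And>i m n. i \<in> I \<Longrightarrow> c i m = c i n \<Longrightarrow>
      (\<integral>x. \<bar>f i ((T i ^^ m) x) - f i ((T i ^^ n) x)\<bar> \<partial>\<mu> i) < d i"
    by metis
  define col where "col v = (\<lambda>i\<in>I. c i (v i))" for v
  have "range col \<subseteq> (\<Pi>\<^sub>E i\<in>I. range (c i))" unfolding col_def by auto
  then have fin: "finite (range col)"
    by (rule finite_subset) (intro finite_PiE finite_I c(1))
  define V where "V = inv col ` range col"
  have "(\<integral>x. \<bar>diag f (\<lambda>i. n + v i) x - diag f (\<lambda>i. n + v' i) x\<bar> \<partial>M) \<le> e"
    if eq: "col v = col v'" for v v' n
  proof -
    let ?u = "\<lambda>i x. f i ((T i ^^ (n + v i)) x) - f i ((T i ^^ (n + v' i)) x)"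
    have ub: "bounded_meas M (?u i)" if "i \<in> I" for i
      using that by (intro bounded_meas_diff bounded_meas_Ti fb)
    have u: "(\<integral>x. \<bar>?u i x\<bar> \<partial>M) < e'" if i: "i \<in> I" for i
    proof (rule d(2)[of "?u i" i, OF ub[OF i]])
      show "\<forall>x\<in>space M. \<bar>?u i x\<bar> \<le> 2 * B"
      proof
        fix x assume "x \<in> space M"
        then show "\<bar>?u i x\<bar> \<le> 2 * B"
          using B(2)[OF i Ti_space[of x "n + v i" i]] B(2)[OF i Ti_space[of x "n + v' i" i]] by linarith
      qed
      have "c i (v i) = c i (v' i)" using fun_cong[OF eq, of i] i by (simp add: col_def)
      from c(2)[OF i this]
      show "(\<integral>x. \<bar>?u i x\<bar> \<partial>\<mu> i) < d i"
        using measure_preserving.integral_abs_diff_Tn_shift[OF measure_preserving[of i], of "f i"] fb[OF i]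
        by (simp add: bounded_meas_\<mu> add.commute[of n])
    qed
    have "(\<integral>x. \<bar>diag f (\<lambda>i. n + v i) x - diag f (\<lambda>i. n + v' i) x\<bar> \<partial>M)
        \<le> (\<integral>x. B ^ card I * (\<Sum>i\<in>I. \<bar>?u i x\<bar>) \<partial>M)"
    proof (rule integral_mono)
      show "integrable M (\<lambda>x. \<bar>diag f (\<lambda>i. n + v i) x - diag f (\<lambda>i. n + v' i) x\<bar>)"
        by (intro integrable_bounded_meas bounded_meas_abs bounded_meas_diff bounded_meas_diag fb)
      show "integrable M (\<lambda>x. B ^ card I * (\<Sum>i\<in>I. \<bar>?u i x\<bar>))"
        by (intro integrable_bounded_meas bounded_meas_mult bounded_meas_const bounded_meas_sum bounded_meas_abs ub)
      fix x assume "x \<in> space M"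
      then show "\<bar>diag f (\<lambda>i. n + v i) x - diag f (\<lambda>i. n + v' i) x\<bar> \<le> B ^ card I * (\<Sum>i\<in>I. \<bar>?u i x\<bar>)"
        unfolding diag_def using B Ti_space by (intro abs_prod_diff_le finite_I) auto
    qed
    also have "\<dots> = B ^ card I * (\<Sum>i\<in>I. \<integral>x. \<bar>?u i x\<bar> \<partial>M)"
      unfolding integral_mult_right_zero
      using integrable_bounded_meas[OF bounded_meas_abs[OF ub]]
      by (subst Bochner_Integration.integral_sum) auto
    also have "\<dots> \<le> B ^ card I * (\<Sum>i\<in>I. e')"
      using u B0 by (intro mult_left_mono sum_mono less_imp_le) auto
    also have "\<dots> = e * (real (card I) / (real (card I) + 1))"
      unfolding e'_def using B0 B(1) by simp
    also have "\<dots> \<le> e * 1" using e by (intro mult_left_mono) auto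
    finally show ?thesis by simp
  qed
  moreover have "col (inv col (col v)) = col v" for v by (simp add: f_inv_into_f)
  ultimately have "(\<integral>x. \<bar>diag f (\<lambda>i. n + v i) x - diag f (\<lambda>i. n + inv col (col v) i) x\<bar> \<partial>M) \<le> e" for v n
    by simp
  then have "\<forall>v. \<exists>v'\<in>V. \<forall>n.
    (\<integral>x. \<bar>diag f (\<lambda>i. n + v i) x - diag f (\<lambda>i. n + v' i) x\<bar> \<partial>M) \<le> e"
    unfolding V_def by blast
  moreover have "finite V" using fin unfolding V_def by simp
  ultimately show ?thesis by blast
qed

section \<open>Weak convergence of averages along shifted diagonals\<close>

definition weakly_jointly_ergodic :: bool where
  "weakly_jointly_ergodic \<longleftrightarrow> (\<forall>f0 f. bounded_meas M f0 \<longrightarrow> (\<forall>i\<in>I. bounded_meas M (f i)) \<longrightarrow>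
    cesaro (\<lambda>n. \<integral>x. f0 x * diag f (\<lambda>i. n) x \<partial>M) \<longlonglongrightarrow> (\<integral>x. f0 x \<partial>M) * (\<Prod>i\<in>I. \<integral>y. f i y \<partial>\<mu> i))"

text \<open>A fixed shift is absorbed into \<open>f i\<close>, whose integral over
  \<open>\<mu> i\<close> it leaves unchanged.\<close>

lemma weakly_jointly_ergodic_shift:
  assumes W: weakly_jointly_ergodic and f0: "bounded_meas M f0" and f: "\<And>i. i \<in> I \<Longrightarrow> bounded_meas M (f i)"
  shows "cesaro (\<lambda>n. \<integral>x. f0 x * diag f (\<lambda>i. n + v i) x \<partial>M)
    \<longlonglongrightarrow> (\<integral>x. f0 x \<partial>M) * (\<Prod>i\<in>I. \<integral>y. f i y \<partial>\<mu> i)"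
proof -
  have "cesaro (\<lambda>n. \<integral>x. f0 x * diag (\<lambda>i x. f i ((T i ^^ v i) x)) (\<lambda>i. n) x \<partial>M)
    \<longlonglongrightarrow> (\<integral>x. f0 x \<partial>M) * (\<Prod>i\<in>I. \<integral>y. f i ((T i ^^ v i) y) \<partial>\<mu> i)"
    using W f0 f unfolding weakly_jointly_ergodic_def by (simp add: bounded_meas_Ti)
  then show ?thesis using f by (simp add: diag_shift integral_Ti add.commute)
qed

text \<open>Weak convergence is strong, uniformly over the multitimes, for almost periodic functions: their
  multitime orbits are totally bounded.\<close>

lemma almost_periodic_uniform_convergence:
  assumes W: weakly_jointly_ergodic
    and f: "\<And>i. i \<in> I \<Longrightarrow> measure_preserving.almost_periodic (\<mu> i) (T i) (f i)" and e: "e > 0"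
  defines "p \<equiv> (\<Prod>i\<in>I. \<integral>y. f i y \<partial>\<mu> i)"
  shows "\<exists>N0. \<forall>N\<ge>N0. \<forall>v. (\<integral>x. (cesaro (\<lambda>n. diag f (\<lambda>i. n + v i) x) N - p)\<^sup>2 \<partial>M) \<le> e"
proof -
  have fb: "bounded_meas M (f i)" if "i \<in> I" for i
    using measure_preserving.almost_periodic_bounded[OF measure_preserving f[OF that]] by (simp add: bounded_meas_\<mu>)
  obtain B where B: "B \<ge> 1" "\<And>i x. i \<in> I \<Longrightarrow> x \<in> space M \<Longrightarrow> \<bar>f i x\<bar> \<le> B"
    using uniform_bound[of f] fb by blast
  define C where "C = B ^ card I"
  have C: "C \<ge> 1" unfolding C_def using B(1) by simp
  have Qb: "bounded_meas M (diag f v)" for v by (intro bounded_meas_diag fb)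
  have QC: "\<bar>diag f v x\<bar> \<le> C" if "x \<in> space M" for v x unfolding C_def using B(2) that by (rule abs_diag_le)
  have pC: "\<bar>p\<bar> \<le> C" unfolding p_def C_def using fb B(2) by (intro abs_prod_le abs_integral_\<mu>_le)
  define D where "D N v x = cesaro (\<lambda>n. diag f (\<lambda>i. n + v i) x) N" for N v x
  have Db: "bounded_meas M (D N v)" for N v unfolding D_def[abs_def] by (intro bounded_meas_cesaro Qb)
  have DC: "\<bar>D N v x\<bar> \<le> C" if "x \<in> space M" for N v x
    unfolding D_def by (intro abs_cesaro_le_bound QC that)
  \<comment> \<open>The errors below add up to \<open>e / 2 + 6 * C * \<delta> = e\<close>.\<close>
  define \<delta> where "\<delta> = e / (12 * C)"
  have \<delta>: "\<delta> > 0" unfolding \<delta>_def using e C by simp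
  obtain V where V: "finite V" "\<And>v. \<exists>v'\<in>V. \<forall>n.
    (\<integral>x. \<bar>diag f (\<lambda>i. n + v i) x - diag f (\<lambda>i. n + v' i) x\<bar> \<partial>M) \<le> \<delta>"
    using diag_totally_bounded[of f \<delta>] f \<delta> by blast
  \<comment> \<open>Weak convergence along \<open>v\<close>, tested against the bounded function
    \<open>diag f w - p\<close>.\<close>
  have lim: "(\<lambda>N. \<integral>x. (diag f w x - p) * (D N v x - p) \<partial>M) \<longlonglongrightarrow> 0" for v w
  proof -
    let ?q = "\<lambda>x. diag f w x - p"
    have qb: "bounded_meas M ?q" by (intro bounded_meas_diff Qb bounded_meas_const)
    have "(\<integral>x. ?q x * (D N v x - p) \<partial>M) = cesaro (\<lambda>n. \<integral>x. ?q x * diag f (\<lambda>i. n + v i) x \<partial>M) N - (\<integral>x. ?q x \<partial>M) * p" for N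
    proof -
      have "(\<integral>x. ?q x * (D N v x - p) \<partial>M) = (\<integral>x. ?q x * D N v x - ?q x * p \<partial>M)"
        by (simp add: right_diff_distrib)
      also have "\<dots> = (\<integral>x. ?q x * D N v x \<partial>M) - (\<integral>x. ?q x * p \<partial>M)"
        by (intro Bochner_Integration.integral_diff integrable_bounded_meas bounded_meas_mult qb Db bounded_meas_const)
      also have "(\<integral>x. ?q x * D N v x \<partial>M) = (\<integral>x. cesaro (\<lambda>n. ?q x * diag f (\<lambda>i. n + v i) x) N \<partial>M)"
        unfolding D_def cesaro_cmult ..
      also have "\<dots> = cesaro (\<lambda>n. \<integral>x. ?q x * diag f (\<lambda>i. n + v i) x \<partial>M) N"
        by (intro integral_cesaro bounded_meas_mult qb Qb)
      finally show ?thesis by simp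
    qed
    moreover have "(\<lambda>N. cesaro (\<lambda>n. \<integral>x. ?q x * diag f (\<lambda>i. n + v i) x \<partial>M) N - (\<integral>x. ?q x \<partial>M) * p)
        \<longlonglongrightarrow> (\<integral>x. ?q x \<partial>M) * p - (\<integral>x. ?q x \<partial>M) * p"
      unfolding p_def by (intro tendsto_diff tendsto_const weakly_jointly_ergodic_shift W bounded_meas_diff Qb bounded_meas_const fb)
    ultimately show ?thesis by simp
  qed
  have "\<forall>\<^sub>F N in sequentially. \<forall>v\<in>V. \<forall>w\<in>V. \<bar>\<integral>x. (diag f w x - p) * (D N v x - p) \<partial>M\<bar> \<le> e / 2"
  proof (intro eventually_ball_finite V(1) ballI)
    fix v w
    have "\<forall>\<^sub>F N in sequentially. \<bar>\<integral>x. (diag f w x - p) * (D N v x - p) \<partial>M\<bar> < e / 2"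
      using order_tendstoD(2)[OF tendsto_rabs_zero[OF lim[of w v]], of "e/2"] e by simp
    then show "\<forall>\<^sub>F N in sequentially. \<bar>\<integral>x. (diag f w x - p) * (D N v x - p) \<partial>M\<bar> \<le> e / 2"
      by eventually_elim simp
  qed
  then obtain N0 where N0: "\<And>N v w. N \<ge> N0 \<Longrightarrow> v \<in> V \<Longrightarrow> w \<in> V \<Longrightarrow>
      \<bar>\<integral>x. (diag f w x - p) * (D N v x - p) \<partial>M\<bar> \<le> e / 2"
    unfolding eventually_sequentially by blast
  have main: "(\<integral>x. (D N v x - p)\<^sup>2 \<partial>M) \<le> e" if N: "N \<ge> Suc N0" for N v
  proof -
    obtain v' where v': "v' \<in> V" and vv': "\<And>n. (\<integral>x. \<bar>diag f (\<lambda>i. n + v i) x - diag f (\<lambda>i. n + v' i) x\<bar> \<partial>M) \<le> \<delta>"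
      using V(2)[of v] by blast
    have D'b: "bounded_meas M (\<lambda>x. D N v' x - p)" by (intro bounded_meas_diff Db bounded_meas_const)
    have D'C: "\<bar>D N v' x - p\<bar> \<le> 2 * C" if "x \<in> space M" for x
      using DC[OF that, of N v'] pC by linarith
    \<comment> \<open>The test function changes with \<open>n\<close>, but it is within
      \<open>\<delta>\<close> of one with multitime in the finite set \<open>V\<close>, for which
      \<open>N0\<close> was chosen. The uniformity in shifts is used at shift 0 only.\<close>
    have q_le: "(\<integral>x. (diag f (\<lambda>i. n + v' i) x - p) * (D N v' x - p) \<partial>M) \<le> e / 2 + 2 * C * \<delta>" for n
    proof -
      let ?q = "diag f (\<lambda>i. n + v' i)"
      obtain w where w: "w \<in> V" and "\<And>m. (\<integral>x. \<bar>diag f (\<lambda>i. m + (n + v' i)) x - diag f (\<lambda>i. m + w i) x\<bar> \<partial>M) \<le> \<delta>"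
        using V(2)[of "\<lambda>i. n + v' i"] by blast
      from this(2)[of 0] have qw: "(\<integral>x. \<bar>?q x - diag f w x\<bar> \<partial>M) \<le> \<delta>" by simp
      have "(\<integral>x. (?q x - p) * (D N v' x - p) \<partial>M)
        = (\<integral>x. (D N v' x - p) * (?q x - diag f w x) + (diag f w x - p) * (D N v' x - p) \<partial>M)"
        by (intro Bochner_Integration.integral_cong) (auto simp: algebra_simps)
      also have "\<dots> = (\<integral>x. (D N v' x - p) * (?q x - diag f w x) \<partial>M) + (\<integral>x. (diag f w x - p) * (D N v' x - p) \<partial>M)"
        by (intro Bochner_Integration.integral_add integrable_bounded_meas bounded_meas_mult D'b bounded_meas_diff Qb bounded_meas_const)
      also have "(\<integral>x. (D N v' x - p) * (?q x - diag f w x) \<partial>M) \<le> 2 * C * (\<integral>x. \<bar>?q x - diag f w x\<bar> \<partial>M)"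
        by (rule order_trans[OF abs_ge_self abs_integral_mult_le]) (intro D'b D'C bounded_meas_diff Qb)+
      also have "\<dots> \<le> 2 * C * \<delta>" using qw C by (intro mult_left_mono) auto
      also have "(\<integral>x. (diag f w x - p) * (D N v' x - p) \<partial>M) \<le> e / 2"
        using N0[OF _ v' w, of N] N by linarith
      finally show ?thesis by simp
    qed
    \<comment> \<open>Only one of the two equal factors is expanded as an average; the other stays,
      so bounds on inner products control the norm.\<close>
    have "(\<integral>x. (D N v' x - p)\<^sup>2 \<partial>M)
      = (\<integral>x. cesaro (\<lambda>n. (diag f (\<lambda>i. n + v' i) x - p) * (D N v' x - p)) N \<partial>M)"
      using N by (intro Bochner_Integration.integral_cong refl)
        (simp add: cesaro_mult_right cesaro_diff cesaro_const D_def power2_eq_square)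
    also have "\<dots> = cesaro (\<lambda>n. \<integral>x. (diag f (\<lambda>i. n + v' i) x - p) * (D N v' x - p) \<partial>M) N"
      by (intro integral_cesaro bounded_meas_mult D'b bounded_meas_diff Qb bounded_meas_const)
    also have "\<dots> \<le> cesaro (\<lambda>n. e / 2 + 2 * C * \<delta>) N" by (intro cesaro_mono q_le)
    also have "\<dots> = e / 2 + 2 * C * \<delta>" using N by (intro cesaro_const) simp
    finally have v'_le: "(\<integral>x. (D N v' x - p)\<^sup>2 \<partial>M) \<le> e / 2 + 2 * C * \<delta>" .
    have DD: "(\<integral>x. \<bar>D N v x - D N v' x\<bar> \<partial>M) \<le> \<delta>"
    proof -
      have "(\<integral>x. \<bar>D N v x - D N v' x\<bar> \<partial>M)
          \<le> (\<integral>x. cesaro (\<lambda>n. \<bar>diag f (\<lambda>i. n + v i) x - diag f (\<lambda>i. n + v' i) x\<bar>) N \<partial>M)"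
      proof (rule integral_mono)
        show "\<bar>D N v x - D N v' x\<bar> \<le> cesaro (\<lambda>n. \<bar>diag f (\<lambda>i. n + v i) x - diag f (\<lambda>i. n + v' i) x\<bar>) N" for x
          unfolding D_def cesaro_diff[symmetric] by (rule abs_cesaro_le)
      qed (intro integrable_bounded_meas bounded_meas_cesaro bounded_meas_abs bounded_meas_diff Qb Db)+
      also have "\<dots> = cesaro (\<lambda>n. \<integral>x. \<bar>diag f (\<lambda>i. n + v i) x - diag f (\<lambda>i. n + v' i) x\<bar> \<partial>M) N"
        by (intro integral_cesaro bounded_meas_abs bounded_meas_diff Qb)
      also have "\<dots> \<le> cesaro (\<lambda>n. \<delta>) N" by (intro cesaro_mono vv')
      also have "\<dots> = \<delta>" using N by (intro cesaro_const) simp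
      finally show ?thesis .
    qed
    have "(\<integral>x. (D N v x - p)\<^sup>2 \<partial>M) \<le> (\<integral>x. (D N v' x - p)\<^sup>2 + 4 * C * \<bar>D N v x - D N v' x\<bar> \<partial>M)"
    proof (rule integral_mono)
      fix x assume x: "x \<in> space M"
      have "(D N v x - p)\<^sup>2 - (D N v' x - p)\<^sup>2 = ((D N v x - p) + (D N v' x - p)) * (D N v x - D N v' x)"
        by (simp add: power2_eq_square algebra_simps)
      also have "\<dots> \<le> \<bar>(D N v x - p) + (D N v' x - p)\<bar> * \<bar>D N v x - D N v' x\<bar>"
        unfolding abs_mult[symmetric] by (rule abs_ge_self)
      also have "\<dots> \<le> (4 * C) * \<bar>D N v x - D N v' x\<bar>"
        using DC[OF x, of N v] DC[OF x, of N v'] pC by (intro mult_right_mono) linarith+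
      finally show "(D N v x - p)\<^sup>2 \<le> (D N v' x - p)\<^sup>2 + 4 * C * \<bar>D N v x - D N v' x\<bar>" by simp
    qed (intro integrable_bounded_meas bounded_meas_add bounded_meas_mult bounded_meas_const bounded_meas_power bounded_meas_abs bounded_meas_diff Db)+
    also have "\<dots> = (\<integral>x. (D N v' x - p)\<^sup>2 \<partial>M) + (\<integral>x. 4 * C * \<bar>D N v x - D N v' x\<bar> \<partial>M)"
      by (intro Bochner_Integration.integral_add integrable_bounded_meas bounded_meas_mult bounded_meas_const bounded_meas_power bounded_meas_abs bounded_meas_diff Db)
    also have "(\<integral>x. 4 * C * \<bar>D N v x - D N v' x\<bar> \<partial>M) = 4 * C * (\<integral>x. \<bar>D N v x - D N v' x\<bar> \<partial>M)" by simp
    also have "\<dots> \<le> 4 * C * \<delta>" using DD C by (intro mult_left_mono) auto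
    finally have "(\<integral>x. (D N v x - p)\<^sup>2 \<partial>M) \<le> e / 2 + 2 * C * \<delta> + 4 * C * \<delta>" using v'_le by linarith
    also have "\<dots> = e" unfolding \<delta>_def using C by (simp add: field_simps)
    finally show ?thesis .
  qed
  then show ?thesis unfolding D_def by (intro exI[of _ "Suc N0"]) blast
qed

end

section \<open>The product system\<close>

lemma (in prob_space) tendsto_L2_add:
  assumes u: "\<And>n. bounded_meas M (u n)" "\<And>n. bounded_meas M (v n)"
    and lim: "(\<lambda>n. \<integral>x. (u n x)\<^sup>2 \<partial>M) \<longlonglongrightarrow> 0" "(\<lambda>n. \<integral>x. (v n x)\<^sup>2 \<partial>M) \<longlonglongrightarrow> 0"
  shows "(\<lambda>n. \<integral>x. (u n x + v n x)\<^sup>2 \<partial>M) \<longlonglongrightarrow> 0"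
proof (rule tendsto_sandwich[of "\<lambda>n. 0" _ _ "\<lambda>n. 2 * (\<integral>x. (u n x)\<^sup>2 \<partial>M) + 2 * (\<integral>x. (v n x)\<^sup>2 \<partial>M)"])
  have "(\<integral>x. (u n x + v n x)\<^sup>2 \<partial>M) \<le> 2 * (\<integral>x. (u n x)\<^sup>2 \<partial>M) + 2 * (\<integral>x. (v n x)\<^sup>2 \<partial>M)" for n
  proof -
    have i: "integrable M (\<lambda>x. (u n x)\<^sup>2)" "integrable M (\<lambda>x. (v n x)\<^sup>2)"
      by (intro integrable_bounded_meas bounded_meas_power u)+
    have "(\<integral>x. (u n x + v n x)\<^sup>2 \<partial>M) \<le> (\<integral>x. 2 * (u n x)\<^sup>2 + 2 * (v n x)\<^sup>2 \<partial>M)"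
    proof (rule integral_mono)
      fix x
      have "0 \<le> (u n x - v n x)\<^sup>2" by simp
      then show "(u n x + v n x)\<^sup>2 \<le> 2 * (u n x)\<^sup>2 + 2 * (v n x)\<^sup>2"
        by (simp add: power2_eq_square algebra_simps)
    qed (use i in \<open>auto intro!: integrable_bounded_meas bounded_meas_power bounded_meas_add u\<close>)
    then show ?thesis using i by simp
  qed
  then show "\<forall>\<^sub>F n in sequentially. (\<integral>x. (u n x + v n x)\<^sup>2 \<partial>M)
      \<le> 2 * (\<integral>x. (u n x)\<^sup>2 \<partial>M) + 2 * (\<integral>x. (v n x)\<^sup>2 \<partial>M)" by (intro always_eventually allI)
  show "(\<lambda>n. 2 * (\<integral>x. (u n x)\<^sup>2 \<partial>M) + 2 * (\<integral>x. (v n x)\<^sup>2 \<partial>M)) \<longlonglongrightarrow> 0"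
    using tendsto_add[OF tendsto_mult_left[OF lim(1), of 2] tendsto_mult_left[OF lim(2), of 2]] by simp
qed auto

lemma (in prob_space) tendsto_L2_sum:
  assumes "finite J" "\<And>j n. j \<in> J \<Longrightarrow> bounded_meas M (u j n)"
    "\<And>j. j \<in> J \<Longrightarrow> (\<lambda>n. \<integral>x. (u j n x)\<^sup>2 \<partial>M) \<longlonglongrightarrow> 0"
  shows "(\<lambda>n. \<integral>x. (\<Sum>j\<in>J. u j n x)\<^sup>2 \<partial>M) \<longlonglongrightarrow> 0"
  using assms
proof (induction J rule: finite_induct)
  case (insert j J)
  then have "(\<lambda>n. \<integral>x. (u j n x + (\<Sum>j\<in>J. u j n x))\<^sup>2 \<partial>M) \<longlonglongrightarrow> 0"
    by (intro tendsto_L2_add bounded_meas_sum) auto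
  then show ?case using insert.hyps by simp
qed simp

text \<open>Every distance from \<open>n\<close> occurs at most once on each side.\<close>

lemma sum_dist_le:
  fixes b :: "nat \<Rightarrow> real"
  assumes b: "\<And>n. b n \<ge> 0" and n: "n < N"
  shows "(\<Sum>n'<N. b (nat \<bar>int n - int n'\<bar>)) \<le> 2 * (\<Sum>h<N. b h)"
proof -
  have "{..<N} = {..<n} \<union> {n..<N}" using n by auto
  then have "(\<Sum>n'<N. b (nat \<bar>int n - int n'\<bar>))
      = (\<Sum>n'<n. b (nat \<bar>int n - int n'\<bar>)) + (\<Sum>n'=n..<N. b (nat \<bar>int n - int n'\<bar>))"
    by (simp add: sum.union_disjoint ivl_disj_int)
  also have "(\<Sum>n'<n. b (nat \<bar>int n - int n'\<bar>)) = (\<Sum>h\<in>(\<lambda>n'. n - n') ` {..<n}. b h)"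
    by (subst sum.reindex) (auto simp: inj_on_def nat_diff_distrib intro!: sum.cong arg_cong[where f=b])
  also have "\<dots> \<le> (\<Sum>h<N. b h)"
    using b n by (intro sum_mono2) auto
  also have "(\<Sum>n'=n..<N. b (nat \<bar>int n - int n'\<bar>)) = (\<Sum>h\<in>(\<lambda>n'. n' - n) ` {n..<N}. b h)"
    by (subst sum.reindex) (auto simp: inj_on_def nat_diff_distrib intro!: sum.cong arg_cong[where f=b])
  also have "\<dots> \<le> (\<Sum>h<N. b h)"
    using b n by (intro sum_mono2) auto
  finally show ?thesis by simp
qed

context joint_systems
begin

abbreviation "\<nu> \<equiv> PiM I \<mu>"

definition prod_map :: "('i \<Rightarrow> 'a) \<Rightarrow> 'i \<Rightarrow> 'a" where
  "prod_map \<omega> = (\<lambda>i\<in>I. T i (\<omega> i))"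

definition tensor :: "('i \<Rightarrow> 'a \<Rightarrow> real) \<Rightarrow> ('i \<Rightarrow> 'a) \<Rightarrow> real" where
  "tensor f \<omega> = (\<Prod>i\<in>I. f i (\<omega> i))"

lemma product_sigma_finite_\<mu>: "product_sigma_finite \<mu>"
  unfolding product_sigma_finite_def
  using prob_space_\<mu> by (simp add: prob_space_imp_sigma_finite)

lemma prob_space_\<nu>: "prob_space \<nu>"
  by (intro prob_space_PiM prob_space_\<mu>)

lemma space_\<nu>: "\<omega> \<in> space \<nu> \<longleftrightarrow> \<omega> \<in> I \<rightarrow>\<^sub>E space M"
  by (simp add: space_PiM space_\<mu> cong: PiE_cong)

lemma prod_map_meas: "prod_map \<in> measurable \<nu> \<nu>"
  unfolding prod_map_def[abs_def]
  using measure_preserving.T_meas[OF measure_preserving] by (intro measurable_restrict measurable_compose[OF measurable_component_singleton])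

text \<open>Rectangles determine the product measure, and their preimages are again
  rectangles.\<close>

lemma invariant_prod: "invariant_measure \<nu> prod_map"
  unfolding invariant_measure_def
proof (intro conjI prod_map_meas)
  interpret product_sigma_finite \<mu> by (rule product_sigma_finite_\<mu>)
  show "distr \<nu> \<nu> prod_map = \<nu>"
  proof (rule PiM_eqI[OF finite_I])
    fix A assume A: "\<And>i. i \<in> I \<Longrightarrow> A i \<in> sets (\<mu> i)"
    have "emeasure (distr \<nu> \<nu> prod_map) (Pi\<^sub>E I A) = emeasure \<nu> (prod_map -` Pi\<^sub>E I A \<inter> space \<nu>)"
      using A by (intro emeasure_distr prod_map_meas sets_PiM_I_finite finite_I)
    also have "prod_map -` Pi\<^sub>E I A \<inter> space \<nu> = (\<Pi>\<^sub>E i\<in>I. T i -` A i \<inter> space (\<mu> i))"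
      by (auto simp: prod_map_def space_PiM PiE_iff)
    also have "emeasure \<nu> \<dots> = (\<Prod>i\<in>I. emeasure (\<mu> i) (T i -` A i \<inter> space (\<mu> i)))"
      using A measure_preserving.T_meas[OF measure_preserving] by (intro emeasure_PiM finite_I measurable_sets)
    also have "\<dots> = (\<Prod>i\<in>I. emeasure (\<mu> i) (A i))"
    proof (rule prod.cong[OF refl])
      fix i assume i: "i \<in> I"
      have "distr (\<mu> i) (\<mu> i) (T i) = \<mu> i"
        using measure_preserving.invariant[OF measure_preserving[of i]] by (simp add: invariant_measure_def)
      then show "emeasure (\<mu> i) (T i -` A i \<inter> space (\<mu> i)) = emeasure (\<mu> i) (A i)"
        using emeasure_distr[OF measure_preserving.T_meas[OF measure_preserving[of i]] A[OF i]] by simp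
    qed
    finally show "emeasure (distr \<nu> \<nu> prod_map) (Pi\<^sub>E I A) = (\<Prod>i\<in>I. emeasure (\<mu> i) (A i))" .
  qed simp
qed

lemma measure_preserving_\<nu>: "measure_preserving \<nu> prod_map"
  using prob_space_\<nu> invariant_prod by (simp add: measure_preserving_def measure_preserving_axioms_def)

lemma prod_map_power: "i \<in> I \<Longrightarrow> (prod_map ^^ n) \<omega> i = (T i ^^ n) (\<omega> i)"
  by (induction n) (auto simp: prod_map_def)

lemma tensor_prod_map: "tensor f ((prod_map ^^ n) \<omega>) = tensor (\<lambda>i x. f i ((T i ^^ n) x)) \<omega>"
  unfolding tensor_def by (intro prod.cong refl) (simp add: prod_map_power)

lemma tensor_mult: "tensor f \<omega> * tensor g \<omega> = tensor (\<lambda>i x. f i x * g i x) \<omega>"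
  by (simp add: tensor_def prod.distrib)

lemma bounded_meas_tensor:
  assumes "\<And>i. i \<in> I \<Longrightarrow> bounded_meas M (f i)" shows "bounded_meas \<nu> (tensor f)"
  unfolding tensor_def[abs_def]
  using assms bounded_meas_\<mu> by (intro bounded_meas_prod bounded_meas_comp[OF _ measurable_component_singleton]) auto

lemma integral_tensor:
  assumes "\<And>i. i \<in> I \<Longrightarrow> bounded_meas M (f i)"
  shows "(\<integral>\<omega>. tensor f \<omega> \<partial>\<nu>) = (\<Prod>i\<in>I. \<integral>x. f i x \<partial>\<mu> i)"
  unfolding tensor_def
  using assms by (intro product_sigma_finite.product_integral_prod product_sigma_finite_\<mu> finite_I
      prob_space.integrable_bounded_meas prob_space_\<mu>) (simp add: bounded_meas_\<mu>)

lemma integral_tensor_mult: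
  assumes "\<And>i. i \<in> I \<Longrightarrow> bounded_meas M (f i)"
  shows "(\<integral>\<omega>. tensor f ((prod_map ^^ n) \<omega>) * tensor f ((prod_map ^^ n') \<omega>) \<partial>\<nu>)
    = (\<Prod>i\<in>I. \<integral>x. f i ((T i ^^ n) x) * f i ((T i ^^ n') x) \<partial>\<mu> i)"
  unfolding tensor_prod_map tensor_mult
  using assms by (intro integral_tensor bounded_meas_mult bounded_meas_Ti)

text \<open>Averaging over all multitimes replaces the diagonal measure by the product measure, when each
  \<open>T\<^sub>i\<close> is ergodic.\<close>

lemma multitime_average:
  assumes erg: "\<And>i. i \<in> I \<Longrightarrow> ergodic (\<mu> i) (T i)"
    and h: "\<And>i. i \<in> I \<Longrightarrow> bounded_meas M (h i)"
  shows "(\<lambda>K. (1 / real K) ^ card I * (\<Sum>v\<in>I \<rightarrow>\<^sub>E {..<K}. \<integral>x. diag h v x \<partial>M)) \<longlonglongrightarrow> (\<Prod>i\<in>I. \<integral>x. h i x \<partial>\<mu> i)"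
proof -
  obtain B where B: "B \<ge> 1" "\<And>i x. i \<in> I \<Longrightarrow> x \<in> space M \<Longrightarrow> \<bar>h i x\<bar> \<le> B"
    using uniform_bound[of h] h by blast
  let ?m = "\<lambda>i. \<integral>x. h i x \<partial>\<mu> i"
  let ?A = "\<lambda>i K x. cesaro (\<lambda>n. h i ((T i ^^ n) x)) K"
  have mB: "\<bar>?m i\<bar> \<le> B" if "i \<in> I" for i
    using that h B(2) by (intro abs_integral_\<mu>_le)
  have Ab: "bounded_meas M (\<lambda>x. ?A i K x - ?m i)" if "i \<in> I" for i K
    by (intro bounded_meas_diff bounded_meas_cesaro bounded_meas_Ti[OF h[OF that]] bounded_meas_const)
  have AB: "\<bar>?A i K x\<bar> \<le> B" if "i \<in> I" "x \<in> space M" for i K x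
    using that B(2) Ti_space by (intro abs_cesaro_le_bound) auto
  \<comment> \<open>The mean ergodic theorem gives this over \<open>\<mu> i\<close>; absolute
    continuity, uniform on bounded functions, carries it to \<open>M\<close>.\<close>
  have A_lim: "(\<lambda>K. \<integral>x. \<bar>?A i K x - ?m i\<bar> \<partial>M) \<longlonglongrightarrow> 0" if i: "i \<in> I" for i
  proof -
    interpret S: measure_preserving "\<mu> i" "T i" by (rule measure_preserving)
    have hi: "bounded_meas (\<mu> i) (h i)" using h[OF i] by (simp add: bounded_meas_\<mu>)
    have "(\<lambda>K. \<integral>x. (?A i K x - ?m i)\<^sup>2 \<partial>\<mu> i) \<longlonglongrightarrow> 0"
      using S.mean_ergodic_const[OF erg[OF i] hi] by (simp add: S.avg_def)
    then have lim: "(\<lambda>K. \<integral>x. \<bar>?A i K x - ?m i\<bar> \<partial>\<mu> i) \<longlonglongrightarrow> 0"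
      using Ab[OF i] by (intro S.tendsto_L1_of_L2) (simp add: bounded_meas_\<mu>)
    show ?thesis
    proof (rule LIMSEQ_I)
      fix e :: real assume "e > 0"
      then have "\<exists>d>0. \<forall>u. bounded_meas M u \<longrightarrow> (\<forall>x\<in>space M. \<bar>u x\<bar> \<le> 2 * B) \<longrightarrow>
          (\<integral>x. \<bar>u x\<bar> \<partial>\<mu> i) < d \<longrightarrow> (\<integral>x. \<bar>u x\<bar> \<partial>M) < e"
        by (intro L1_small_of_absolutely_continuous prob_space_\<mu> sets_\<mu>) (simp_all add: null_sets_\<mu>)
      then obtain d where d: "d > 0" "\<And>u. bounded_meas M u \<Longrightarrow> (\<forall>x\<in>space M. \<bar>u x\<bar> \<le> 2 * B) \<Longrightarrow>
          (\<integral>x. \<bar>u x\<bar> \<partial>\<mu> i) < d \<Longrightarrow> (\<integral>x. \<bar>u x\<bar> \<partial>M) < e" by blast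
      obtain K0 where K0: "\<And>K. K \<ge> K0 \<Longrightarrow> (\<integral>x. \<bar>?A i K x - ?m i\<bar> \<partial>\<mu> i) < d"
        using LIMSEQ_D[OF lim d(1)] by auto
      have "(\<integral>x. \<bar>?A i K x - ?m i\<bar> \<partial>M) < e" if "K \<ge> K0" for K
      proof (rule d(2)[OF Ab[OF i] _ K0[OF that]])
        show "\<forall>x\<in>space M. \<bar>?A i K x - ?m i\<bar> \<le> 2 * B"
        proof
          fix x assume "x \<in> space M"
          then show "\<bar>?A i K x - ?m i\<bar> \<le> 2 * B" using AB[OF i, of x K] mB[OF i] by linarith
        qed
      qed
      then show "\<exists>K0. \<forall>K\<ge>K0. norm ((\<integral>x. \<bar>?A i K x - ?m i\<bar> \<partial>M) - 0) < e"
        by (intro exI[of _ K0]) simp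
    qed
  qed
  \<comment> \<open>Multiplying out the product of averages gives one term for each multitime in the
    box.\<close>
  have eq: "(1 / real K) ^ card I * (\<Sum>v\<in>I \<rightarrow>\<^sub>E {..<K}. \<integral>x. diag h v x \<partial>M) = (\<integral>x. (\<Prod>i\<in>I. ?A i K x) \<partial>M)" for K
  proof -
    have "(\<Prod>i\<in>I. ?A i K x) = (1 / real K) ^ card I * (\<Sum>v\<in>I \<rightarrow>\<^sub>E {..<K}. diag h v x)" for x
      unfolding cesaro_def prod.distrib diag_def
      by (subst prod_sum_PiE) (auto simp: finite_I)
    then show ?thesis
      by (simp add: Bochner_Integration.integral_sum integrable_bounded_meas bounded_meas_diag h)
  qed
  have bd: "\<bar>(\<integral>x. (\<Prod>i\<in>I. ?A i K x) \<partial>M) - (\<Prod>i\<in>I. ?m i)\<bar>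
      \<le> B ^ card I * (\<Sum>i\<in>I. \<integral>x. \<bar>?A i K x - ?m i\<bar> \<partial>M)" for K
  proof -
    have Pb: "bounded_meas M (\<lambda>x. \<Prod>i\<in>I. ?A i K x)"
      by (intro bounded_meas_prod bounded_meas_cesaro bounded_meas_Ti h)
    have "(\<integral>x. (\<Prod>i\<in>I. ?A i K x) \<partial>M) - (\<Prod>i\<in>I. ?m i) = (\<integral>x. (\<Prod>i\<in>I. ?A i K x) - (\<Prod>i\<in>I. ?m i) \<partial>M)"
      using integrable_bounded_meas[OF Pb] by (simp add: prob_space)
    also have "\<bar>\<dots>\<bar> \<le> (\<integral>x. \<bar>(\<Prod>i\<in>I. ?A i K x) - (\<Prod>i\<in>I. ?m i)\<bar> \<partial>M)" by (rule integral_abs_bound)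
    also have "\<dots> \<le> (\<integral>x. B ^ card I * (\<Sum>i\<in>I. \<bar>?A i K x - ?m i\<bar>) \<partial>M)"
    proof (rule integral_mono)
      show "integrable M (\<lambda>x. \<bar>(\<Prod>i\<in>I. ?A i K x) - (\<Prod>i\<in>I. ?m i)\<bar>)"
        by (intro integrable_bounded_meas bounded_meas_abs bounded_meas_diff Pb bounded_meas_const)
      show "integrable M (\<lambda>x. B ^ card I * (\<Sum>i\<in>I. \<bar>?A i K x - ?m i\<bar>))"
        by (intro integrable_bounded_meas bounded_meas_mult bounded_meas_const bounded_meas_sum bounded_meas_abs Ab)
      fix x assume "x \<in> space M"
      then show "\<bar>(\<Prod>i\<in>I. ?A i K x) - (\<Prod>i\<in>I. ?m i)\<bar> \<le> B ^ card I * (\<Sum>i\<in>I. \<bar>?A i K x - ?m i\<bar>)"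
        using AB mB B(1) by (intro abs_prod_diff_le finite_I)
    qed
    also have "\<dots> = B ^ card I * (\<Sum>i\<in>I. \<integral>x. \<bar>?A i K x - ?m i\<bar> \<partial>M)"
      unfolding integral_mult_right_zero
      using integrable_bounded_meas[OF bounded_meas_abs[OF Ab]]
      by (subst Bochner_Integration.integral_sum) auto
    finally show ?thesis .
  qed
  have "(\<lambda>K. B ^ card I * (\<Sum>i\<in>I. \<integral>x. \<bar>?A i K x - ?m i\<bar> \<partial>M)) \<longlonglongrightarrow> B ^ card I * (\<Sum>i\<in>I. 0)"
    using A_lim by (intro tendsto_mult_left tendsto_sum)
  then have "(\<lambda>K. (\<integral>x. (\<Prod>i\<in>I. ?A i K x) \<partial>M) - (\<Prod>i\<in>I. ?m i)) \<longlonglongrightarrow> 0"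
    unfolding sum.neutral_const mult_zero_right
    by (rule Lim_null_comparison[rotated]) (simp only: real_norm_def bd always_eventually simp_thms)
  then show ?thesis unfolding eq by (rule LIM_zero_cancel)
qed

section \<open>Ergodic averages of tensor products\<close>

abbreviation tensor_avg :: "('i \<Rightarrow> 'a \<Rightarrow> real) \<Rightarrow> nat \<Rightarrow> ('i \<Rightarrow> 'a) \<Rightarrow> real" where
  "tensor_avg f N \<omega> \<equiv> cesaro (\<lambda>n. tensor f ((prod_map ^^ n) \<omega>)) N"

lemma bounded_meas_tensor_n:
  assumes "\<And>i. i \<in> I \<Longrightarrow> bounded_meas M (f i)"
  shows "bounded_meas \<nu> (\<lambda>\<omega>. tensor f ((prod_map ^^ n) \<omega>))"
  by (rule measure_preserving.bounded_meas_Tn[OF measure_preserving_\<nu> bounded_meas_tensor[OF assms]])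

text \<open>For fixed \<open>N\<close> the squared errors over \<nu> and along a multitime
  \<open>v\<close> expand into the same expression in correlations. Averaging over \<open>v\<close>
  in growing boxes turns each diagonal integral into the product of integrals over the
  \<open>\<mu> i\<close>, and the bound survives because it is uniform in \<open>v\<close>.\<close>

lemma almost_periodic_tensor_avg:
  assumes W: weakly_jointly_ergodic and erg: "\<And>i. i \<in> I \<Longrightarrow> ergodic (\<mu> i) (T i)"
    and f: "\<And>i. i \<in> I \<Longrightarrow> measure_preserving.almost_periodic (\<mu> i) (T i) (f i)"
  shows "(\<lambda>N. \<integral>\<omega>. (tensor_avg f N \<omega> - (\<Prod>i\<in>I. \<integral>y. f i y \<partial>\<mu> i))\<^sup>2 \<partial>\<nu>) \<longlonglongrightarrow> 0"
proof (rule LIMSEQ_I)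
  interpret \<nu>: prob_space \<nu> by (rule prob_space_\<nu>)
  have fb: "bounded_meas M (f i)" if "i \<in> I" for i
    using measure_preserving.almost_periodic_bounded[OF measure_preserving f[OF that]] by (simp add: bounded_meas_\<mu>)
  define p where "p = (\<Prod>i\<in>I. \<integral>y. f i y \<partial>\<mu> i)"
  fix e :: real assume e: "e > 0"
  obtain N0 where N0: "\<And>N v. N \<ge> N0 \<Longrightarrow> (\<integral>x. (cesaro (\<lambda>n. diag f (\<lambda>i. n + v i) x) N - p)\<^sup>2 \<partial>M) \<le> e / 2"
    using almost_periodic_uniform_convergence[OF W f, of "e/2"] e unfolding p_def by auto
  have "(\<integral>\<omega>. (tensor_avg f N \<omega> - p)\<^sup>2 \<partial>\<nu>) \<le> e / 2" if N: "N \<ge> Suc N0" for N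
  proof -
    define A where "A h K = (1 / real K) ^ card I * (\<Sum>v\<in>I \<rightarrow>\<^sub>E {..<K}. \<integral>x. diag h v x \<partial>M)" for h K
    let ?h = "\<lambda>n i x. f i ((T i ^^ n) x)"
    let ?hh = "\<lambda>n n' i x. f i ((T i ^^ n) x) * f i ((T i ^^ n') x)"
    have A_lim: "A h \<longlonglongrightarrow> (\<Prod>i\<in>I. \<integral>x. h i x \<partial>\<mu> i)" if "\<And>i. i \<in> I \<Longrightarrow> bounded_meas M (h i)" for h
      unfolding A_def[abs_def] by (rule multitime_average[OF erg that])
    have rhs: "(\<integral>\<omega>. (tensor_avg f N \<omega> - p)\<^sup>2 \<partial>\<nu>)
      = cesaro (\<lambda>n. cesaro (\<lambda>n'. \<Prod>i\<in>I. \<integral>x. ?hh n n' i x \<partial>\<mu> i) N) N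
        - 2 * p * cesaro (\<lambda>n. \<Prod>i\<in>I. \<integral>x. ?h n i x \<partial>\<mu> i) N + p\<^sup>2"
    proof (subst \<nu>.integral_square_cesaro_diff[OF bounded_meas_tensor_n[OF fb]])
      have "(\<integral>\<omega>. tensor f ((prod_map ^^ n) \<omega>) \<partial>\<nu>) = (\<Prod>i\<in>I. \<integral>x. ?h n i x \<partial>\<mu> i)" for n
        unfolding tensor_prod_map by (intro integral_tensor bounded_meas_Ti fb)
      then show "cesaro (\<lambda>n. cesaro (\<lambda>n'. \<integral>\<omega>. tensor f ((prod_map ^^ n) \<omega>) * tensor f ((prod_map ^^ n') \<omega>) \<partial>\<nu>) N) N
          - 2 * p * cesaro (\<lambda>n. \<integral>\<omega>. tensor f ((prod_map ^^ n) \<omega>) \<partial>\<nu>) N + p\<^sup>2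
        = cesaro (\<lambda>n. cesaro (\<lambda>n'. \<Prod>i\<in>I. \<integral>x. ?hh n n' i x \<partial>\<mu> i) N) N
          - 2 * p * cesaro (\<lambda>n. \<Prod>i\<in>I. \<integral>x. ?h n i x \<partial>\<mu> i) N + p\<^sup>2"
        using integral_tensor_mult[OF fb] by simp
    qed (use N in auto)
    have lhs: "(1 / real K) ^ card I * (\<Sum>v\<in>I \<rightarrow>\<^sub>E {..<K}. \<integral>x. (cesaro (\<lambda>n. diag f (\<lambda>i. n + v i) x) N - p)\<^sup>2 \<partial>M)
      = cesaro (\<lambda>n. cesaro (\<lambda>n'. A (?hh n n') K) N) N - 2 * p * cesaro (\<lambda>n. A (?h n) K) N
        + p\<^sup>2" if K: "K > 0" for K
    proof -
      have "(\<integral>x. (cesaro (\<lambda>n. diag f (\<lambda>i. n + v i) x) N - p)\<^sup>2 \<partial>M)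
        = cesaro (\<lambda>n. cesaro (\<lambda>n'. \<integral>x. diag (?hh n n') v x \<partial>M) N) N
          - 2 * p * cesaro (\<lambda>n. \<integral>x. diag (?h n) v x \<partial>M) N + p\<^sup>2" for v
      proof -
        have "diag (?h n) v = diag f (\<lambda>i. n + v i)" for n
          by (rule ext) (rule diag_shift)
        moreover have "diag (?hh n n') v = (\<lambda>x. diag f (\<lambda>i. n + v i) x * diag f (\<lambda>i. n' + v i) x)" for n n'
          by (rule ext) (simp flip: diag_mult diag_shift)
        ultimately show ?thesis
          using N fb by (simp add: integral_square_cesaro_diff bounded_meas_diag)
      qed
      moreover have "(1 / real K) ^ card I * (\<Sum>v\<in>I \<rightarrow>\<^sub>E {..<K}. p\<^sup>2) = p\<^sup>2"
        using K by (simp add: card_PiE finite_I power_one_over)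
      ultimately show ?thesis
        unfolding A_def
        by (simp add: sum.distrib sum_subtractf distrib_left right_diff_distrib cesaro_sum cesaro_cmult
            sum_distrib_left[symmetric] mult.left_commute)
    qed
    \<comment> \<open>\<open>N\<close> stays fixed while \<open>K\<close> grows, so only finitely
      many correlations have to converge.\<close>
    have lim: "(\<lambda>K. cesaro (\<lambda>n. cesaro (\<lambda>n'. A (?hh n n') K) N) N - 2 * p * cesaro (\<lambda>n. A (?h n) K) N + p\<^sup>2)
      \<longlonglongrightarrow> (\<integral>\<omega>. (tensor_avg f N \<omega> - p)\<^sup>2 \<partial>\<nu>)"
      unfolding rhs
      by (intro tendsto_add tendsto_diff tendsto_mult_left tendsto_const tendsto_cesaro A_lim bounded_meas_mult bounded_meas_Ti fb)
    have le: "cesaro (\<lambda>n. cesaro (\<lambda>n'. A (?hh n n') K) N) N - 2 * p * cesaro (\<lambda>n. A (?h n) K) N + p\<^sup>2 \<le> e / 2"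
      if K: "K \<ge> 1" for K
    proof -
      have "(1 / real K) ^ card I * (\<Sum>v\<in>I \<rightarrow>\<^sub>E {..<K}. \<integral>x. (cesaro (\<lambda>n. diag f (\<lambda>i. n + v i) x) N - p)\<^sup>2 \<partial>M)
        \<le> (1 / real K) ^ card I * (\<Sum>v\<in>I \<rightarrow>\<^sub>E {..<K}. e / 2)"
        using N by (intro mult_left_mono sum_mono N0) auto
      also have "\<dots> = e / 2" using K by (simp add: card_PiE finite_I power_one_over)
      finally show ?thesis using lhs[of K] K by simp
    qed
    show ?thesis by (rule LIMSEQ_le_const2[OF lim]) (use le in blast)
  qed
  then have "\<bar>\<integral>\<omega>. (tensor_avg f N \<omega> - p)\<^sup>2 \<partial>\<nu>\<bar> < e" if "N \<ge> Suc N0" for N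
    using that e by fastforce
  then show "\<exists>N0. \<forall>N\<ge>N0. norm ((\<integral>\<omega>. (tensor_avg f N \<omega> - (\<Prod>i\<in>I. \<integral>y. f i y \<partial>\<mu> i))\<^sup>2 \<partial>\<nu>) - 0) < e"
    unfolding p_def by auto
qed

text \<open>Correlations over \<nu> factor, and the absolute value at coordinate \<open>j\<close>
  depends on the time difference only. The other factors are bounded, so the squared norm is at most
  a constant times the mean of the absolute autocorrelations of \<open>f j\<close>, which tends to 0
  by weak mixing tested against \<open>f j\<close> itself.\<close>

lemma orthogonal_tensor_avg:
  assumes f: "\<And>i. i \<in> I \<Longrightarrow> bounded_meas M (f i)"
    and j: "j \<in> I" "measure_preserving.orthogonal_to_almost_periodic (\<mu> j) (T j) (f j)"
  shows "(\<lambda>N. \<integral>\<omega>. (tensor_avg f N \<omega>)\<^sup>2 \<partial>\<nu>) \<longlonglongrightarrow> 0"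
proof -
  interpret \<nu>: prob_space \<nu> by (rule prob_space_\<nu>)
  interpret S: measure_preserving "\<mu> j" "T j" by (rule measure_preserving)
  obtain B where B: "B \<ge> 1" "\<And>i x. i \<in> I \<Longrightarrow> x \<in> space M \<Longrightarrow> \<bar>f i x\<bar> \<le> B"
    using uniform_bound[of f] f by blast
  define C where "C = (B\<^sup>2) ^ card (I - {j})"
  have C: "C \<ge> 0" unfolding C_def by simp
  define a where "a h = \<bar>\<integral>x. f j x * f j ((T j ^^ h) x) \<partial>\<mu> j\<bar>" for h
  have a_lim: "cesaro a \<longlonglongrightarrow> 0"
    unfolding a_def using S.orthogonal_to_almost_periodic_weakly_mixing[OF j(2)] f[OF j(1)]
    by (intro cesaro_abs_tendsto_0) (simp add: bounded_meas_\<mu>)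
  have corr_j: "\<bar>\<integral>x. f j ((T j ^^ n) x) * f j ((T j ^^ n') x) \<partial>\<mu> j\<bar> = a (nat \<bar>int n - int n'\<bar>)" for n n'
  proof -
    have *: "(\<integral>x. f j ((T j ^^ n) x) * f j ((T j ^^ (m + n)) x) \<partial>\<mu> j) = (\<integral>x. f j x * f j ((T j ^^ m) x) \<partial>\<mu> j)" for n m
      using integral_Ti[of "\<lambda>x. f j x * f j ((T j ^^ m) x)" j n] f[OF j(1)]
      by (simp add: Ti_Ti bounded_meas_mult bounded_meas_Ti)
    show ?thesis
    proof (cases "n \<le> n'")
      case True
      then show ?thesis using *[of n "n' - n"] by (simp add: a_def nat_diff_distrib)
    next
      case False
      then show ?thesis using *[of n' "n - n'"] by (simp add: a_def nat_diff_distrib mult.commute)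
    qed
  qed
  have corr: "\<bar>\<integral>\<omega>. tensor f ((prod_map ^^ n) \<omega>) * tensor f ((prod_map ^^ n') \<omega>) \<partial>\<nu>\<bar>
      \<le> C * a (nat \<bar>int n - int n'\<bar>)" for n n'
  proof -
    have "\<bar>\<integral>x. f i ((T i ^^ n) x) * f i ((T i ^^ n') x) \<partial>\<mu> i\<bar> \<le> B\<^sup>2" if i: "i \<in> I" for i
    proof (rule prob_space.abs_integral_le_bound[OF prob_space_\<mu>])
      show "bounded_meas (\<mu> i) (\<lambda>x. f i ((T i ^^ n) x) * f i ((T i ^^ n') x))"
        unfolding bounded_meas_\<mu> by (intro bounded_meas_mult bounded_meas_Ti f i)
      fix x assume "x \<in> space (\<mu> i)"
      then show "\<bar>f i ((T i ^^ n) x) * f i ((T i ^^ n') x)\<bar> \<le> B\<^sup>2"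
        unfolding abs_mult power2_eq_square using B(2)[OF i Ti_space] B(1)
        by (intro mult_mono) (auto simp: space_\<mu>)
    qed
    then have "\<bar>\<Prod>i\<in>I - {j}. \<integral>x. f i ((T i ^^ n) x) * f i ((T i ^^ n') x) \<partial>\<mu> i\<bar> \<le> C"
      unfolding C_def by (intro abs_prod_le) auto
    then have "\<bar>\<integral>x. f j ((T j ^^ n) x) * f j ((T j ^^ n') x) \<partial>\<mu> j\<bar> *
        \<bar>\<Prod>i\<in>I - {j}. \<integral>x. f i ((T i ^^ n) x) * f i ((T i ^^ n') x) \<partial>\<mu> i\<bar> \<le> a (nat \<bar>int n - int n'\<bar>) * C"
      unfolding corr_j by (intro mult_left_mono) (simp_all add: a_def)
    moreover have "(\<integral>\<omega>. tensor f ((prod_map ^^ n) \<omega>) * tensor f ((prod_map ^^ n') \<omega>) \<partial>\<nu>)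
      = (\<integral>x. f j ((T j ^^ n) x) * f j ((T j ^^ n') x) \<partial>\<mu> j) *
        (\<Prod>i\<in>I - {j}. \<integral>x. f i ((T i ^^ n) x) * f i ((T i ^^ n') x) \<partial>\<mu> i)"
      using integral_tensor_mult[of f n n'] f prod.remove[OF finite_I j(1)] by simp
    ultimately show ?thesis by (simp add: abs_mult mult.commute)
  qed
  have bd: "(\<integral>\<omega>. (tensor_avg f N \<omega>)\<^sup>2 \<partial>\<nu>) \<le> C * (2 * cesaro a N)" if N: "N > 0" for N
  proof -
    have "(\<integral>\<omega>. (tensor_avg f N \<omega>)\<^sup>2 \<partial>\<nu>)
      = cesaro (\<lambda>n. cesaro (\<lambda>n'. \<integral>\<omega>. tensor f ((prod_map ^^ n) \<omega>) * tensor f ((prod_map ^^ n') \<omega>) \<partial>\<nu>) N) N"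
      using \<nu>.integral_square_cesaro_diff[OF bounded_meas_tensor_n[OF f] N, where p=0] by simp
    also have "\<dots> \<le> cesaro (\<lambda>n. cesaro (\<lambda>n'. C * a (nat \<bar>int n - int n'\<bar>)) N) N"
      by (intro cesaro_mono order_trans[OF abs_ge_self corr])
    also have "\<dots> = (1 / real N) * (\<Sum>n<N. (1 / real N) * (\<Sum>n'<N. C * a (nat \<bar>int n - int n'\<bar>)))"
      by (simp add: cesaro_def)
    also have "\<dots> \<le> (1 / real N) * (\<Sum>n<N. (1 / real N) * (C * (2 * (\<Sum>h<N. a h))))"
    proof (intro mult_left_mono sum_mono)
      fix n assume "n \<in> {..<N}"
      then have "(\<Sum>n'<N. a (nat \<bar>int n - int n'\<bar>)) \<le> 2 * (\<Sum>h<N. a h)"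
        by (intro sum_dist_le) (auto simp: a_def)
      then show "(\<Sum>n'<N. C * a (nat \<bar>int n - int n'\<bar>)) \<le> C * (2 * (\<Sum>h<N. a h))"
        unfolding sum_distrib_left[symmetric] using C by (rule mult_left_mono)
    qed auto
    also have "\<dots> = C * (2 * cesaro a N)" using N by (simp add: cesaro_def)
    finally show ?thesis .
  qed
  have lim: "(\<lambda>N. C * (2 * cesaro a N)) \<longlonglongrightarrow> 0"
    using tendsto_mult_left[OF tendsto_mult_left[OF a_lim, of 2], of C] by simp
  show ?thesis
  proof (rule tendsto_sandwich[OF _ _ tendsto_const lim])
    show "\<forall>\<^sub>F N in sequentially. (\<integral>\<omega>. (tensor_avg f N \<omega>)\<^sup>2 \<partial>\<nu>) \<le> C * (2 * cesaro a N)"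
      unfolding eventually_sequentially by (rule exI[of _ 1]) (intro allI impI bd, linarith)
  qed simp
qed

text \<open>Expand the product of the sums \<open>c i + w i\<close> over the set \<open>X\<close> of
  indices that contribute \<open>c i\<close>. A term with \<open>X \<noteq> I\<close> has a factor
  orthogonal to the almost periodic functions and tends to 0; the term \<open>X = I\<close> is the
  almost periodic case.\<close>

lemma weakly_jointly_ergodic_tensor_avg:
  assumes W: weakly_jointly_ergodic and erg: "\<And>i. i \<in> I \<Longrightarrow> ergodic (\<mu> i) (T i)"
    and f: "\<And>i. i \<in> I \<Longrightarrow> bounded_meas M (f i)"
  shows "(\<lambda>N. \<integral>\<omega>. (tensor_avg f N \<omega> - (\<Prod>i\<in>I. \<integral>y. f i y \<partial>\<mu> i))\<^sup>2 \<partial>\<nu>) \<longlonglongrightarrow> 0"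
proof -
  interpret \<nu>: prob_space \<nu> by (rule prob_space_\<nu>)
  have "\<forall>i\<in>I. \<exists>h. measure_preserving.almost_periodic (\<mu> i) (T i) h \<and>
      measure_preserving.orthogonal_to_almost_periodic (\<mu> i) (T i) (\<lambda>x. f i x - h x)"
  proof
    fix i assume i: "i \<in> I"
    interpret S: measure_preserving "\<mu> i" "T i" by (rule measure_preserving)
    have "bounded_meas (\<mu> i) (f i)" using f[OF i] by (simp add: bounded_meas_\<mu>)
    then show "\<exists>h. S.almost_periodic h \<and> S.orthogonal_to_almost_periodic (\<lambda>x. f i x - h x)"
      by (rule S.almost_periodic_decomposition) blast
  qed
  then obtain c where c: "\<And>i. i \<in> I \<Longrightarrow> measure_preserving.almost_periodic (\<mu> i) (T i) (c i)"
    "\<And>i. i \<in> I \<Longrightarrow> measure_preserving.orthogonal_to_almost_periodic (\<mu> i) (T i) (\<lambda>x. f i x - c i x)"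
    by metis
  define w where "w i x = f i x - c i x" for i x
  have cb: "bounded_meas M (c i)" if "i \<in> I" for i
    using measure_preserving.almost_periodic_bounded[OF measure_preserving c(1)[OF that]] by (simp add: bounded_meas_\<mu>)
  have wb: "bounded_meas M (w i)" if "i \<in> I" for i
    unfolding w_def[abs_def] using that by (intro bounded_meas_diff f cb)
  \<comment> \<open>Constants are almost periodic, so the orthogonal part has mean zero and the
    limit value is that of the family \<open>c\<close>.\<close>
  have int_eq: "(\<integral>y. f i y \<partial>\<mu> i) = (\<integral>y. c i y \<partial>\<mu> i)" if i: "i \<in> I" for i
  proof -
    interpret S: measure_preserving "\<mu> i" "T i" by (rule measure_preserving)
    have "(\<integral>y. 1 * (f i y - c i y) \<partial>\<mu> i) = 0"
      using c(2)[OF i] S.almost_periodic_const[of 1] unfolding S.orthogonal_to_almost_periodic_def by blast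
    moreover have "integrable (\<mu> i) (f i)" "integrable (\<mu> i) (c i)"
      using f[OF i] cb[OF i] by (auto intro!: S.integrable_bounded_meas simp: bounded_meas_\<mu>)
    ultimately show ?thesis by simp
  qed
  define F where "F X i = (if i \<in> X then c i else w i)" for X i
  have Fb: "bounded_meas M (F X i)" if "i \<in> I" for X i
    unfolding F_def using that cb wb by simp
  have expand: "tensor f \<omega> = (\<Sum>X\<in>Pow I. tensor (F X) \<omega>)" for \<omega>
  proof -
    have "tensor f \<omega> = (\<Prod>i\<in>I. c i (\<omega> i) + w i (\<omega> i))" by (simp add: tensor_def w_def)
    also have "\<dots> = (\<Sum>X\<in>Pow I. (\<Prod>i\<in>X. c i (\<omega> i)) * (\<Prod>i\<in>I - X. w i (\<omega> i)))"
      by (rule prod_add[OF finite_I])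
    also have "\<dots> = (\<Sum>X\<in>Pow I. tensor (F X) \<omega>)"
    proof (rule sum.cong[OF refl])
      fix X assume X: "X \<in> Pow I"
      have "tensor (F X) \<omega> = (\<Prod>i\<in>X. F X i (\<omega> i)) * (\<Prod>i\<in>I - X. F X i (\<omega> i))"
        unfolding tensor_def using X finite_I by (simp add: prod.subset_diff mult.commute)
      then show "(\<Prod>i\<in>X. c i (\<omega> i)) * (\<Prod>i\<in>I - X. w i (\<omega> i)) = tensor (F X) \<omega>"
        by (simp add: F_def)
    qed
    finally show ?thesis .
  qed
  define p where "p = (\<Prod>i\<in>I. \<integral>y. f i y \<partial>\<mu> i)"
  define u where "u X N \<omega> = tensor_avg (F X) N \<omega> - (if X = I then p else 0)" for X N \<omega>
  have ub: "bounded_meas \<nu> (u X N)" for X N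
    unfolding u_def[abs_def] by (intro bounded_meas_diff bounded_meas_cesaro bounded_meas_tensor_n Fb bounded_meas_const)
  have "(\<lambda>N. \<integral>\<omega>. (u X N \<omega>)\<^sup>2 \<partial>\<nu>) \<longlonglongrightarrow> 0" if X: "X \<in> Pow I" for X
  proof (cases "X = I")
    case True
    have "tensor (F I) \<omega> = tensor c \<omega>" for \<omega> unfolding tensor_def F_def by simp
    moreover have "p = (\<Prod>i\<in>I. \<integral>y. c i y \<partial>\<mu> i)" unfolding p_def by (intro prod.cong refl int_eq)
    ultimately show ?thesis
      using almost_periodic_tensor_avg[OF W erg c(1)] True by (simp add: u_def)
  next
    case False
    then obtain j where j: "j \<in> I" "j \<notin> X" using X by auto
    have "measure_preserving.orthogonal_to_almost_periodic (\<mu> j) (T j) (F X j)"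
      using c(2)[OF j(1)] j(2) by (simp add: F_def w_def[abs_def])
    from orthogonal_tensor_avg[of "F X", OF Fb j(1) this] show ?thesis using False by (simp add: u_def)
  qed
  then have "(\<lambda>N. \<integral>\<omega>. (\<Sum>X\<in>Pow I. u X N \<omega>)\<^sup>2 \<partial>\<nu>) \<longlonglongrightarrow> 0"
    using finite_I by (intro \<nu>.tendsto_L2_sum ub) auto
  moreover have "(\<Sum>X\<in>Pow I. u X N \<omega>) = tensor_avg f N \<omega> - p" for N \<omega>
    unfolding u_def expand cesaro_sum sum_subtractf using finite_I by (simp add: sum.delta)
  ultimately show ?thesis unfolding p_def by simp
qed

text \<open>Take the indicator of an invariant set \<open>A\<close> for \<open>f0\<close> and for
  \<open>f j\<close>, and 1 elsewhere: the averages are constant and the limit reads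
  \<open>measure M A = measure M A * measure (\<mu> j) A\<close>. If \<open>A\<close> is null for
  \<open>M\<close>, it is null for \<open>\<mu> j\<close> by equivalence.\<close>

lemma weakly_jointly_ergodic_imp_ergodic_factor:
  assumes W: weakly_jointly_ergodic and j: "j \<in> I"
  shows "ergodic (\<mu> j) (T j)"
  unfolding ergodic_def
proof (intro conjI ballI impI measure_preserving.invariant[OF measure_preserving])
  interpret S: measure_preserving "\<mu> j" "T j" by (rule measure_preserving)
  fix A assume A: "A \<in> sets (\<mu> j)" "T j -` A \<inter> space (\<mu> j) = A"
  have AM: "A \<in> sets M" using A(1) sets_\<mu> by blast
  define f :: "'i \<Rightarrow> 'a \<Rightarrow> real" where "f i = (if i = j then indicator A else (\<lambda>x. 1))" for i
  have fb: "bounded_meas M (f i)" for i unfolding f_def using AM by (auto intro: bounded_meas_indicator bounded_meas_const)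
  have A_iff: "(T j ^^ n) x \<in> A \<longleftrightarrow> x \<in> A" if "x \<in> space M" for n x
  proof (induction n)
    case (Suc n)
    have "(T j ^^ n) x \<in> space (\<mu> j)" using Ti_space[OF that] by (simp add: space_\<mu>)
    then have "T j ((T j ^^ n) x) \<in> A \<longleftrightarrow> (T j ^^ n) x \<in> A" using A(2) by blast
    then show ?case using Suc by simp
  qed simp
  have d: "diag f (\<lambda>i. n) x = indicator A x" if "x \<in> space M" for n x
    unfolding diag_def using A_iff[OF that] j finite_I
    by (subst prod.remove[OF finite_I j]) (auto simp: f_def indicator_def)
  have p: "(\<Prod>i\<in>I. \<integral>y. f i y \<partial>\<mu> i) = measure (\<mu> j) A"
  proof -
    have "(\<integral>y. f i y \<partial>\<mu> i) = 1" if "i \<noteq> j" for i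
      using that prob_space.prob_space[OF prob_space_\<mu>[of i]] by (simp add: f_def)
    moreover have "(\<integral>y. f j y \<partial>\<mu> j) = measure (\<mu> j) A"
      using A(1) by (simp add: f_def)
    ultimately show ?thesis by (subst prod.remove[OF finite_I j]) auto
  qed
  have "cesaro (\<lambda>n. \<integral>x. indicator A x * diag f (\<lambda>i. n) x \<partial>M) \<longlonglongrightarrow> (\<integral>x. indicator A x \<partial>M) * measure (\<mu> j) A"
    using W fb bounded_meas_indicator[OF AM] unfolding weakly_jointly_ergodic_def p[symmetric] by blast
  moreover have "(\<integral>x. indicator A x * diag f (\<lambda>i. n) x \<partial>M) = measure M A" for n
  proof -
    have "(\<integral>x. indicator A x * diag f (\<lambda>i. n) x \<partial>M) = (\<integral>x. indicator A x \<partial>M)"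
      by (intro Bochner_Integration.integral_cong refl) (auto simp: d indicator_def)
    then show ?thesis using AM by simp
  qed
  ultimately have "(\<lambda>N. cesaro (\<lambda>n. measure M A) N) \<longlonglongrightarrow> measure M A * measure (\<mu> j) A"
    using AM by simp
  then have "measure M A = measure M A * measure (\<mu> j) A"
    using cesaro_to_const LIMSEQ_unique by blast
  then consider "measure M A = 0" | "measure (\<mu> j) A = 1" by auto
  then show "emeasure (\<mu> j) A = 0 \<or> emeasure (\<mu> j) A = 1"
  proof cases
    case 1
    then have "A \<in> null_sets (\<mu> j)" using AM null_sets_\<mu> by (simp add: null_sets_def emeasure_eq_measure)
    then show ?thesis by auto
  next
    case 2
    then show ?thesis by (simp add: S.emeasure_eq_measure)
  qed
qed

text \<open>An invariant set \<open>A\<close> is independent of every rectangle, so \<open>\<nu>\<close> conditioned on \<open>A\<close> is again \<open>\<nu>\<close>.\<close>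

lemma weakly_jointly_ergodic_imp_ergodic_prod:
  assumes W: weakly_jointly_ergodic
  shows "ergodic \<nu> prod_map"
  unfolding ergodic_def
proof (intro conjI ballI impI invariant_prod)
  interpret P: product_sigma_finite \<mu> by (rule product_sigma_finite_\<mu>)
  interpret D: measure_preserving \<nu> prod_map by (rule measure_preserving_\<nu>)
  fix A assume A: "A \<in> sets \<nu>" "prod_map -` A \<inter> space \<nu> = A"
  have A_iff: "(prod_map ^^ n) \<omega> \<in> A \<longleftrightarrow> \<omega> \<in> A" if "\<omega> \<in> space \<nu>" for n \<omega>
  proof (induction n)
    case (Suc n)
    have "prod_map ((prod_map ^^ n) \<omega>) \<in> A \<longleftrightarrow> (prod_map ^^ n) \<omega> \<in> A" using A(2) D.Tn_space[OF that] by blast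
    then show ?case using Suc by simp
  qed simp
  have Ab: "bounded_meas \<nu> (indicator A)" using A(1) by (rule bounded_meas_indicator)
  have rect: "measure \<nu> (A \<inter> Pi\<^sub>E I E) = measure \<nu> A * measure \<nu> (Pi\<^sub>E I E)" if E: "\<And>i. i \<in> I \<Longrightarrow> E i \<in> sets (\<mu> i)" for E
  proof -
    define f :: "'i \<Rightarrow> 'a \<Rightarrow> real" where "f i = indicator (E i)" for i
    have fb: "bounded_meas M (f i)" if "i \<in> I" for i
      unfolding f_def using E[OF that] sets_\<mu> by (intro bounded_meas_indicator) blast
    let ?R = "Pi\<^sub>E I E"
    have R: "?R \<in> sets \<nu>" using E by (intro sets_PiM_I_finite finite_I)
    have tensor: "tensor f \<omega> = indicator ?R \<omega>" if \<omega>: "\<omega> \<in> space \<nu>" for \<omega>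
    proof (cases "\<omega> \<in> ?R")
      case True
      then show ?thesis by (simp add: tensor_def f_def PiE_iff)
    next
      case False
      then obtain i where "i \<in> I" "\<omega> i \<notin> E i" using \<omega> by (auto simp: space_PiM PiE_iff)
      then show ?thesis using False finite_I unfolding tensor_def f_def
        by (auto simp: indicator_def intro!: prod_zero)
    qed
    have pR: "(\<Prod>i\<in>I. \<integral>y. f i y \<partial>\<mu> i) = measure \<nu> ?R"
      using integral_tensor[of f] fb R tensor
      by (simp cong: Bochner_Integration.integral_cong)
    have lim: "(\<lambda>N. \<integral>\<omega>. (tensor_avg f N \<omega> - measure \<nu> ?R)\<^sup>2 \<partial>\<nu>) \<longlonglongrightarrow> 0"
      using weakly_jointly_ergodic_tensor_avg[of f, OF W weakly_jointly_ergodic_imp_ergodic_factor[OF W] fb] unfolding pR by blast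
    have db: "bounded_meas \<nu> (\<lambda>\<omega>. tensor_avg f N \<omega> - measure \<nu> ?R)" for N
      by (intro bounded_meas_diff bounded_meas_cesaro bounded_meas_tensor_n fb bounded_meas_const)
    \<comment> \<open>As \<open>A\<close> is invariant, all terms of the average have the same
      integral over \<open>A\<close>; convergence to the constant then determines the measure of
      \<open>A \<inter> ?R\<close>.\<close>
    have eq: "(\<integral>\<omega>. indicator A \<omega> * (tensor_avg f N \<omega> - measure \<nu> ?R) \<partial>\<nu>)
        = measure \<nu> (A \<inter> ?R) - measure \<nu> A * measure \<nu> ?R" if N: "N > 0" for N
    proof -
      have "(\<integral>\<omega>. indicator A \<omega> * tensor f ((prod_map ^^ n) \<omega>) \<partial>\<nu>) = measure \<nu> (A \<inter> ?R)" for n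
      proof -
        have "(\<integral>\<omega>. indicator A \<omega> * tensor f ((prod_map ^^ n) \<omega>) \<partial>\<nu>)
            = (\<integral>\<omega>. indicator A ((prod_map ^^ n) \<omega>) * tensor f ((prod_map ^^ n) \<omega>) \<partial>\<nu>)"
          using A_iff by (intro Bochner_Integration.integral_cong refl) (auto simp: indicator_def)
        also have "\<dots> = (\<integral>\<omega>. indicator A \<omega> * tensor f \<omega> \<partial>\<nu>)"
          by (rule D.integral_Tn) (intro bounded_meas_measurable bounded_meas_mult Ab bounded_meas_tensor fb)
        also have "\<dots> = (\<integral>\<omega>. indicator (A \<inter> ?R) \<omega> \<partial>\<nu>)"
          by (intro Bochner_Integration.integral_cong refl) (auto simp: tensor indicator_def)
        finally show ?thesis using A(1) R by simp
      qed
      then have "(\<integral>\<omega>. cesaro (\<lambda>n. indicator A \<omega> * tensor f ((prod_map ^^ n) \<omega>)) N \<partial>\<nu>) = measure \<nu> (A \<inter> ?R)"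
        using N by (subst D.integral_cesaro) (auto simp: cesaro_const intro!: bounded_meas_mult Ab bounded_meas_tensor_n fb)
      moreover have "integrable \<nu> (\<lambda>\<omega>. cesaro (\<lambda>n. indicator A \<omega> * tensor f ((prod_map ^^ n) \<omega>)) N)"
        by (intro D.integrable_bounded_meas bounded_meas_cesaro bounded_meas_mult Ab bounded_meas_tensor_n fb)
      moreover have "integrable \<nu> (\<lambda>\<omega>. indicator A \<omega> * measure \<nu> ?R)"
        by (intro D.integrable_bounded_meas bounded_meas_mult Ab bounded_meas_const)
      ultimately show ?thesis using A(1) by (simp add: right_diff_distrib cesaro_cmult)
    qed
    have "\<bar>measure \<nu> (A \<inter> ?R) - measure \<nu> A * measure \<nu> ?R\<bar> \<le> 1 * (\<integral>\<omega>. \<bar>tensor_avg f N \<omega> - measure \<nu> ?R\<bar> \<partial>\<nu>)"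
      if N: "N > 0" for N
      unfolding eq[OF N, symmetric] by (intro D.abs_integral_mult_le db Ab) (auto simp: indicator_def)
    moreover have "(\<lambda>N. 1 * (\<integral>\<omega>. \<bar>tensor_avg f N \<omega> - measure \<nu> ?R\<bar> \<partial>\<nu>)) \<longlonglongrightarrow> 0"
      using D.tendsto_L1_of_L2[OF db lim] by simp
    ultimately have "\<bar>measure \<nu> (A \<inter> ?R) - measure \<nu> A * measure \<nu> ?R\<bar> \<le> 0"
      by (intro LIMSEQ_le_const) (auto intro!: exI[of _ 1])
    then show ?thesis by simp
  qed
  show "emeasure \<nu> A = 0 \<or> emeasure \<nu> A = 1"
  proof (cases "measure \<nu> A = 0")
    case False
    have "uniform_measure \<nu> A = \<nu>"
    proof (rule P.PiM_eqI[OF finite_I])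
      fix E assume E: "\<And>i. i \<in> I \<Longrightarrow> E i \<in> sets (\<mu> i)"
      have R: "Pi\<^sub>E I E \<in> sets \<nu>" using E by (intro sets_PiM_I_finite finite_I)
      have "emeasure (uniform_measure \<nu> A) (Pi\<^sub>E I E) = emeasure \<nu> (A \<inter> Pi\<^sub>E I E) / emeasure \<nu> A"
        using A(1) R by (rule emeasure_uniform_measure)
      also have "\<dots> = ennreal (measure \<nu> (Pi\<^sub>E I E))"
        using False rect[OF E] by (simp add: D.emeasure_eq_measure divide_ennreal zero_less_measure_iff)
      also have "\<dots> = (\<Prod>i\<in>I. emeasure (\<mu> i) (E i))"
        using P.emeasure_PiM[OF finite_I E] by (simp add: D.emeasure_eq_measure)
      finally show "emeasure (uniform_measure \<nu> A) (Pi\<^sub>E I E) = (\<Prod>i\<in>I. emeasure (\<mu> i) (E i))" .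
    qed simp
    \<comment> \<open>Both measures are evaluated at \<open>A\<close>, where the conditioned one is
      1.\<close>
    then have "emeasure \<nu> A = emeasure \<nu> (A \<inter> A) / emeasure \<nu> A"
      using emeasure_uniform_measure[OF A(1) A(1)] by simp
    also have "\<dots> = 1" using False by (simp add: D.emeasure_eq_measure divide_ennreal zero_less_measure_iff)
    finally show ?thesis by simp
  qed (simp add: D.emeasure_eq_measure)
qed

end

section \<open>Domination implies joint ergodicity\<close>

context joint_systems
begin

abbreviation diag_avg :: "('i \<Rightarrow> 'a \<Rightarrow> real) \<Rightarrow> nat \<Rightarrow> 'a \<Rightarrow> real" where
  "diag_avg f N x \<equiv> cesaro (\<lambda>n. diag f (\<lambda>i. n) x) N"

abbreviation limit_value :: "('i \<Rightarrow> 'a \<Rightarrow> real) \<Rightarrow> real" where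
  "limit_value f \<equiv> \<Prod>i\<in>I. \<integral>y. f i y \<partial>\<mu> i"

definition jointly_ergodic :: bool where
  "jointly_ergodic \<longleftrightarrow> (\<forall>f. (\<forall>i\<in>I. bounded_meas M (f i)) \<longrightarrow>
    (\<lambda>N. \<integral>x. (diag_avg f N x - limit_value f)\<^sup>2 \<partial>M) \<longlonglongrightarrow> 0)"

lemma bounded_meas_diag_avg:
  "(\<And>i. i \<in> I \<Longrightarrow> bounded_meas M (f i)) \<Longrightarrow> bounded_meas M (diag_avg f N)"
  by (intro bounded_meas_cesaro bounded_meas_diag)

lemma jointly_ergodic_imp_weakly:
  assumes J: jointly_ergodic shows weakly_jointly_ergodic
  unfolding weakly_jointly_ergodic_def
proof (intro allI impI)
  fix f0 and f :: "'i \<Rightarrow> 'a \<Rightarrow> real"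
  assume f0: "bounded_meas M f0" and f: "\<forall>i\<in>I. bounded_meas M (f i)"
  let ?p = "limit_value f"
  obtain B where B: "\<And>x. x \<in> space M \<Longrightarrow> \<bar>f0 x\<bar> \<le> B" using f0 by (metis bounded_measE)
  have fb: "bounded_meas M (f i)" if "i \<in> I" for i using f that by blast
  have db: "bounded_meas M (\<lambda>x. diag_avg f N x - ?p)" for N
    by (intro bounded_meas_diff bounded_meas_diag_avg fb bounded_meas_const)
  have "(\<lambda>N. \<integral>x. (diag_avg f N x - ?p)\<^sup>2 \<partial>M) \<longlonglongrightarrow> 0" using J f unfolding jointly_ergodic_def by blast
  from tendsto_L1_of_L2[OF db this]
  have lim: "(\<lambda>N. B * (\<integral>x. \<bar>diag_avg f N x - ?p\<bar> \<partial>M)) \<longlonglongrightarrow> 0"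
    using tendsto_mult_left[of _ 0 _ B] by fastforce
  have "\<bar>cesaro (\<lambda>n. \<integral>x. f0 x * diag f (\<lambda>i. n) x \<partial>M) N - (\<integral>x. f0 x \<partial>M) * ?p\<bar>
      \<le> B * (\<integral>x. \<bar>diag_avg f N x - ?p\<bar> \<partial>M)" for N
  proof -
    have "cesaro (\<lambda>n. \<integral>x. f0 x * diag f (\<lambda>i. n) x \<partial>M) N = (\<integral>x. f0 x * diag_avg f N x \<partial>M)"
      unfolding cesaro_cmult[symmetric]
      by (rule integral_cesaro[symmetric]) (intro bounded_meas_mult f0 bounded_meas_diag fb)
    moreover have "(\<integral>x. f0 x \<partial>M) * ?p = (\<integral>x. f0 x * ?p \<partial>M)" by simp
    moreover have "(\<integral>x. f0 x * diag_avg f N x \<partial>M) - (\<integral>x. f0 x * ?p \<partial>M) = (\<integral>x. f0 x * (diag_avg f N x - ?p) \<partial>M)"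
      unfolding right_diff_distrib
      by (rule Bochner_Integration.integral_diff[symmetric];
        rule integrable_bounded_meas[OF bounded_meas_mult[OF f0]])
        (rule bounded_meas_diag_avg[OF fb], assumption, rule bounded_meas_const)
    ultimately show ?thesis using abs_integral_mult_le[OF db f0 B] by simp
  qed
  then have "(\<lambda>N. cesaro (\<lambda>n. \<integral>x. f0 x * diag f (\<lambda>i. n) x \<partial>M) N - (\<integral>x. f0 x \<partial>M) * ?p) \<longlonglongrightarrow> 0"
    by (intro Lim_null_comparison[OF _ lim] always_eventually allI) (simp only: real_norm_def)
  then show "cesaro (\<lambda>n. \<integral>x. f0 x * diag f (\<lambda>i. n) x \<partial>M) \<longlonglongrightarrow> (\<integral>x. f0 x \<partial>M) * ?p"
    by (rule LIM_zero_cancel)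
qed

text \<open>The limsup bound of (iv) with explicit slack \<open>e\<close>, for averages over
  \<open>n < N\<close>. The measure of the intersection is written as an integral of a product of
  indicators, the form in which linear combinations can be taken.\<close>

definition dominated_by :: "real \<Rightarrow> bool" where
  "dominated_by C \<longleftrightarrow> (\<forall>A. (\<forall>i\<in>I. A i \<in> sets M) \<longrightarrow> (\<forall>e>0. \<forall>\<^sub>F N in sequentially.
    cesaro (\<lambda>n. \<integral>x. diag (\<lambda>i. indicator (A i)) (\<lambda>i. n) x \<partial>M) N \<le> C * (\<Prod>i\<in>I. measure (\<mu> i) (A i)) + e))"

text \<open>For functions with finitely many values, \<open>(tensor_avg f H - p)\<^sup>2\<close> is a linear combination of
  indicators of rectangles with nonnegative coefficients, indexed by the possible values of
  \<open>f\<^sub>i(T\<^sub>i\<^sup>h y)\<close>, \<open>h < H\<close>, so that the domination hypothesis applies termwise.\<close>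

lemma dominated_tensor_avg:
  assumes dom: "dominated_by C"
    and f: "\<And>i. i \<in> I \<Longrightarrow> bounded_meas M (f i)" "\<And>i. i \<in> I \<Longrightarrow> finite (f i ` space M)"
    and e: "e > 0"
  shows "\<forall>\<^sub>F N in sequentially. cesaro (\<lambda>n. \<integral>x. (cesaro (\<lambda>h. diag f (\<lambda>i. n + h) x) H - p)\<^sup>2 \<partial>M) N
    \<le> C * (\<integral>\<omega>. (tensor_avg f H \<omega> - p)\<^sup>2 \<partial>\<nu>) + e"
proof -
  interpret \<nu>: prob_space \<nu> by (rule prob_space_\<nu>)
  \<comment> \<open>An element of \<open>G\<close> is a table of values of each \<open>f i\<close>
    along \<open>H\<close> steps of an orbit of \<open>T i\<close>. For each \<open>i\<close>, the
    cells \<open>E i (w i)\<close> with \<open>w i\<close> in \<open>W i\<close> partition the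
    space.\<close>
  define W where "W i = {..<H} \<rightarrow>\<^sub>E (f i ` space M)" for i
  define G where "G = Pi\<^sub>E I W"
  have fin: "finite G" unfolding G_def W_def by (intro finite_PiE finite_I f(2)) auto
  define E where "E i w = {y \<in> space M. \<forall>h\<in>{..<H}. f i ((T i ^^ h) y) = w h}" for i and w :: "nat \<Rightarrow> real"
  have E: "E i w \<in> sets M" if "i \<in> I" for i w
  proof -
    have [measurable]: "(\<lambda>y. f i ((T i ^^ h) y)) \<in> borel_measurable M" for h
      by (intro bounded_meas_measurable bounded_meas_Ti f that)
    show ?thesis unfolding E_def by measurable
  qed
  define \<gamma> where "\<gamma> w = (cesaro (\<lambda>h. \<Prod>i\<in>I. w i h) H - p)\<^sup>2" for w :: "'i \<Rightarrow> nat \<Rightarrow> real"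
  have expand: "(cesaro (\<lambda>h. \<Prod>i\<in>I. f i ((T i ^^ h) (x i))) H - p)\<^sup>2
      = (\<Sum>w\<in>G. \<gamma> w * (\<Prod>i\<in>I. indicator (E i (w i)) (x i)))"
    if x: "\<And>i. i \<in> I \<Longrightarrow> x i \<in> space M" for x
  proof -
    \<comment> \<open>The table realised by \<open>x\<close>, the only one whose product of
      indicators does not vanish at \<open>x\<close>.\<close>
    define w0 where "w0 = (\<lambda>i\<in>I. \<lambda>h\<in>{..<H}. f i ((T i ^^ h) (x i)))"
    have w0: "w0 \<in> G" unfolding w0_def G_def W_def using x Ti_space by auto
    have "(\<Prod>i\<in>I. indicator (E i (w i)) (x i) :: real) = (if w = w0 then 1 else 0)" if w: "w \<in> G" for w
    proof (cases "\<forall>i\<in>I. x i \<in> E i (w i)")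
      case True
      have "w i = w0 i" if i: "i \<in> I" for i
      proof -
        have "w i \<in> W i" "w0 i \<in> W i" using w w0 i unfolding G_def by auto
        moreover have "w i h = w0 i h" if "h \<in> {..<H}" for h
          using True i that unfolding E_def w0_def by auto
        ultimately show ?thesis unfolding W_def by (rule PiE_ext)
      qed
      then have "w = w0" using w w0 PiE_ext[of w I W w0] unfolding G_def by blast
      then show ?thesis using True by simp
    next
      case False
      then obtain i where i: "i \<in> I" "x i \<notin> E i (w i)" by blast
      then have "w \<noteq> w0" using x unfolding E_def w0_def by auto
      moreover have "(\<Prod>i\<in>I. indicator (E i (w i)) (x i) :: real) = 0"
        using i by (intro prod_zero finite_I bexI[of _ i]) auto
      ultimately show ?thesis by simp
    qed
    then have "(\<Sum>w\<in>G. \<gamma> w * (\<Prod>i\<in>I. indicator (E i (w i)) (x i))) = (\<Sum>w\<in>G. if w = w0 then \<gamma> w else 0)"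
      by (intro sum.cong refl) simp
    also have "\<dots> = \<gamma> w0" using fin w0 by simp
    also have "\<dots> = (cesaro (\<lambda>h. \<Prod>i\<in>I. f i ((T i ^^ h) (x i))) H - p)\<^sup>2"
      unfolding \<gamma>_def w0_def cesaro_def by simp
    finally show ?thesis by simp
  qed
  have Ib: "bounded_meas M (indicator (E i (w i)) :: 'a \<Rightarrow> real)" if "i \<in> I" for i and w :: "'i \<Rightarrow> nat \<Rightarrow> real"
    by (intro bounded_meas_indicator E that)
  have lhs: "(\<integral>x. (cesaro (\<lambda>h. diag f (\<lambda>i. n + h) x) H - p)\<^sup>2 \<partial>M)
      = (\<Sum>w\<in>G. \<gamma> w * (\<integral>x. diag (\<lambda>i. indicator (E i (w i))) (\<lambda>i. n) x \<partial>M))" for n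
  proof -
    have "(\<integral>x. (cesaro (\<lambda>h. diag f (\<lambda>i. n + h) x) H - p)\<^sup>2 \<partial>M)
      = (\<integral>x. (\<Sum>w\<in>G. \<gamma> w * diag (\<lambda>i. indicator (E i (w i))) (\<lambda>i. n) x) \<partial>M)"
    proof (rule Bochner_Integration.integral_cong[OF refl])
      fix x assume "x \<in> space M"
      then show "(cesaro (\<lambda>h. diag f (\<lambda>i. n + h) x) H - p)\<^sup>2
          = (\<Sum>w\<in>G. \<gamma> w * diag (\<lambda>i. indicator (E i (w i))) (\<lambda>i. n) x)"
        using expand[of "\<lambda>i. (T i ^^ n) x"] Ti_space by (simp add: diag_def Ti_Ti add.commute[of n])
    qed
    also have "\<dots> = (\<Sum>w\<in>G. \<integral>x. \<gamma> w * diag (\<lambda>i. indicator (E i (w i))) (\<lambda>i. n) x \<partial>M)"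
      by (intro Bochner_Integration.integral_sum integrable_bounded_meas bounded_meas_mult bounded_meas_const bounded_meas_diag Ib)
    finally show ?thesis by simp
  qed
  have rhs: "(\<integral>\<omega>. (tensor_avg f H \<omega> - p)\<^sup>2 \<partial>\<nu>) = (\<Sum>w\<in>G. \<gamma> w * (\<Prod>i\<in>I. measure (\<mu> i) (E i (w i))))"
  proof -
    have "(\<integral>\<omega>. (tensor_avg f H \<omega> - p)\<^sup>2 \<partial>\<nu>)
      = (\<integral>\<omega>. (\<Sum>w\<in>G. \<gamma> w * tensor (\<lambda>i. indicator (E i (w i))) \<omega>) \<partial>\<nu>)"
    proof (rule Bochner_Integration.integral_cong[OF refl])
      fix \<omega> assume "\<omega> \<in> space \<nu>"
      then have "\<omega> i \<in> space M" if "i \<in> I" for i using that space_\<nu> by auto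
      then show "(tensor_avg f H \<omega> - p)\<^sup>2 = (\<Sum>w\<in>G. \<gamma> w * tensor (\<lambda>i. indicator (E i (w i))) \<omega>)"
        using expand[of \<omega>] unfolding tensor_prod_map unfolding tensor_def by simp
    qed
    also have "\<dots> = (\<Sum>w\<in>G. \<integral>\<omega>. \<gamma> w * tensor (\<lambda>i. indicator (E i (w i))) \<omega> \<partial>\<nu>)"
      by (intro Bochner_Integration.integral_sum \<nu>.integrable_bounded_meas bounded_meas_mult bounded_meas_const bounded_meas_tensor Ib)
    also have "\<dots> = (\<Sum>w\<in>G. \<gamma> w * (\<Prod>i\<in>I. measure (\<mu> i) (E i (w i))))"
    proof (intro sum.cong refl)
      fix w
      have "(\<integral>\<omega>. tensor (\<lambda>i. indicator (E i (w i))) \<omega> \<partial>\<nu>) = (\<Prod>i\<in>I. \<integral>y. indicator (E i (w i)) y \<partial>\<mu> i)"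
        by (intro integral_tensor Ib)
      also have "\<dots> = (\<Prod>i\<in>I. measure (\<mu> i) (E i (w i)))"
        using E sets_\<mu> by (intro prod.cong refl) simp
      finally show "(\<integral>\<omega>. \<gamma> w * tensor (\<lambda>i. indicator (E i (w i))) \<omega> \<partial>\<nu>) = \<gamma> w * (\<Prod>i\<in>I. measure (\<mu> i) (E i (w i)))"
        by simp
    qed
    finally show ?thesis .
  qed
  have \<gamma>0: "\<gamma> w \<ge> 0" for w unfolding \<gamma>_def by simp
  \<comment> \<open>The slack of all rectangles, weighted by \<open>\<gamma>\<close>, then sums to
    at most \<open>e\<close>; the 1 covers the case that all weights vanish.\<close>
  define \<delta> where "\<delta> = e / ((\<Sum>w\<in>G. \<gamma> w) + 1)"
  have S0: "(\<Sum>w\<in>G. \<gamma> w) \<ge> 0" using \<gamma>0 by (intro sum_nonneg)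
  then have \<delta>: "\<delta> > 0" unfolding \<delta>_def using e by (intro divide_pos_pos) auto
  have "\<forall>\<^sub>F N in sequentially. \<forall>w\<in>G. cesaro (\<lambda>n. \<integral>x. diag (\<lambda>i. indicator (E i (w i))) (\<lambda>i. n) x \<partial>M) N
      \<le> C * (\<Prod>i\<in>I. measure (\<mu> i) (E i (w i))) + \<delta>"
  proof (intro eventually_ball_finite fin ballI)
    fix w
    show "\<forall>\<^sub>F N in sequentially. cesaro (\<lambda>n. \<integral>x. diag (\<lambda>i. indicator (E i (w i))) (\<lambda>i. n) x \<partial>M) N
      \<le> C * (\<Prod>i\<in>I. measure (\<mu> i) (E i (w i))) + \<delta>"
      using dom[unfolded dominated_by_def, rule_format, of "\<lambda>i. E i (w i)" \<delta>] E \<delta> by simp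
  qed
  then show ?thesis
  proof eventually_elim
    case (elim N)
    have "cesaro (\<lambda>n. \<integral>x. (cesaro (\<lambda>h. diag f (\<lambda>i. n + h) x) H - p)\<^sup>2 \<partial>M) N
      = (\<Sum>w\<in>G. \<gamma> w * cesaro (\<lambda>n. \<integral>x. diag (\<lambda>i. indicator (E i (w i))) (\<lambda>i. n) x \<partial>M) N)"
      unfolding lhs by (simp add: cesaro_sum cesaro_cmult)
    also have "\<dots> \<le> (\<Sum>w\<in>G. \<gamma> w * (C * (\<Prod>i\<in>I. measure (\<mu> i) (E i (w i))) + \<delta>))"
      using elim \<gamma>0 by (intro sum_mono mult_left_mono) auto
    also have "\<dots> = C * (\<Sum>w\<in>G. \<gamma> w * (\<Prod>i\<in>I. measure (\<mu> i) (E i (w i)))) + (\<Sum>w\<in>G. \<gamma> w) * \<delta>"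
      by (simp add: distrib_left sum.distrib sum_distrib_left sum_distrib_right mult.left_commute)
    also have "(\<Sum>w\<in>G. \<gamma> w) * \<delta> \<le> e"
    proof -
      have "(\<Sum>w\<in>G. \<gamma> w) * \<delta> \<le> ((\<Sum>w\<in>G. \<gamma> w) + 1) * \<delta>" using \<delta> by (intro mult_right_mono) auto
      also have "\<dots> = e" unfolding \<delta>_def using S0 by simp
      finally show ?thesis .
    qed
    finally show ?case unfolding rhs by simp
  qed
qed

text \<open>Domination speaks of sets, hence the restriction to finitely many values.
  \<open>b n\<close> is the tensor average of length \<open>H\<close> at the diagonal point moved by
  time \<open>n\<close>; exchanging the two averages shows that the mean of the \<open>b n\<close>
  differs from \<open>diag_avg f N\<close> by O(H/N).\<close>

lemma dominated_imp_jointly_ergodic_simple: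
  assumes dom: "dominated_by C" "C > 0" and erg: "ergodic \<nu> prod_map"
    and f: "\<And>i. i \<in> I \<Longrightarrow> bounded_meas M (f i)" "\<And>i. i \<in> I \<Longrightarrow> finite (f i ` space M)"
  shows "(\<lambda>N. \<integral>x. (diag_avg f N x - limit_value f)\<^sup>2 \<partial>M) \<longlonglongrightarrow> 0"
proof (rule LIMSEQ_I)
  let ?p = "limit_value f"
  fix e :: real assume e: "e > 0"
  obtain B where B: "B \<ge> 1" "\<And>i x. i \<in> I \<Longrightarrow> x \<in> space M \<Longrightarrow> \<bar>f i x\<bar> \<le> B"
    using uniform_bound[of f] f by blast
  define Q where "Q = B ^ card I"
  have Q: "Q \<ge> 1" unfolding Q_def using B(1) by simp
  have dQ: "\<bar>diag f v x\<bar> \<le> Q" if "x \<in> space M" for v x unfolding Q_def using B(2) that by (rule abs_diag_le)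
  have pQ: "\<bar>?p\<bar> \<le> Q" unfolding Q_def using f(1) B(2) by (intro abs_prod_le abs_integral_\<mu>_le)
  interpret D: measure_preserving \<nu> prod_map by (rule measure_preserving_\<nu>)
  have "(\<lambda>H. \<integral>\<omega>. (tensor_avg f H \<omega> - ?p)\<^sup>2 \<partial>\<nu>) \<longlonglongrightarrow> 0"
    using D.mean_ergodic_const[OF erg bounded_meas_tensor[of f, OF f(1)]]
    unfolding D.avg_def using integral_tensor[of f] f(1) by simp
  \<comment> \<open>Domination multiplies this error by \<open>C\<close>, leaving
    \<open>e / 4\<close>. The slack and the shift error contribute at most \<open>e / 4\<close>
    each, so the total stays below \<open>e\<close>.\<close>
  then have "\<forall>\<^sub>F H in sequentially. (\<integral>\<omega>. (tensor_avg f H \<omega> - ?p)\<^sup>2 \<partial>\<nu>) < e / (4 * C)"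
    using dom(2) e by (intro order_tendstoD(2)) auto
  then have "\<forall>\<^sub>F H in sequentially. (\<integral>\<omega>. (tensor_avg f H \<omega> - ?p)\<^sup>2 \<partial>\<nu>) < e / (4 * C) \<and> H > 0"
    by (intro eventually_conj eventually_gt_at_top)
  then obtain H where H: "(\<integral>\<omega>. (tensor_avg f H \<omega> - ?p)\<^sup>2 \<partial>\<nu>) < e / (4 * C)" "H > 0"
    by (metis (mono_tags, lifting) eventually_happens' sequentially_bot)
  define b where "b n x = cesaro (\<lambda>h. diag f (\<lambda>i. n + h) x) H" for n x
  have bb: "bounded_meas M (b n)" for n
    unfolding b_def[abs_def] by (intro bounded_meas_cesaro bounded_meas_diag f)
  have bQ: "\<bar>b n x\<bar> \<le> Q" if "x \<in> space M" for n x unfolding b_def by (intro abs_cesaro_le_bound dQ that)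
  have shift: "\<bar>diag_avg f N x - cesaro (\<lambda>n. b n x) N\<bar> \<le> 2 * real H * Q / real N" if x: "x \<in> space M" for N x
  proof -
    have "cesaro (\<lambda>n. b n x) N = cesaro (\<lambda>h. cesaro (\<lambda>n. diag f (\<lambda>i. n + h) x) N) H"
      unfolding b_def by (rule cesaro_swap)
    then have "cesaro (\<lambda>n. b n x) N - diag_avg f N x
        = cesaro (\<lambda>h. cesaro (\<lambda>n. diag f (\<lambda>i. n + h) x) N - diag_avg f N x) H"
      using H(2) by (simp add: cesaro_diff cesaro_const)
    also have "\<bar>\<dots>\<bar> \<le> 2 * real H * Q / real N"
    proof (rule abs_cesaro_le_bound_lt)
      fix h assume "h < H"
      have "\<bar>cesaro (\<lambda>n. diag f (\<lambda>i. n + h) x) N - diag_avg f N x\<bar> \<le> 2 * real h * Q / real N"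
        using abs_cesaro_shift_le[of "\<lambda>n. diag f (\<lambda>i. n) x" Q h N] dQ[OF x] by simp
      also have "\<dots> \<le> 2 * real H * Q / real N"
        using \<open>h < H\<close> Q by (intro divide_right_mono mult_right_mono) auto
      finally show "\<bar>cesaro (\<lambda>n. diag f (\<lambda>i. n + h) x) N - diag_avg f N x\<bar> \<le> 2 * real H * Q / real N" .
    qed (use Q in auto)
    finally show ?thesis by (simp add: abs_minus_commute)
  qed
  have Ab: "bounded_meas M (diag_avg f N)" for N by (intro bounded_meas_diag_avg f)
  have le: "(\<integral>x. (diag_avg f N x - ?p)\<^sup>2 \<partial>M)
      \<le> cesaro (\<lambda>n. \<integral>x. (b n x - ?p)\<^sup>2 \<partial>M) N + 4 * Q * (2 * real H * Q) / real N" if N: "N > 0" for N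
  proof -
    \<comment> \<open>\<open>4 * Q\<close> bounds the sum of the two deviations from
      \<open>?p\<close>, and the remaining factor bounds their difference.\<close>
    let ?r = "4 * Q * (2 * real H * Q) / real N"
    have cb: "bounded_meas M (\<lambda>x. cesaro (\<lambda>n. (b n x - ?p)\<^sup>2) N)"
      by (intro bounded_meas_cesaro bounded_meas_power bounded_meas_diff bb bounded_meas_const)
    have "(\<integral>x. (diag_avg f N x - ?p)\<^sup>2 \<partial>M) \<le> (\<integral>x. cesaro (\<lambda>n. (b n x - ?p)\<^sup>2) N + ?r \<partial>M)"
    proof (rule integral_mono)
      show "integrable M (\<lambda>x. (diag_avg f N x - ?p)\<^sup>2)"
        by (intro integrable_bounded_meas bounded_meas_power bounded_meas_diff Ab bounded_meas_const)
      show "integrable M (\<lambda>x. cesaro (\<lambda>n. (b n x - ?p)\<^sup>2) N + ?r)"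
        by (intro integrable_bounded_meas bounded_meas_add cb bounded_meas_const)
      fix x assume x: "x \<in> space M"
      let ?a = "diag_avg f N x - ?p" and ?c = "cesaro (\<lambda>n. b n x) N - ?p"
      have "?a\<^sup>2 - ?c\<^sup>2 = (?a + ?c) * (diag_avg f N x - cesaro (\<lambda>n. b n x) N)"
        by (simp add: power2_eq_square algebra_simps)
      also have "\<dots> \<le> \<bar>?a + ?c\<bar> * \<bar>diag_avg f N x - cesaro (\<lambda>n. b n x) N\<bar>"
        unfolding abs_mult[symmetric] by (rule abs_ge_self)
      also have "\<dots> \<le> (4 * Q) * (2 * real H * Q / real N)"
      proof (rule mult_mono)
        have "\<bar>diag_avg f N x\<bar> \<le> Q" "\<bar>cesaro (\<lambda>n. b n x) N\<bar> \<le> Q"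
          by (intro abs_cesaro_le_bound dQ bQ x)+
        then show "\<bar>?a + ?c\<bar> \<le> 4 * Q" using pQ by linarith
      qed (use shift[OF x] Q in auto)
      also have "\<dots> = ?r" by simp
      also have "?c = cesaro (\<lambda>n. b n x - ?p) N" using N by (simp add: cesaro_diff cesaro_const)
      finally show "?a\<^sup>2 \<le> cesaro (\<lambda>n. (b n x - ?p)\<^sup>2) N + ?r"
        using cesaro_square_le[of "\<lambda>n. b n x - ?p" N] by linarith
    qed
    also have "\<dots> = (\<integral>x. cesaro (\<lambda>n. (b n x - ?p)\<^sup>2) N \<partial>M) + ?r"
      using integrable_bounded_meas[OF cb] by (simp add: prob_space)
    also have "(\<integral>x. cesaro (\<lambda>n. (b n x - ?p)\<^sup>2) N \<partial>M) = cesaro (\<lambda>n. \<integral>x. (b n x - ?p)\<^sup>2 \<partial>M) N"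
      by (intro integral_cesaro bounded_meas_power bounded_meas_diff bb bounded_meas_const)
    finally show ?thesis .
  qed
  have "\<forall>\<^sub>F N in sequentially. cesaro (\<lambda>n. \<integral>x. (b n x - ?p)\<^sup>2 \<partial>M) N
      \<le> C * (\<integral>\<omega>. (tensor_avg f H \<omega> - ?p)\<^sup>2 \<partial>\<nu>) + e / 4"
    unfolding b_def using e by (intro dominated_tensor_avg dom f) auto
  moreover have "\<forall>\<^sub>F N in sequentially. 4 * Q * (2 * real H * Q) / real N < e / 4"
    using e by (intro order_tendstoD(2)[OF tendsto_const_over_nat]) auto
  moreover have "\<forall>\<^sub>F N in sequentially. N > (0::nat)" by (rule eventually_gt_at_top)
  ultimately have "\<forall>\<^sub>F N in sequentially. (\<integral>x. (diag_avg f N x - ?p)\<^sup>2 \<partial>M) < e"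
  proof eventually_elim
    case (elim N)
    have "C * (\<integral>\<omega>. (tensor_avg f H \<omega> - ?p)\<^sup>2 \<partial>\<nu>) \<le> C * (e / (4 * C))"
      using H(1) dom(2) by (intro mult_left_mono) auto
    also have "\<dots> = e / 4" using dom(2) by simp
    finally show ?case using le[OF elim(3)] elim(1,2) e by linarith
  qed
  then show "\<exists>N0. \<forall>N\<ge>N0. norm ((\<integral>x. (diag_avg f N x - ?p)\<^sup>2 \<partial>M) - 0) < e"
    unfolding eventually_sequentially by simp
qed

text \<open>Rounding values down to multiples of \<open>1 / m\<close> gives uniformly close
  functions with finitely many values. Averages and limit values move by at most a small
  \<open>\<kappa>\<close>, uniformly in \<open>N\<close>.\<close>

lemma dominated_imp_jointly_ergodic:
  assumes dom: "dominated_by C" "C > 0" and erg: "ergodic \<nu> prod_map"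
  shows jointly_ergodic
  unfolding jointly_ergodic_def
proof (intro allI impI)
  fix f :: "'i \<Rightarrow> 'a \<Rightarrow> real" assume "\<forall>i\<in>I. bounded_meas M (f i)"
  then have f: "bounded_meas M (f i)" if "i \<in> I" for i using that by blast
  let ?p = "limit_value f"
  obtain B0 where B0: "B0 \<ge> 1" "\<And>i x. i \<in> I \<Longrightarrow> x \<in> space M \<Longrightarrow> \<bar>f i x\<bar> \<le> B0"
    using uniform_bound[of f] f by blast
  \<comment> \<open>The extra 1 leaves room for the rounding, so one bound serves both
    families.\<close>
  define B where "B = B0 + 1"
  have B: "B \<ge> 1" "\<And>i x. i \<in> I \<Longrightarrow> x \<in> space M \<Longrightarrow> \<bar>f i x\<bar> \<le> B"
    unfolding B_def using B0 by force+
  define Q where "Q = B ^ card I"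
  have Q: "Q \<ge> 1" unfolding Q_def using B(1) by simp
  have db: "bounded_meas M (\<lambda>x. diag_avg f N x - ?p)" for N
    by (intro bounded_meas_diff bounded_meas_diag_avg f bounded_meas_const)
  have L1: "(\<lambda>N. \<integral>x. \<bar>diag_avg f N x - ?p\<bar> \<partial>M) \<longlonglongrightarrow> 0"
  proof (rule LIMSEQ_I)
    fix e :: real assume e: "e > 0"
    \<comment> \<open>Large enough to make the total rounding error \<open>\<kappa>\<close> at most
      \<open>e / 4\<close>.\<close>
    obtain m :: nat where m: "real m > 4 * Q * (real (card I) + 1) / e" using reals_Archimedean2 by blast
    have m0: "real m > 0" using m Q e by (smt (verit) divide_nonneg_pos mult_nonneg_nonneg of_nat_0_le_iff)
    define q where "q i x = real_of_int \<lfloor>f i x * real m\<rfloor> / real m" for i x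
    have qf: "\<bar>f i x - q i x\<bar> \<le> 1 / real m" for i x
    proof -
      have "\<bar>f i x * real m - real_of_int \<lfloor>f i x * real m\<rfloor>\<bar> \<le> 1" by linarith
      then have "\<bar>f i x * real m - real_of_int \<lfloor>f i x * real m\<rfloor>\<bar> / real m \<le> 1 / real m"
        using m0 by (intro divide_right_mono) auto
      moreover have "f i x - q i x = (f i x * real m - real_of_int \<lfloor>f i x * real m\<rfloor>) / real m"
        unfolding q_def using m0 by (simp add: diff_divide_distrib)
      ultimately show ?thesis by simp
    qed
    have qB: "\<bar>q i x\<bar> \<le> B" if "i \<in> I" "x \<in> space M" for i x
    proof -
      have "1 / real m \<le> 1" using m0 by simp
      then show ?thesis using qf[of i x] B0(2)[OF that] unfolding B_def by linarith
    qed
    have qb: "bounded_meas M (q i)" if i: "i \<in> I" for i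
    proof (rule bounded_measI[OF _ qB[OF i]])
      have [measurable]: "f i \<in> borel_measurable M" by (intro bounded_meas_measurable f i)
      show "q i \<in> borel_measurable M" unfolding q_def[abs_def] by measurable
    qed
    have qfin: "finite (q i ` space M)" if i: "i \<in> I" for i
    proof (rule finite_subset)
      show "q i ` space M \<subseteq> (\<lambda>z. real_of_int z / real m) ` {\<lfloor>- B * real m\<rfloor>..\<lfloor>B * real m\<rfloor>}"
      proof (rule image_subsetI)
        fix x assume "x \<in> space M"
        then have "\<bar>f i x\<bar> \<le> B" by (rule B(2)[OF i])
        then have "- B * real m \<le> f i x * real m" "f i x * real m \<le> B * real m"
          by (intro mult_right_mono; linarith)+
        then have "\<lfloor>f i x * real m\<rfloor> \<in> {\<lfloor>- B * real m\<rfloor>..\<lfloor>B * real m\<rfloor>}"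
          unfolding atLeastAtMost_iff by (intro conjI floor_mono)
        then show "q i x \<in> (\<lambda>z. real_of_int z / real m) ` {\<lfloor>- B * real m\<rfloor>..\<lfloor>B * real m\<rfloor>}"
          unfolding q_def by blast
      qed
    qed auto
    let ?pq = "limit_value q"
    define \<kappa> where "\<kappa> = Q * (real (card I) * (1 / real m))"
    have \<kappa>: "\<kappa> \<le> e / 4"
    proof -
      have "4 * Q * (real (card I) + 1) < e * real m" using m e by (simp add: divide_less_eq mult.commute)
      then have "4 * (Q * real (card I)) \<le> e * real m" using Q by (simp add: algebra_simps)
      then show ?thesis unfolding \<kappa>_def using m0 by (simp add: field_simps)
    qed
    have dd: "\<bar>diag f v x - diag q v x\<bar> \<le> \<kappa>" if x: "x \<in> space M" for v x
    proof -
      have "\<bar>diag f v x - diag q v x\<bar> \<le> Q * (\<Sum>i\<in>I. \<bar>f i ((T i ^^ v i) x) - q i ((T i ^^ v i) x)\<bar>)"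
        unfolding diag_def Q_def using B qB Ti_space[OF x] by (intro abs_prod_diff_le finite_I) auto
      also have "\<dots> \<le> Q * (\<Sum>i\<in>I. 1 / real m)"
        using Q qf by (intro mult_left_mono sum_mono) auto
      finally show ?thesis unfolding \<kappa>_def by simp
    qed
    have pp: "\<bar>?p - ?pq\<bar> \<le> \<kappa>"
    proof -
      have int: "integrable (\<mu> i) (f i)" "integrable (\<mu> i) (q i)" if "i \<in> I" for i
        using f[OF that] qb[OF that] by (auto intro!: prob_space.integrable_bounded_meas prob_space_\<mu> simp: bounded_meas_\<mu>)
      have "\<bar>?p - ?pq\<bar> \<le> Q * (\<Sum>i\<in>I. \<bar>(\<integral>y. f i y \<partial>\<mu> i) - (\<integral>y. q i y \<partial>\<mu> i)\<bar>)"
        unfolding Q_def using B qB f qb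
        by (intro abs_prod_diff_le finite_I abs_integral_\<mu>_le)
      also have "\<dots> \<le> Q * (\<Sum>i\<in>I. 1 / real m)"
      proof (intro mult_left_mono sum_mono)
        fix i assume i: "i \<in> I"
        have "(\<integral>y. f i y \<partial>\<mu> i) - (\<integral>y. q i y \<partial>\<mu> i) = (\<integral>y. f i y - q i y \<partial>\<mu> i)"
          using int[OF i] by simp
        also have "\<bar>\<dots>\<bar> \<le> 1 / real m"
          by (intro abs_integral_\<mu>_le bounded_meas_diff f[OF i] qb[OF i] qf)
        finally show "\<bar>(\<integral>y. f i y \<partial>\<mu> i) - (\<integral>y. q i y \<partial>\<mu> i)\<bar> \<le> 1 / real m" .
      qed (use Q in auto)
      finally show ?thesis unfolding \<kappa>_def by simp
    qed
    have qdb: "bounded_meas M (\<lambda>x. diag_avg q N x - ?pq)" for N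
      by (intro bounded_meas_diff bounded_meas_diag_avg qb bounded_meas_const)
    have le: "(\<integral>x. \<bar>diag_avg f N x - ?p\<bar> \<partial>M) \<le> (\<integral>x. \<bar>diag_avg q N x - ?pq\<bar> \<partial>M) + 2 * \<kappa>" for N
    proof -
      have "(\<integral>x. \<bar>diag_avg f N x - ?p\<bar> \<partial>M) \<le> (\<integral>x. \<bar>diag_avg q N x - ?pq\<bar> + 2 * \<kappa> \<partial>M)"
      proof (rule integral_mono)
        fix x assume x: "x \<in> space M"
        have "\<bar>diag_avg f N x - diag_avg q N x\<bar> \<le> \<kappa>"
          unfolding cesaro_diff[symmetric] by (intro abs_cesaro_le_bound dd x)
        then show "\<bar>diag_avg f N x - ?p\<bar> \<le> \<bar>diag_avg q N x - ?pq\<bar> + 2 * \<kappa>" using pp by linarith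
      qed (intro integrable_bounded_meas bounded_meas_add bounded_meas_abs db qdb bounded_meas_const)+
      also have "\<dots> = (\<integral>x. \<bar>diag_avg q N x - ?pq\<bar> \<partial>M) + 2 * \<kappa>"
        using integrable_bounded_meas[OF bounded_meas_abs[OF qdb]] by (simp add: prob_space)
      finally show ?thesis .
    qed
    have "(\<lambda>N. \<integral>x. \<bar>diag_avg q N x - ?pq\<bar> \<partial>M) \<longlonglongrightarrow> 0"
      by (rule tendsto_L1_of_L2[OF qdb dominated_imp_jointly_ergodic_simple[OF dom erg qb qfin]])
    then have "\<forall>\<^sub>F N in sequentially. (\<integral>x. \<bar>diag_avg q N x - ?pq\<bar> \<partial>M) < e / 2"
      using e by (intro order_tendstoD(2)) auto
    then have "\<forall>\<^sub>F N in sequentially. (\<integral>x. \<bar>diag_avg f N x - ?p\<bar> \<partial>M) < e"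
    proof eventually_elim
      case (elim N)
      then show ?case using le[of N] \<kappa> by linarith
    qed
    then show "\<exists>N0. \<forall>N\<ge>N0. norm ((\<integral>x. \<bar>diag_avg f N x - ?p\<bar> \<partial>M) - 0) < e"
      unfolding eventually_sequentially by simp
  qed
  show "(\<lambda>N. \<integral>x. (diag_avg f N x - ?p)\<^sup>2 \<partial>M) \<longlonglongrightarrow> 0"
  proof (rule tendsto_L2_of_L1[OF db _ L1])
    fix N x assume x: "x \<in> space M"
    have "\<bar>diag_avg f N x\<bar> \<le> Q"
      unfolding Q_def by (intro abs_cesaro_le_bound abs_diag_le B x)
    moreover have "\<bar>?p\<bar> \<le> Q"
      unfolding Q_def using B(2) f
      by (intro abs_prod_le abs_integral_\<mu>_le)
    ultimately show "\<bar>diag_avg f N x - ?p\<bar> \<le> 2 * Q" by linarith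
  qed
qed

end

section \<open>The equivalences\<close>

context joint_systems
begin

lemma integral_mult_diag_bounded:
  assumes f0: "bounded_meas M f0" and f: "\<And>i. i \<in> I \<Longrightarrow> bounded_meas M (f i)"
  shows "\<exists>B. \<forall>v. \<bar>\<integral>x. f0 x * diag f v x \<partial>M\<bar> \<le> B"
proof -
  obtain B0 where B0: "B0 \<ge> 1" "\<And>x. x \<in> space M \<Longrightarrow> \<bar>f0 x\<bar> \<le> B0" using f0 by (metis bounded_measE)
  obtain B where B: "B \<ge> 1" "\<And>i x. i \<in> I \<Longrightarrow> x \<in> space M \<Longrightarrow> \<bar>f i x\<bar> \<le> B"
    using uniform_bound[of f] f by blast
  have "\<bar>\<integral>x. f0 x * diag f v x \<partial>M\<bar> \<le> B0 * B ^ card I" for v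
  proof (rule abs_integral_le_bound)
    show "bounded_meas M (\<lambda>x. f0 x * diag f v x)" by (intro bounded_meas_mult f0 bounded_meas_diag f)
    show "\<bar>f0 x * diag f v x\<bar> \<le> B0 * B ^ card I" if "x \<in> space M" for x
      unfolding abs_mult using B0 abs_diag_le[of f B x v] B that by (intro mult_mono) auto
  qed
  then show ?thesis by blast
qed

lemma weakly_jointly_ergodic_from_1:
  assumes f0: "bounded_meas M f0" and f: "\<And>i. i \<in> I \<Longrightarrow> bounded_meas M (f i)"
  shows "(\<lambda>N. (1 / real N) * (\<Sum>n=1..N. \<integral>x. f0 x * diag f (\<lambda>i. n) x \<partial>M)) \<longlonglongrightarrow> L \<longleftrightarrow>
    cesaro (\<lambda>n. \<integral>x. f0 x * diag f (\<lambda>i. n) x \<partial>M) \<longlonglongrightarrow> L"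
proof -
  obtain B where "\<And>v. \<bar>\<integral>x. f0 x * diag f v x \<partial>M\<bar> \<le> B"
    using integral_mult_diag_bounded[of f0 f] f0 f by blast
  then show ?thesis by (rule cesaro_from_1_tendsto_iff)
qed

text \<open>The preimages are not cut down to \<open>space M\<close>; they are measurable because
  \<open>space M\<close> is the whole type, and for nonempty \<open>I\<close> their intersection is
  a finite intersection of measurable sets.\<close>

lemma integral_diag_indicator:
  assumes "I \<noteq> {}" "space M = UNIV" and A: "\<And>i. i \<in> I \<Longrightarrow> A i \<in> sets M"
  shows "(\<integral>x. diag (\<lambda>i. indicator (A i)) v x \<partial>M) = measure M (\<Inter>i\<in>I. (T i ^^ v i) -` A i)"
proof -
  have "(T i ^^ n) -` A i \<in> sets M" if "i \<in> I" for i n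
    using measurable_sets[OF Ti_meas A[OF that], of n i] assms(2) by simp
  then have sets: "(\<Inter>i\<in>I. (T i ^^ v i) -` A i) \<in> sets M"
    using assms(1) finite_I by (intro sets.finite_INT) auto
  have "diag (\<lambda>i. indicator (A i)) v x = indicator (\<Inter>i\<in>I. (T i ^^ v i) -` A i) x" for x
  proof (cases "\<forall>i\<in>I. (T i ^^ v i) x \<in> A i")
    case True
    then show ?thesis by (simp add: diag_def)
  next
    case False
    then obtain i where "i \<in> I" "(T i ^^ v i) x \<notin> A i" by blast
    moreover from this have "(\<Prod>i\<in>I. indicator (A i) ((T i ^^ v i) x) :: real) = 0"
      by (intro prod_zero finite_I bexI[of _ i]) auto
    ultimately show ?thesis unfolding diag_def by (subst indicator_simps(2)) blast+
  qed
  then show ?thesis using sets by simp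
qed

lemma dominated_if_limsup_le:
  assumes "I \<noteq> {}" "space M = UNIV"
    and le: "\<And>A. \<forall>i\<in>I. A i \<in> sets M \<Longrightarrow>
      limsup (\<lambda>N. ereal ((1 / real N) * (\<Sum>n=1..N. measure M (\<Inter>i\<in>I. (T i ^^ n) -` A i))))
        \<le> ereal (C * (\<Prod>i\<in>I. measure (\<mu> i) (A i)))"
  shows "dominated_by C"
  unfolding dominated_by_def
proof (intro allI impI)
  fix A :: "'i \<Rightarrow> 'a set" and e :: real
  assume A: "\<forall>i\<in>I. A i \<in> sets M" and e: "e > 0"
  let ?L = "C * (\<Prod>i\<in>I. measure (\<mu> i) (A i))"
  define a where "a n = measure M (\<Inter>i\<in>I. (T i ^^ n) -` A i)" for n
  have eq: "(\<integral>x. diag (\<lambda>i. indicator (A i)) (\<lambda>i. n) x \<partial>M) = a n" for n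
    unfolding a_def using integral_diag_indicator[OF assms(1,2), of A] A by blast
  \<comment> \<open>Half of \<open>e\<close> pays for the change of range from \<open>1..N\<close>
    to \<open>0..<N\<close>, the other half for turning a limsup bound into an eventual one.\<close>
  have "\<bar>a n\<bar> \<le> 1" for n unfolding a_def by simp
  from cesaro_shift_tendsto[of a, OF this, of 1]
  have "\<forall>\<^sub>F N in sequentially. cesaro (\<lambda>n. a (Suc n)) N - cesaro a N > - (e / 2)"
    using e by (intro order_tendstoD(1)) auto
  moreover have "\<forall>\<^sub>F N in sequentially. ereal ((1 / real N) * (\<Sum>n=1..N. a n)) < ereal (?L + e / 2)"
    using le[OF A] e unfolding a_def[symmetric] by (intro Limsup_lessD) (simp add: le_less_trans)
  ultimately show "\<forall>\<^sub>F N in sequentially. cesaro (\<lambda>n. \<integral>x. diag (\<lambda>i. indicator (A i)) (\<lambda>i. n) x \<partial>M) N \<le> ?L + e"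
    unfolding eq cesaro_from_1
  proof eventually_elim
    case (elim N)
    then have "cesaro (\<lambda>n. a (Suc n)) N < ?L + e / 2" by simp
    then show ?case using elim(1) by linarith
  qed
qed

lemma limsup_le_if_tendsto:
  assumes "I \<noteq> {}" "space M = UNIV" and A: "\<forall>i\<in>I. A i \<in> sets M"
    and lim: "(\<lambda>N. (1 / real N) * (\<Sum>n=1..N. \<integral>x. diag (\<lambda>i. indicator (A i)) (\<lambda>i. n) x \<partial>M))
      \<longlonglongrightarrow> (\<Prod>i\<in>I. \<integral>y. indicator (A i) y \<partial>\<mu> i)"
  shows "limsup (\<lambda>N. ereal ((1 / real N) * (\<Sum>n=1..N. measure M (\<Inter>i\<in>I. (T i ^^ n) -` A i))))
    \<le> ereal (1 * (\<Prod>i\<in>I. measure (\<mu> i) (A i)))"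
proof -
  have p: "(\<Prod>i\<in>I. \<integral>y. indicator (A i) y \<partial>\<mu> i) = (\<Prod>i\<in>I. measure (\<mu> i) (A i))"
    using A sets_\<mu> by (intro prod.cong refl) simp
  have "(\<integral>x. diag (\<lambda>i. indicator (A i)) (\<lambda>i. n) x \<partial>M) = measure M (\<Inter>i\<in>I. (T i ^^ n) -` A i)" for n
    using integral_diag_indicator[OF assms(1,2), of A] A by blast
  then have "(\<lambda>N. ereal ((1 / real N) * (\<Sum>n=1..N. measure M (\<Inter>i\<in>I. (T i ^^ n) -` A i))))
      \<longlonglongrightarrow> ereal (\<Prod>i\<in>I. measure (\<mu> i) (A i))"
    using lim unfolding p by (intro tendsto_ereal) simp
  from lim_imp_Limsup[OF trivial_limit_sequentially this] show ?thesis by simp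
qed

end

section \<open>Translation of the stated conditions into the setting of the locale\<close>

theorem theorem7p3:
  fixes M :: "'a::metric_space measure"
    and k :: nat
    and T :: "nat \<Rightarrow> 'a \<Rightarrow> 'a"
    and \<mu> :: "nat \<Rightarrow> 'a measure"
  assumes compactX: "compact (UNIV :: 'a set)"
    and k: "k \<ge> 1"
    and M_prob: "prob_space M"
    and M_borel: "sets M = sets borel"
    and mu_prob: "\<And>i. i \<in> {1..k} \<Longrightarrow> prob_space (\<mu> i)"
    and mu_equiv: "\<And>i. i \<in> {1..k} \<Longrightarrow> equivalent_measures (\<mu> i) M"
    and T_inv: "\<And>i. i \<in> {1..k} \<Longrightarrow> invariant_measure (\<mu> i) (T i)"
  shows
   "((\<forall>f :: nat \<Rightarrow> 'a \<Rightarrow> real. (\<forall>i\<in>{1..k}. bounded_meas M (f i)) \<longrightarrow>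
        (\<lambda>N. \<integral>x. ((1 / real N) * (\<Sum>n<N. \<Prod>i\<in>{1..k}. f i ((T i ^^ n) x))
                    - (\<Prod>i\<in>{1..k}. \<integral>y. f i y \<partial>\<mu> i))\<^sup>2 \<partial>M)
        \<longlonglongrightarrow> 0)
     \<longleftrightarrow>
     (\<forall>f :: nat \<Rightarrow> 'a \<Rightarrow> real. (\<forall>i\<in>{0..k}. bounded_meas M (f i)) \<longrightarrow>
        (\<lambda>N. (1 / real N) * (\<Sum>n=1..N. \<integral>x. f 0 x * (\<Prod>i\<in>{1..k}. f i ((T i ^^ n) x)) \<partial>M))
        \<longlonglongrightarrow> (\<integral>x. f 0 x \<partial>M) * (\<Prod>i\<in>{1..k}. \<integral>y. f i y \<partial>\<mu> i)))
    \<and>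
    ((\<forall>f :: nat \<Rightarrow> 'a \<Rightarrow> real. (\<forall>i\<in>{0..k}. bounded_meas M (f i)) \<longrightarrow>
        (\<lambda>N. (1 / real N) * (\<Sum>n=1..N. \<integral>x. f 0 x * (\<Prod>i\<in>{1..k}. f i ((T i ^^ n) x)) \<partial>M))
        \<longlonglongrightarrow> (\<integral>x. f 0 x \<partial>M) * (\<Prod>i\<in>{1..k}. \<integral>y. f i y \<partial>\<mu> i))
     \<longleftrightarrow>
     (ergodic (PiM {1..k} \<mu>) (product_map k T) \<and>
      (\<forall>f :: nat \<Rightarrow> 'a \<Rightarrow> real. (\<forall>i\<in>{1..k}. bounded_meas M (f i)) \<longrightarrow>
        (\<lambda>N. (1 / real N) * (\<Sum>n=1..N. \<integral>x. (\<Prod>i\<in>{1..k}. f i ((T i ^^ n) x)) \<partial>M))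
        \<longlonglongrightarrow> (\<Prod>i\<in>{1..k}. \<integral>y. f i y \<partial>\<mu> i))))
    \<and>
    ((ergodic (PiM {1..k} \<mu>) (product_map k T) \<and>
      (\<forall>f :: nat \<Rightarrow> 'a \<Rightarrow> real. (\<forall>i\<in>{1..k}. bounded_meas M (f i)) \<longrightarrow>
        (\<lambda>N. (1 / real N) * (\<Sum>n=1..N. \<integral>x. (\<Prod>i\<in>{1..k}. f i ((T i ^^ n) x)) \<partial>M))
        \<longlonglongrightarrow> (\<Prod>i\<in>{1..k}. \<integral>y. f i y \<partial>\<mu> i)))
     \<longleftrightarrow>
     (ergodic (PiM {1..k} \<mu>) (product_map k T) \<and>
      (\<exists>C>0. \<forall>A :: nat \<Rightarrow> 'a set. (\<forall>i\<in>{1..k}. A i \<in> sets M) \<longrightarrow>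
         limsup (\<lambda>N. ereal ((1 / real N) *
            (\<Sum>n=1..N. measure M (\<Inter>i\<in>{1..k}. (T i ^^ n) -` A i))))
         \<le> ereal (C * (\<Prod>i\<in>{1..k}. measure (\<mu> i) (A i))))))"
proof -
  \<comment> \<open>Outside \<open>{1..k}\<close> nothing is known about \<open>\<mu>\<close> and
    \<open>T\<close>, whereas the locale speaks of all indices; the identity on \<open>M\<close>
    fills the gap.\<close>
  define \<mu>' where "\<mu>' i = (if i \<in> {1..k} then \<mu> i else M)" for i
  define T' where "T' i = (if i \<in> {1..k} then T i else id)" for i
  have "invariant_measure M id" unfolding invariant_measure_def by (simp add: distr_id2 id_def)
  then have inv': "prob_space (\<mu>' i)" "invariant_measure (\<mu>' i) (T' i)" "equivalent_measures (\<mu>' i) M" for i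
    using mu_prob T_inv mu_equiv M_prob by (auto simp: \<mu>'_def T'_def equivalent_measures_def)
  interpret M: prob_space M by (rule M_prob)
  have "measure_preserving (\<mu>' i) (T' i)" for i using inv' by (simp add: measure_preserving_def measure_preserving_axioms_def)
  then interpret J: joint_systems M "{1..k}" \<mu>' T'
    using inv'(3) by (intro joint_systems.intro M_prob joint_systems_axioms.intro)
      (simp_all add: equivalent_measures_def)
  have space: "space M = UNIV" using sets_eq_imp_space_eq[OF M_borel] by simp
  have ne: "{1..k} \<noteq> {}" using k by simp
  have \<mu>: "\<mu>' i = \<mu> i" and T: "T' i = T i" if "i \<in> {1..k}" for i using that by (auto simp: \<mu>'_def T'_def)
  have diag: "J.diag f v x = (\<Prod>i\<in>{1..k}. f i ((T i ^^ v i) x))" for f v x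
    unfolding J.diag_def by (intro prod.cong refl) (simp add: T)
  have val: "J.limit_value f = (\<Prod>i\<in>{1..k}. \<integral>y. f i y \<partial>\<mu> i)" for f :: "nat \<Rightarrow> 'a \<Rightarrow> real"
    by (intro prod.cong refl) (simp add: \<mu>)
  have meas: "(\<Prod>i\<in>{1..k}. measure (\<mu>' i) (A i)) = (\<Prod>i\<in>{1..k}. measure (\<mu> i) (A i))" for A
    by (intro prod.cong refl) (simp add: \<mu>)
  have inter: "(\<Inter>i\<in>{1..k}. (T' i ^^ n) -` A i) = (\<Inter>i\<in>{1..k}. (T i ^^ n) -` A i)" for n A
    by (intro INF_cong refl) (simp add: T)
  have "PiM {1..k} \<mu>' = PiM {1..k} \<mu>" by (intro PiM_cong refl \<mu>)
  moreover have "J.prod_map = product_map k T"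
    unfolding J.prod_map_def[abs_def] product_map_def by (intro ext restrict_ext) (simp add: T)
  ultimately have erg: "ergodic J.\<nu> J.prod_map \<longleftrightarrow> ergodic (PiM {1..k} \<mu>) (product_map k T)" by simp
  let ?III = "\<forall>f :: nat \<Rightarrow> 'a \<Rightarrow> real. (\<forall>i\<in>{1..k}. bounded_meas M (f i)) \<longrightarrow>
        (\<lambda>N. (1 / real N) * (\<Sum>n=1..N. \<integral>x. (\<Prod>i\<in>{1..k}. f i ((T i ^^ n) x)) \<partial>M))
        \<longlonglongrightarrow> (\<Prod>i\<in>{1..k}. \<integral>y. f i y \<partial>\<mu> i)"
  let ?IV = "\<exists>C>0. \<forall>A :: nat \<Rightarrow> 'a set. (\<forall>i\<in>{1..k}. A i \<in> sets M) \<longrightarrow>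
         limsup (\<lambda>N. ereal ((1 / real N) *
            (\<Sum>n=1..N. measure M (\<Inter>i\<in>{1..k}. (T i ^^ n) -` A i))))
         \<le> ereal (C * (\<Prod>i\<in>{1..k}. measure (\<mu> i) (A i)))"
  have I: "(\<forall>f :: nat \<Rightarrow> 'a \<Rightarrow> real. (\<forall>i\<in>{1..k}. bounded_meas M (f i)) \<longrightarrow>
        (\<lambda>N. \<integral>x. ((1 / real N) * (\<Sum>n<N. \<Prod>i\<in>{1..k}. f i ((T i ^^ n) x))
                    - (\<Prod>i\<in>{1..k}. \<integral>y. f i y \<partial>\<mu> i))\<^sup>2 \<partial>M)
        \<longlonglongrightarrow> 0) \<longleftrightarrow> J.jointly_ergodic"
    unfolding J.jointly_ergodic_def cesaro_def diag val ..
  have from_1: "(\<lambda>N. (1 / real N) * (\<Sum>n=1..N. \<integral>x. f0 x * (\<Prod>i\<in>{1..k}. f i ((T i ^^ n) x)) \<partial>M)) \<longlonglongrightarrow> L \<longleftrightarrow>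
      cesaro (\<lambda>n. \<integral>x. f0 x * J.diag f (\<lambda>i. n) x \<partial>M) \<longlonglongrightarrow> L"
    if "bounded_meas M f0" "\<And>i. i \<in> {1..k} \<Longrightarrow> bounded_meas M (f i)" for f0 f L
    using J.weakly_jointly_ergodic_from_1[of f0 f L] that unfolding diag by blast
  have II: "(\<forall>f :: nat \<Rightarrow> 'a \<Rightarrow> real. (\<forall>i\<in>{0..k}. bounded_meas M (f i)) \<longrightarrow>
        (\<lambda>N. (1 / real N) * (\<Sum>n=1..N. \<integral>x. f 0 x * (\<Prod>i\<in>{1..k}. f i ((T i ^^ n) x)) \<partial>M))
        \<longlonglongrightarrow> (\<integral>x. f 0 x \<partial>M) * (\<Prod>i\<in>{1..k}. \<integral>y. f i y \<partial>\<mu> i)) \<longleftrightarrow> J.weakly_jointly_ergodic"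
    (is "?L \<longleftrightarrow> _")
  proof
    assume L: ?L
    show J.weakly_jointly_ergodic
      unfolding J.weakly_jointly_ergodic_def
    proof (intro allI impI)
      fix f0 and f :: "nat \<Rightarrow> 'a \<Rightarrow> real"
      assume b: "bounded_meas M f0" "\<forall>i\<in>{1..k}. bounded_meas M (f i)"
      \<comment> \<open>The stated condition keeps the test function at index 0 of the family, which
        lies outside \<open>{1..k}\<close> and is free.\<close>
      define g where "g i = (if i = 0 then f0 else f i)" for i
      have g: "\<forall>i\<in>{0..k}. bounded_meas M (g i)" using b unfolding g_def by auto
      have gi: "g 0 = f0" "\<And>i. i \<in> {1..k} \<Longrightarrow> g i = f i" unfolding g_def by auto
      have e1: "(\<Prod>i\<in>{1..k}. g i ((T i ^^ n) x)) = (\<Prod>i\<in>{1..k}. f i ((T i ^^ n) x))" for n x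
        by (intro prod.cong refl) (simp add: gi(2))
      have e2: "(\<Prod>i\<in>{1..k}. \<integral>y. g i y \<partial>\<mu> i) = (\<Prod>i\<in>{1..k}. \<integral>y. f i y \<partial>\<mu> i)"
        by (intro prod.cong refl) (simp add: gi(2))
      have "(\<lambda>N. (1 / real N) * (\<Sum>n=1..N. \<integral>x. f0 x * (\<Prod>i\<in>{1..k}. f i ((T i ^^ n) x)) \<partial>M))
        \<longlonglongrightarrow> (\<integral>x. f0 x \<partial>M) * (\<Prod>i\<in>{1..k}. \<integral>y. f i y \<partial>\<mu> i)"
        using mp[OF spec[OF L] g] unfolding e1 e2 gi(1) .
      then show "cesaro (\<lambda>n. \<integral>x. f0 x * J.diag f (\<lambda>i. n) x \<partial>M) \<longlonglongrightarrow> (\<integral>x. f0 x \<partial>M) * J.limit_value f"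
        unfolding val using b by (subst (asm) from_1) auto
    qed
  next
    assume W: J.weakly_jointly_ergodic
    show ?L
    proof (intro allI impI)
      fix f :: "nat \<Rightarrow> 'a \<Rightarrow> real" assume f: "\<forall>i\<in>{0..k}. bounded_meas M (f i)"
      then have b: "bounded_meas M (f 0)" "\<forall>i\<in>{1..k}. bounded_meas M (f i)" by auto
      show "(\<lambda>N. (1 / real N) * (\<Sum>n=1..N. \<integral>x. f 0 x * (\<Prod>i\<in>{1..k}. f i ((T i ^^ n) x)) \<partial>M))
        \<longlonglongrightarrow> (\<integral>x. f 0 x \<partial>M) * (\<Prod>i\<in>{1..k}. \<integral>y. f i y \<partial>\<mu> i)"
        using W[unfolded J.weakly_jointly_ergodic_def val, rule_format, of "f 0" f] b
        by (subst from_1) auto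
    qed
  qed
  have III: ?III if W: J.weakly_jointly_ergodic
  proof (intro allI impI)
    fix f :: "nat \<Rightarrow> 'a \<Rightarrow> real" assume f: "\<forall>i\<in>{1..k}. bounded_meas M (f i)"
    \<comment> \<open>Testing against the constant 1 gives the convergence without
      \<open>f 0\<close>.\<close>
    have c: "bounded_meas M (\<lambda>x. 1)" by (rule bounded_meas_const)
    have "cesaro (\<lambda>n. \<integral>x. 1 * J.diag f (\<lambda>i. n) x \<partial>M) \<longlonglongrightarrow> (\<integral>x. 1 \<partial>M) * J.limit_value f"
      using W c f unfolding J.weakly_jointly_ergodic_def by blast
    then have "(\<lambda>N. (1 / real N) * (\<Sum>n=1..N. \<integral>x. 1 * (\<Prod>i\<in>{1..k}. f i ((T i ^^ n) x)) \<partial>M))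
        \<longlonglongrightarrow> (\<integral>x. 1 \<partial>M) * (\<Prod>i\<in>{1..k}. \<integral>y. f i y \<partial>\<mu> i)"
      unfolding val using f c by (subst from_1) auto
    then show "(\<lambda>N. (1 / real N) * (\<Sum>n=1..N. \<integral>x. (\<Prod>i\<in>{1..k}. f i ((T i ^^ n) x)) \<partial>M))
        \<longlonglongrightarrow> (\<Prod>i\<in>{1..k}. \<integral>y. f i y \<partial>\<mu> i)" by (simp add: M.prob_space)
  qed
  have IV: ?IV if F: ?III
  proof (intro exI[of _ 1] conjI allI impI)
    fix A :: "nat \<Rightarrow> 'a set" assume A: "\<forall>i\<in>{1..k}. A i \<in> sets M"
    have "(\<lambda>N. (1 / real N) * (\<Sum>n=1..N. \<integral>x. J.diag (\<lambda>i. indicator (A i)) (\<lambda>i. n) x \<partial>M))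
        \<longlonglongrightarrow> J.limit_value (\<lambda>i. indicator (A i))"
      using F[rule_format, of "\<lambda>i. indicator (A i)"] A bounded_meas_indicator unfolding diag val by blast
    from J.limsup_le_if_tendsto[OF ne space A this]
    show "limsup (\<lambda>N. ereal ((1 / real N) * (\<Sum>n=1..N. measure M (\<Inter>i\<in>{1..k}. (T i ^^ n) -` A i))))
         \<le> ereal (1 * (\<Prod>i\<in>{1..k}. measure (\<mu> i) (A i)))"
      unfolding meas inter .
  qed simp
  have V: "\<exists>C>0. J.dominated_by C" if ?IV
  proof -
    from that obtain C where C: "C > 0" "\<And>A. \<forall>i\<in>{1..k}. A i \<in> sets M \<Longrightarrow>
         limsup (\<lambda>N. ereal ((1 / real N) * (\<Sum>n=1..N. measure M (\<Inter>i\<in>{1..k}. (T i ^^ n) -` A i))))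
         \<le> ereal (C * (\<Prod>i\<in>{1..k}. measure (\<mu> i) (A i)))" by blast
    have "J.dominated_by C"
      by (rule J.dominated_if_limsup_le[OF ne space]) (unfold meas inter, rule C(2))
    then show ?thesis using C(1) by blast
  qed
  \<comment> \<open>The implications close the cycle (i), (ii), (iii), (iv), (i).\<close>
  show ?thesis
    unfolding I II
    using III IV V erg J.jointly_ergodic_imp_weakly J.weakly_jointly_ergodic_imp_ergodic_prod
      J.dominated_imp_jointly_ergodic by blast
qed

end
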